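(* Let $\Gamma_l$ be a $K_B$-bounded contour with $\mathcal V_0(B,\Gamma_l)<\frac14d_0^2(\Gamma_l)$, and let $H_1^{(l)}=A_1+X^{(l)}$, where $X^{(l)}$, $\|X^{(l)}\|\le r_0(B)$, is the solution of $X=V_1(A_1+X,\Gamma_l)$ described in the context. Then for every $z\in\mathbb C\setminus(\sigma'(A_0)\cup\Gamma_l)$ the transfer function $M_1(z,\Gamma_l)$ admits the factorization $$M_1(z,\Gamma_l)=W_1(z,\Gamma_l)\,(H_1^{(l)}-z),$$ where $W_1(z,\Gamma_l)$ is the bounded operator in $\mathcal H_1$ given by $$W_1(z,\Gamma_l)=I_1-\int_{\sigma'(A_0)\cup\Gamma_l}K_B(d\mu)\,\frac1{\mu-z}\,(H_1^{(l)}-\mu)^{-1},$$ $I_1$ being the identity operator in $\mathcal H_1$. Moreover, if $\operatorname{dist}\{z,\sigma(A_1)\}\le d_0(\Gamma_l)/2$, then $W_1(z,\Gamma_l)$ is boundedly invertible and $$\bigl\|[W_1(z,\Gamma_l)]^{-1}\bigr\|\le\left(1-\frac{\mathcal V_0(B,\Gamma_l)}{d_0^2(\Gamma_l)/4}\right)^{-1}<\infty.$$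
   Context: Setting. $\mathcal H_0,\mathcal H_1$ are separable Hilbert spaces; $A_0$, $A_1$ are (possibly unbounded) self-adjoint operators in $\mathcal H_0$, $\mathcal H_1$; $B_{01}:\mathcal H_1\to\mathcal H_0$ is bounded and $B_{10}=B_{01}^*$. $E_0$ is the spectral measure of $A_0$, $E^0(\mu)=E_0((-\infty,\mu))$, and $K_B(\mu)=B_{10}E^0(\mu)B_{01}$. Spectral assumptions. There are finitely many pairwise disjoint open intervals $\Delta_k^0=(\mu_k^{(1)},\mu_k^{(2)})$, $k=1,\dots,m$ ($1\le m<\infty$, $-\infty\le\mu_1^{(1)}$, $\mu_m^{(2)}\le+\infty$), contained in the continuous spectrum $\sigma_c(A_0)$ (no eigenvalues of $A_0$ lie in them), with $\Delta_k^0\cap\sigma(A_1)\ne\emptyset$ for all $k$ and $\sigma(A_1)\cap\sigma'(A_0)=\emptyset$, where $\sigma'(A_0)=\sigma(A_0)\setminus\bigcup_{k=1}^m\Delta_k^0$. Analyticity assumptions. On each $\Delta_k^0$ the function $K_B(\mu)$ is differentiable in operator norm; $K_B'$ is continuous on $\overline{\Delta_k^0}$ and has an analytic continuation from $\Delta_k^0$ to a simply connected domain $D_k^-\subset\mathbb C^-$ whose boundary contains $\Delta_k^0$ (the $D_k^-$ are mutually disjoint for different $k$), hence also to $D_k^+=\{z:\bar z\in D_k^-\}$; the continuations are still denoted $K_B'$. At finite end points $\mu_k^{(i)}$, $\|K'_B(\mu)-K'_B(\mu_k^{(i)})\|\le C|\mu-\mu_k^{(i)}|^\gamma$ for $\mu\in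 D_k^\pm$, with some $C,\gamma>0$. Contours. For $l=(l_1,\dots,l_m)$, $l_k=\pm1$, put $D_l=\bigcup_kD_k^{l_k}$, where $D_k^{\pm1}=D_k^\pm$. A contour $\Gamma_l=\bigcup_k\Gamma_k^{l_k}$ consists of rectifiable Jordan curves $\Gamma_k^{l_k}$ in $D_k^{l_k}$ obtained by continuous deformation of $\Delta_k^0$ with the (finite) end points kept fixed, whose closures have no points in common with $\sigma_c(A_0)$ other than end points. The modified variation is $$\mathcal V_0(B,\Gamma_l)=\sup_{\{\delta_k\}}\sum_k\|B_{10}E_0(\delta_k\cap\sigma'(A_0))B_{01}\|+\int_{\Gamma_l}|d\mu|\,\|K_B'(\mu)\|,$$ the supremum over finite or countable partitions of $\sigma(A_0)$ into disjoint Borel sets. $\Gamma_l$ is $K_B$-bounded if $\mathcal V_0(B,\Gamma_l)<\infty$. $d_0(\Gamma_l)=\operatorname{dist}\{\sigma(A_1),\sigma'(A_0)\cup\Gamma_l\}$. Integrals and transfer function. $\int_{\sigma'(A_0)\cup\Gamma}K_B(d\mu)T(\mu):=\int_{\sigma'(A_0)}B_{10}E_0(d\mu)B_{01}T(\mu)+\int_\Gamma d\mu\,K_B'(\mu)T(\mu)$. Put $V_1(z,\Gamma_l)=\int_{\sigma'(A_0)\cup\Gamma_l}K_B(d\mu)\frac1{z-\mu}$, $M_1(z,\Gamma_l)=A_1-z+V_1(z,\Gamma_l)$, and, for an operator $Y$ in $\mathcal H_1$ with spectrum separated from $\sigma'(A_0)\cup\Gamma_l$, $V_1(Y,\Gamma_l)=\int_{\sigma'(A_0)\cup\Gamma_l}K_B(d\mu)(Y-\mu)^{-1}$.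 The operators $X^{(l)},H_1^{(l)}$. If $\Gamma_l\subset D_l$ is $K_B$-bounded with $\mathcal V_0(B,\Gamma_l)<\frac14d_0^2(\Gamma_l)$, then $X=V_1(A_1+X,\Gamma_l)$ has a unique bounded solution $X^{(l)}$ with $\|X^{(l)}\|\le r_{\min}(\Gamma_l):=\frac{d_0(\Gamma_l)}2-\sqrt{\frac{d_0^2(\Gamma_l)}4-\mathcal V_0(B,\Gamma_l)}$; for fixed $l$ it is the same for all such contours, and $\|X^{(l)}\|\le r_0(B):=\inf r_{\min}(\Gamma_l)$, the infimum over all such contours in $D_l$ (its value does not depend on $l$). *)

theory Defs
  imports "HOL-Analysis.Analysis"
begin

section \<open>Complex Hilbert spaces\<close>

class complex_normed = real_normed_vector +
  fixes scaleC :: "complex \<Rightarrow> 'a \<Rightarrow> 'a"  (infixr \<open>*\<^sub>C\<close> 75)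
  assumes scaleC_add_right: "c *\<^sub>C (x + y) = c *\<^sub>C x + c *\<^sub>C y"
    and scaleC_add_left: "(c + d) *\<^sub>C x = c *\<^sub>C x + d *\<^sub>C x"
    and scaleC_scaleC: "c *\<^sub>C d *\<^sub>C x = (c * d) *\<^sub>C x"
    and scaleR_scaleC: "r *\<^sub>R x = complex_of_real r *\<^sub>C x"
    and norm_scaleC: "norm (c *\<^sub>C x) = cmod c * norm x"

text \<open>The real inner product, and with it the norm and the topology, comes from
  \<open>real_inner\<close>; \<open>cinner\<close> is linear in its first argument.\<close>

class complex_hilbert = complex_normed + real_inner + banach +
  fixes cinner :: "'a \<Rightarrow> 'a \<Rightarrow> complex"
  assumes cinner_commute: "cinner x y = cnj (cinner y x)"
    and cinner_add_left: "cinner (x + y) u = cinner x u + cinner y u"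
    and cinner_scaleC_left: "cinner (c *\<^sub>C x) y = c * cinner x y"
    and inner_eq_Re_cinner: "inner x y = Re (cinner x y)"

instantiation complex :: complex_hilbert
begin
definition scaleC_complex :: "complex \<Rightarrow> complex \<Rightarrow> complex" where
  "scaleC_complex c x = c * x"
definition cinner_complex :: "complex \<Rightarrow> complex \<Rightarrow> complex" where
  "cinner_complex x y = x * cnj y"
instance
  by standard (auto simp: scaleC_complex_def cinner_complex_def algebra_simps
      scaleR_conv_of_real norm_mult inner_complex_def)
end

instantiation blinfun :: (real_normed_vector, complex_normed) complex_normed
begin

lift_definition scaleC_blinfun :: "complex \<Rightarrow> 'a \<Rightarrow>\<^sub>L 'b \<Rightarrow> 'a \<Rightarrow>\<^sub>L 'b"
  is "\<lambda>c T x. c *\<^sub>C T x"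
proof -
  fix c :: complex and T :: "'a \<Rightarrow> 'b"
  assume T: "bounded_linear T"
  obtain K where K: "\<And>x. norm (T x) \<le> norm x * K"
    using bounded_linear.bounded[OF T] by blast
  show "bounded_linear (\<lambda>x. c *\<^sub>C T x)"
  proof (rule bounded_linear_intro[where K = "K * cmod c"])
    show "c *\<^sub>C T (x + y) = c *\<^sub>C T x + c *\<^sub>C T y" for x y
      by (simp add: linear_add[OF bounded_linear.linear[OF T]] scaleC_add_right)
    show "c *\<^sub>C T (r *\<^sub>R x) = r *\<^sub>R c *\<^sub>C T x" for r x
      by (simp add: linear_scale[OF bounded_linear.linear[OF T]] scaleR_scaleC scaleC_scaleC
          mult.commute)
    show "norm (c *\<^sub>C T x) \<le> norm x * (K * cmod c)" for x
      using mult_left_mono[OF K[of x] norm_ge_zero[of c]]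
      by (simp add: norm_scaleC mult_ac)
  qed
qed

instance
proof
  fix c d :: complex and S T :: "'a \<Rightarrow>\<^sub>L 'b" and r :: real
  show "c *\<^sub>C (S + T) = c *\<^sub>C S + c *\<^sub>C T"
    by transfer (simp add: scaleC_add_right)
  show "(c + d) *\<^sub>C T = c *\<^sub>C T + d *\<^sub>C T"
    by transfer (simp add: scaleC_add_left)
  show comp: "c *\<^sub>C d *\<^sub>C T = (c * d) *\<^sub>C T" for c d :: complex and T :: "'a \<Rightarrow>\<^sub>L 'b"
    by transfer (simp add: scaleC_scaleC)
  show real: "r *\<^sub>R T = complex_of_real r *\<^sub>C T" for r and T :: "'a \<Rightarrow>\<^sub>L 'b"
    by transfer (simp add: scaleR_scaleC)
  have le: "norm (c *\<^sub>C T) \<le> cmod c * norm T" for c and T :: "'a \<Rightarrow>\<^sub>L 'b"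
  proof (rule norm_blinfun_bound)
    fix x
    have "norm (blinfun_apply (c *\<^sub>C T) x) = cmod c * norm (T x)"
      by (simp add: scaleC_blinfun.rep_eq norm_scaleC)
    also have "\<dots> \<le> cmod c * norm T * norm x"
      using norm_blinfun[of T x] by (simp add: mult_left_mono mult.assoc)
    finally show "norm (blinfun_apply (c *\<^sub>C T) x) \<le> cmod c * norm T * norm x" .
  qed simp
  show "norm (c *\<^sub>C T) = cmod c * norm T"
  proof (cases "c = 0")
    case True
    then show ?thesis using le[of c T] by simp
  next
    case False
    have "inverse c *\<^sub>C c *\<^sub>C T = T"
      using False real[of 1 T] by (simp add: comp)
    then have "norm T \<le> cmod (inverse c) * norm (c *\<^sub>C T)"
      using le[of "inverse c" "c *\<^sub>C T"] by simp
    then have "cmod c * norm T \<le> norm (c *\<^sub>C T)"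
      using False by (simp add: norm_inverse norm_divide field_simps)
    then show ?thesis using le[of c T] by simp
  qed
qed

end

section \<open>Bounded and unbounded operators\<close>

text \<open>A bounded operator is a \<open>blinfun\<close> (which only knows real linearity) that commutes with
  complex scalars; its norm is the operator norm.  A possibly unbounded operator is represented
  by its graph, so that equality of operators includes equality of their domains, and
  the inverse of an operator is the converse of its graph.\<close>

definition clinear_op :: "'a::complex_normed \<Rightarrow>\<^sub>L 'b::complex_normed \<Rightarrow> bool" where
  "clinear_op T \<longleftrightarrow> (\<forall>c x. T (c *\<^sub>C x) = c *\<^sub>C T x)"

definition is_adjoint ::
    "'b::complex_hilbert \<Rightarrow>\<^sub>L 'a::complex_hilbert \<Rightarrow> 'a \<Rightarrow>\<^sub>L 'b \<Rightarrow> bool" where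
  "is_adjoint T' T \<longleftrightarrow> (\<forall>x y. cinner (T x) y = cinner x (T' y))"

type_synonym 'a opgraph = "('a \<times> 'a) set"

definition graph :: "'a::real_normed_vector \<Rightarrow>\<^sub>L 'a \<Rightarrow> 'a opgraph" where
  "graph T = {(x, T x) | x. True}"

definition lin_op :: "'a::complex_normed opgraph \<Rightarrow> bool" where
  "lin_op A \<longleftrightarrow> single_valued A \<and> (0, 0) \<in> A \<and>
     (\<forall>x y u v. (x, y) \<in> A \<longrightarrow> (u, v) \<in> A \<longrightarrow> (x + u, y + v) \<in> A) \<and>
     (\<forall>c x y. (x, y) \<in> A \<longrightarrow> (c *\<^sub>C x, c *\<^sub>C y) \<in> A)"

definition adj_graph :: "'a::complex_hilbert opgraph \<Rightarrow> 'a opgraph" where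
  "adj_graph A = {(x, y). \<forall>(u, v) \<in> A. cinner v x = cinner u y}"

definition self_adjoint_op :: "'a::complex_hilbert opgraph \<Rightarrow> bool" where
  "self_adjoint_op A \<longleftrightarrow> lin_op A \<and> closure (Domain A) = UNIV \<and> adj_graph A = A"

definition op_add :: "'a::complex_normed opgraph \<Rightarrow> 'a \<Rightarrow>\<^sub>L 'a \<Rightarrow> 'a opgraph" where
  "op_add A T = {(x, y + T x) | x y. (x, y) \<in> A}"

definition op_shift :: "'a::complex_normed opgraph \<Rightarrow> complex \<Rightarrow> 'a opgraph" where
  "op_shift A z = {(x, y - z *\<^sub>C x) | x y. (x, y) \<in> A}"

definition op_comp :: "'a::complex_normed \<Rightarrow>\<^sub>L 'a \<Rightarrow> 'a opgraph \<Rightarrow> 'a opgraph" where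
  "op_comp T A = {(x, T y) | x y. (x, y) \<in> A}"

definition resolvent_set :: "'a::complex_normed opgraph \<Rightarrow> complex set" where
  "resolvent_set A = {z. \<exists>R. clinear_op R \<and> (op_shift A z)\<inverse> = graph R}"

definition op_spectrum :: "'a::complex_normed opgraph \<Rightarrow> complex set" where
  "op_spectrum A = - resolvent_set A"

definition resolvent :: "'a::complex_normed opgraph \<Rightarrow> complex \<Rightarrow> 'a \<Rightarrow>\<^sub>L 'a" where
  "resolvent A z = (THE R. (op_shift A z)\<inverse> = graph R)"

definition continuous_spectrum :: "'a::complex_normed opgraph \<Rightarrow> complex set" where
  "continuous_spectrum A = {z \<in> op_spectrum A.
     (\<forall>x. (x, z *\<^sub>C x) \<in> A \<longrightarrow> x = 0) \<and> closure (Range (op_shift A z)) = UNIV}"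

section \<open>Integration with respect to an operator-valued measure\<close>

text \<open>The integral of \<open>T\<close> over \<open>S\<close> against \<open>M\<close> (measure on the left) is the limit, in operator
  norm, of the sums of \<open>M \<delta> T(\<xi>\<^sub>\<delta>)\<close> along refinement of finite Borel partitions of \<open>S\<close>.\<close>

definition borel_partition :: "real set \<Rightarrow> real set set \<Rightarrow> bool" where
  "borel_partition S P \<longleftrightarrow> finite P \<and> P \<subseteq> sets borel \<and> partition_on S P"

definition has_op_integral :: "(real set \<Rightarrow> 'b \<Rightarrow>\<^sub>L 'c) \<Rightarrow> real set \<Rightarrow>
    (real \<Rightarrow> 'a::complex_normed \<Rightarrow>\<^sub>L 'b::complex_normed) \<Rightarrow>
    ('a \<Rightarrow>\<^sub>L 'c::complex_normed) \<Rightarrow> bool" where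
  "has_op_integral M S T I \<longleftrightarrow>
     (\<forall>\<epsilon>>0. \<exists>P\<^sub>0. borel_partition S P\<^sub>0 \<and>
        (\<forall>P \<xi>. borel_partition S P \<and> refines S P P\<^sub>0 \<and> (\<forall>\<delta>\<in>P. \<xi> \<delta> \<in> \<delta>) \<longrightarrow>
           norm ((\<Sum>\<delta>\<in>P. M \<delta> o\<^sub>L T (\<xi> \<delta>)) - I) < \<epsilon>))"

definition op_integral :: "(real set \<Rightarrow> 'b \<Rightarrow>\<^sub>L 'c) \<Rightarrow> real set \<Rightarrow>
    (real \<Rightarrow> 'a::complex_normed \<Rightarrow>\<^sub>L 'b::complex_normed) \<Rightarrow>
    'a \<Rightarrow>\<^sub>L 'c::complex_normed" where
  "op_integral M S T = (THE I. has_op_integral M S T I)"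

definition projection_measure :: "(real set \<Rightarrow> 'a::complex_hilbert \<Rightarrow>\<^sub>L 'a) \<Rightarrow> bool" where
  "projection_measure E \<longleftrightarrow>
     (\<forall>\<delta>\<in>sets borel. clinear_op (E \<delta>) \<and> E \<delta> o\<^sub>L E \<delta> = E \<delta> \<and> is_adjoint (E \<delta>) (E \<delta>)) \<and>
     E UNIV = id_blinfun \<and>
     (\<forall>\<delta>::nat \<Rightarrow> real set. range \<delta> \<subseteq> sets borel \<and> disjoint_family \<delta> \<longrightarrow>
        (\<forall>x. (\<lambda>n. E (\<delta> n) x) sums E (\<Union>n. \<delta> n) x))"

text \<open>The second conjunct says that \<open>A = \<integral> \<mu> E(d\<mu>)\<close>: the domain of \<open>A\<close> consists of the vectors for
  which the truncated integrals over \<open>[-n, n]\<close> converge.\<close>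

definition spectral_measure_of ::
    "(real set \<Rightarrow> 'a::complex_hilbert \<Rightarrow>\<^sub>L 'a) \<Rightarrow> 'a opgraph \<Rightarrow> bool" where
  "spectral_measure_of E A \<longleftrightarrow> projection_measure E \<and>
     A = {(x, y). (\<lambda>n::nat. op_integral E {- real n..real n}
                     (\<lambda>\<mu>. complex_of_real \<mu> *\<^sub>C id_blinfun) x) \<longlonglongrightarrow> y}"

section \<open>Curves and line integrals\<close>

definition arc_length :: "(real \<Rightarrow> complex) \<Rightarrow> real \<Rightarrow> real \<Rightarrow> ennreal" where
  "arc_length \<gamma> s t =
     (SUP d \<in> {d. d division_of {s..t}}. \<Sum>J\<in>d. ennreal (dist (\<gamma> (Inf J)) (\<gamma> (Sup J))))"

text \<open>Riemann-Stieltjes integral of \<open>F(\<mu>) d\<mu>\<close> along the restriction of \<open>\<gamma>\<close> to \<open>[s, t]\<close>.\<close>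

definition has_rs_integral :: "(real \<Rightarrow> complex) \<Rightarrow> (complex \<Rightarrow> 'c::complex_normed) \<Rightarrow>
    real \<Rightarrow> real \<Rightarrow> 'c \<Rightarrow> bool" where
  "has_rs_integral \<gamma> F s t I \<longleftrightarrow>
     (\<forall>\<epsilon>>0. \<exists>d>0. \<forall>p. p tagged_division_of {s..t} \<and> (\<lambda>x. ball x d) fine p \<longrightarrow>
        norm ((\<Sum>(x, J)\<in>p. (\<gamma> (Sup J) - \<gamma> (Inf J)) *\<^sub>C F (\<gamma> x)) - I) < \<epsilon>)"

text \<open>Line integral along a curve parametrized by the open, possibly infinite, interval
  \<open>(a, b)\<close>: the limit of the integrals over compact subintervals exhausting \<open>(a, b)\<close>.\<close>

definition has_line_integral :: "ereal \<Rightarrow> ereal \<Rightarrow> (real \<Rightarrow> complex) \<Rightarrow>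
    (complex \<Rightarrow> 'c::complex_normed) \<Rightarrow> 'c \<Rightarrow> bool" where
  "has_line_integral a b \<gamma> F I \<longleftrightarrow>
     (\<forall>\<epsilon>>0. \<exists>s\<^sub>0\<in>einterval a b. \<exists>t\<^sub>0\<in>einterval a b. s\<^sub>0 \<le> t\<^sub>0 \<and>
        (\<forall>s\<in>einterval a b. \<forall>t\<in>einterval a b. s \<le> s\<^sub>0 \<and> t\<^sub>0 \<le> t \<longrightarrow>
           (\<exists>J. has_rs_integral \<gamma> F s t J \<and> norm (J - I) < \<epsilon>)))"

definition line_integral :: "ereal \<Rightarrow> ereal \<Rightarrow> (real \<Rightarrow> complex) \<Rightarrow>
    (complex \<Rightarrow> 'c::complex_normed) \<Rightarrow> 'c" where
  "line_integral a b \<gamma> F = (THE I. has_line_integral a b \<gamma> F I)"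

text \<open>Integral of a nonnegative continuous function with respect to arc length, as the supremum
  of the lower Darboux-Stieltjes sums over compact subintervals.\<close>

definition arc_length_integral :: "ereal \<Rightarrow> ereal \<Rightarrow> (real \<Rightarrow> complex) \<Rightarrow>
    (complex \<Rightarrow> real) \<Rightarrow> ennreal" where
  "arc_length_integral a b \<gamma> h =
     (SUP d \<in> {d. \<exists>s t. {s..t} \<subseteq> einterval a b \<and> d division_of {s..t}}.
        \<Sum>J\<in>d. (INF x\<in>J. ennreal (h (\<gamma> x))) * arc_length \<gamma> (Inf J) (Sup J))"

text \<open>Finite end points of \<open>(a, b)\<close> are fixed by \<open>h\<close>, infinite ones stay at infinity.
  Note that \<open>closure (einterval a b)\<close> is the closure in the real line.\<close>

definition fixes_ends :: "ereal \<Rightarrow> ereal \<Rightarrow> (real \<Rightarrow> complex) \<Rightarrow> bool" where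
  "fixes_ends a b h \<longleftrightarrow>
     (\<forall>x \<in> closure (einterval a b) - einterval a b. h x = complex_of_real x) \<and>
     (a = -\<infinity> \<longrightarrow> filterlim h at_infinity at_bot) \<and>
     (b = \<infinity> \<longrightarrow> filterlim h at_infinity at_top)"

definition jordan_deformation ::
    "ereal \<Rightarrow> ereal \<Rightarrow> complex set \<Rightarrow> (real \<Rightarrow> complex) \<Rightarrow> bool" where
  "jordan_deformation a b D \<gamma> \<longleftrightarrow>
     continuous_on (closure (einterval a b)) \<gamma> \<and> inj_on \<gamma> (closure (einterval a b)) \<and>
     \<gamma> ` einterval a b \<subseteq> D \<and>
     (\<forall>s t. {s..t} \<subseteq> closure (einterval a b) \<longrightarrow> arc_length \<gamma> s t < \<infinity>) \<and>
     homotopic_with_canon (fixes_ends a b) (closure (einterval a b))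
       (D \<union> complex_of_real ` closure (einterval a b)) complex_of_real \<gamma>"

text \<open>Operator-valued holomorphy (in norm): the real Frechet derivative is multiplication by a
  complex scalar.\<close>

definition op_holomorphic_on ::
    "(complex \<Rightarrow> 'c::complex_normed) \<Rightarrow> complex set \<Rightarrow> bool" where
  "op_holomorphic_on F U \<longleftrightarrow> (\<forall>z\<in>U. \<exists>F'. (F has_derivative (\<lambda>w. w *\<^sub>C F')) (at z))"

section \<open>The block operator data\<close>

text \<open>\<open>lo k\<close>, \<open>hi k\<close> for \<open>k = 1, \<dots>, num\<close> are the end points of the intervals;
  \<open>Dm k\<close> is the domain in the lower half-plane and \<open>Kp k\<close> is the derivative of \<open>K\<^sub>B\<close> on the
  \<open>k\<close>-th interval together with its analytic continuation.\<close>

record (overloaded) ('a, 'b) block_data =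
  opA0 :: "'a opgraph"
  opA1 :: "'b opgraph"
  opB01 :: "'b \<Rightarrow>\<^sub>L 'a"
  opB10 :: "'a \<Rightarrow>\<^sub>L 'b"
  specE :: "real set \<Rightarrow> 'a \<Rightarrow>\<^sub>L 'a"
  num :: nat
  lo :: "nat \<Rightarrow> ereal"
  hi :: "nat \<Rightarrow> ereal"
  Dm :: "nat \<Rightarrow> complex set"
  Kp :: "nat \<Rightarrow> complex \<Rightarrow> 'b \<Rightarrow>\<^sub>L 'b"

definition Delta :: "('a::complex_hilbert, 'b::complex_hilbert) block_data \<Rightarrow> nat \<Rightarrow> real set" where
  "Delta S k = einterval (lo S k) (hi S k)"

definition sigma_rest :: "('a::complex_hilbert, 'b::complex_hilbert) block_data \<Rightarrow> complex set" where
  "sigma_rest S = op_spectrum (opA0 S) - (\<Union>k\<in>{1..num S}. complex_of_real ` Delta S k)"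

definition KB_measure ::
    "('a::complex_hilbert, 'b::complex_hilbert) block_data \<Rightarrow> real set \<Rightarrow> 'b \<Rightarrow>\<^sub>L 'b" where
  "KB_measure S \<delta> = opB10 S o\<^sub>L specE S \<delta> o\<^sub>L opB01 S"

definition KB :: "('a::complex_hilbert, 'b::complex_hilbert) block_data \<Rightarrow> real \<Rightarrow> 'b \<Rightarrow>\<^sub>L 'b" where
  "KB S \<mu> = KB_measure S {..<\<mu>}"

definition operator_assumptions ::
    "('a::complex_hilbert, 'b::complex_hilbert) block_data \<Rightarrow> bool" where
  "operator_assumptions S \<longleftrightarrow>
     separable_space (euclidean :: 'a topology) \<and> separable_space (euclidean :: 'b topology) \<and>
     self_adjoint_op (opA0 S) \<and> self_adjoint_op (opA1 S) \<and>
     clinear_op (opB01 S) \<and> is_adjoint (opB10 S) (opB01 S) \<and>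
     spectral_measure_of (specE S) (opA0 S)"

definition spectral_assumptions ::
    "('a::complex_hilbert, 'b::complex_hilbert) block_data \<Rightarrow> bool" where
  "spectral_assumptions S \<longleftrightarrow>
     1 \<le> num S \<and> disjoint_family_on (Delta S) {1..num S} \<and>
     (\<forall>k\<in>{1..num S}. complex_of_real ` Delta S k \<subseteq> continuous_spectrum (opA0 S) \<and>
        complex_of_real ` Delta S k \<inter> op_spectrum (opA1 S) \<noteq> {}) \<and>
     op_spectrum (opA1 S) \<inter> sigma_rest S = {}"

definition analyticity_assumptions ::
    "('a::complex_hilbert, 'b::complex_hilbert) block_data \<Rightarrow> bool" where
  "analyticity_assumptions S \<longleftrightarrow>
     disjoint_family_on (Dm S) {1..num S} \<and>
     (\<forall>k\<in>{1..num S}.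
        open (Dm S k) \<and> simply_connected (Dm S k) \<and> Dm S k \<subseteq> {z. Im z < 0} \<and>
        complex_of_real ` Delta S k \<subseteq> frontier (Dm S k) \<and>
        (\<forall>\<mu>\<in>Delta S k. (KB S has_vector_derivative Kp S k (complex_of_real \<mu>)) (at \<mu>)) \<and>
        continuous_on (complex_of_real ` closure (Delta S k)) (Kp S k) \<and>
        (\<exists>U. open U \<and> Dm S k \<union> complex_of_real ` Delta S k \<union> cnj ` Dm S k \<subseteq> U \<and>
           op_holomorphic_on (Kp S k) U) \<and>
        (\<forall>e \<in> closure (Delta S k) - Delta S k. \<exists>C>0. \<exists>g>0.
           \<forall>w \<in> Dm S k \<union> cnj ` Dm S k.
             norm (Kp S k w - Kp S k (complex_of_real e)) \<le> C * cmod (w - complex_of_real e) powr g))"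

definition standing_assumptions ::
    "('a::complex_hilbert, 'b::complex_hilbert) block_data \<Rightarrow> bool" where
  "standing_assumptions S \<longleftrightarrow>
     operator_assumptions S \<and> spectral_assumptions S \<and> analyticity_assumptions S"

section \<open>Contours\<close>

text \<open>A contour \<open>\<Gamma>\<^sub>l\<close> is given by parametrizations \<open>\<Gamma> k\<close> of its components by the
  intervals \<open>Delta S k\<close>, with the orientation of the intervals.\<close>

definition sheet ::
    "('a::complex_hilbert, 'b::complex_hilbert) block_data \<Rightarrow> (nat \<Rightarrow> int) \<Rightarrow> nat \<Rightarrow> complex set" where
  "sheet S l k = (if l k = 1 then cnj ` Dm S k else Dm S k)"

definition sign_vector ::
    "('a::complex_hilbert, 'b::complex_hilbert) block_data \<Rightarrow> (nat \<Rightarrow> int) \<Rightarrow> bool" where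
  "sign_vector S l \<longleftrightarrow> (\<forall>k\<in>{1..num S}. l k = 1 \<or> l k = -1)"

definition contour :: "('a::complex_hilbert, 'b::complex_hilbert) block_data \<Rightarrow>
    (nat \<Rightarrow> int) \<Rightarrow> (nat \<Rightarrow> real \<Rightarrow> complex) \<Rightarrow> bool" where
  "contour S l \<Gamma> \<longleftrightarrow> (\<forall>k\<in>{1..num S}.
     jordan_deformation (lo S k) (hi S k) (sheet S l k) (\<Gamma> k) \<and>
     closure (\<Gamma> k ` Delta S k) \<inter> continuous_spectrum (opA0 S)
       \<subseteq> complex_of_real ` (closure (Delta S k) - Delta S k))"

definition trace_of :: "('a::complex_hilbert, 'b::complex_hilbert) block_data \<Rightarrow>
    (nat \<Rightarrow> real \<Rightarrow> complex) \<Rightarrow> complex set" where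
  "trace_of S \<Gamma> = (\<Union>k\<in>{1..num S}. \<Gamma> k ` Delta S k)"

text \<open>Sequences of disjoint Borel sets cover the finite partitions too, as the sets may be empty.\<close>

definition V0 :: "('a::complex_hilbert, 'b::complex_hilbert) block_data \<Rightarrow>
    (nat \<Rightarrow> real \<Rightarrow> complex) \<Rightarrow> ennreal" where
  "V0 S \<Gamma> =
     (SUP \<delta> \<in> {\<delta> :: nat \<Rightarrow> real set. range \<delta> \<subseteq> sets borel \<and> disjoint_family \<delta> \<and>
                 (\<Union>n. \<delta> n) = complex_of_real -` op_spectrum (opA0 S)}.
        \<Sum>n. ennreal (norm (KB_measure S (\<delta> n \<inter> complex_of_real -` sigma_rest S)))) +
     (\<Sum>k=1..num S. arc_length_integral (lo S k) (hi S k) (\<Gamma> k) (\<lambda>\<mu>. norm (Kp S k \<mu>)))"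

definition KB_bounded :: "('a::complex_hilbert, 'b::complex_hilbert) block_data \<Rightarrow>
    (nat \<Rightarrow> real \<Rightarrow> complex) \<Rightarrow> bool" where
  "KB_bounded S \<Gamma> \<longleftrightarrow> V0 S \<Gamma> < \<infinity>"

definition d0 :: "('a::complex_hilbert, 'b::complex_hilbert) block_data \<Rightarrow>
    (nat \<Rightarrow> real \<Rightarrow> complex) \<Rightarrow> real" where
  "d0 S \<Gamma> = setdist (op_spectrum (opA1 S)) (sigma_rest S \<union> trace_of S \<Gamma>)"

definition admissible :: "('a::complex_hilbert, 'b::complex_hilbert) block_data \<Rightarrow>
    (nat \<Rightarrow> int) \<Rightarrow> (nat \<Rightarrow> real \<Rightarrow> complex) \<Rightarrow> bool" where
  "admissible S l \<Gamma> \<longleftrightarrow>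
     contour S l \<Gamma> \<and> KB_bounded S \<Gamma> \<and> V0 S \<Gamma> < ennreal ((d0 S \<Gamma>)\<^sup>2 / 4)"

definition r_min :: "('a::complex_hilbert, 'b::complex_hilbert) block_data \<Rightarrow>
    (nat \<Rightarrow> real \<Rightarrow> complex) \<Rightarrow> real" where
  "r_min S \<Gamma> = d0 S \<Gamma> / 2 - sqrt ((d0 S \<Gamma>)\<^sup>2 / 4 - enn2real (V0 S \<Gamma>))"

definition r0 :: "('a::complex_hilbert, 'b::complex_hilbert) block_data \<Rightarrow>
    (nat \<Rightarrow> int) \<Rightarrow> real" where
  "r0 S l = Inf (r_min S ` {\<Gamma>. admissible S l \<Gamma>})"

section \<open>Integrals and transfer function\<close>

definition KB_integrable :: "('a::complex_hilbert, 'b::complex_hilbert) block_data \<Rightarrow>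
    (nat \<Rightarrow> real \<Rightarrow> complex) \<Rightarrow> (complex \<Rightarrow> 'b \<Rightarrow>\<^sub>L 'b) \<Rightarrow> bool" where
  "KB_integrable S \<Gamma> T \<longleftrightarrow>
     (\<exists>I. has_op_integral (KB_measure S) (complex_of_real -` sigma_rest S)
            (\<lambda>\<mu>. T (complex_of_real \<mu>)) I) \<and>
     (\<forall>k\<in>{1..num S}. \<exists>I. has_line_integral (lo S k) (hi S k) (\<Gamma> k)
            (\<lambda>\<mu>. Kp S k \<mu> o\<^sub>L T \<mu>) I)"

definition KB_integral :: "('a::complex_hilbert, 'b::complex_hilbert) block_data \<Rightarrow>
    (nat \<Rightarrow> real \<Rightarrow> complex) \<Rightarrow> (complex \<Rightarrow> 'b \<Rightarrow>\<^sub>L 'b) \<Rightarrow> 'b \<Rightarrow>\<^sub>L 'b" where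
  "KB_integral S \<Gamma> T =
     op_integral (KB_measure S) (complex_of_real -` sigma_rest S) (\<lambda>\<mu>. T (complex_of_real \<mu>)) +
     (\<Sum>k=1..num S. line_integral (lo S k) (hi S k) (\<Gamma> k) (\<lambda>\<mu>. Kp S k \<mu> o\<^sub>L T \<mu>))"

definition V1 :: "('a::complex_hilbert, 'b::complex_hilbert) block_data \<Rightarrow>
    (nat \<Rightarrow> real \<Rightarrow> complex) \<Rightarrow> complex \<Rightarrow> 'b \<Rightarrow>\<^sub>L 'b" where
  "V1 S \<Gamma> z = KB_integral S \<Gamma> (\<lambda>\<mu>. (1 / (z - \<mu>)) *\<^sub>C id_blinfun)"

definition V1_op :: "('a::complex_hilbert, 'b::complex_hilbert) block_data \<Rightarrow>
    (nat \<Rightarrow> real \<Rightarrow> complex) \<Rightarrow> 'b opgraph \<Rightarrow> 'b \<Rightarrow>\<^sub>L 'b" where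
  "V1_op S \<Gamma> Y = KB_integral S \<Gamma> (\<lambda>\<mu>. resolvent Y \<mu>)"

definition M1 :: "('a::complex_hilbert, 'b::complex_hilbert) block_data \<Rightarrow>
    (nat \<Rightarrow> real \<Rightarrow> complex) \<Rightarrow> complex \<Rightarrow> 'b opgraph" where
  "M1 S \<Gamma> z = op_add (op_shift (opA1 S) z) (V1 S \<Gamma> z)"

definition W1 :: "('a::complex_hilbert, 'b::complex_hilbert) block_data \<Rightarrow>
    (nat \<Rightarrow> real \<Rightarrow> complex) \<Rightarrow> 'b opgraph \<Rightarrow> complex \<Rightarrow> 'b \<Rightarrow>\<^sub>L 'b" where
  "W1 S \<Gamma> H z = id_blinfun - KB_integral S \<Gamma> (\<lambda>\<mu>. (1 / (\<mu> - z)) *\<^sub>C resolvent H \<mu>)"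

text \<open>The operator \<open>X\<^sup>(\<^sup>l\<^sup>)\<close>: the solution in the ball of radius \<open>r_min\<close>.\<close>

definition basic_solution :: "('a::complex_hilbert, 'b::complex_hilbert) block_data \<Rightarrow>
    (nat \<Rightarrow> real \<Rightarrow> complex) \<Rightarrow> 'b \<Rightarrow>\<^sub>L 'b \<Rightarrow> bool" where
  "basic_solution S \<Gamma> X \<longleftrightarrow>
     clinear_op X \<and> X = V1_op S \<Gamma> (op_add (opA1 S) X) \<and> norm X \<le> r_min S \<Gamma>"

lemma r_min_nonneg:
  assumes "admissible S l \<Gamma>"
  shows "0 \<le> r_min S \<Gamma>"
proof -
  have "sqrt ((d0 S \<Gamma>)\<^sup>2 / 4 - enn2real (V0 S \<Gamma>)) \<le> sqrt ((d0 S \<Gamma> / 2)\<^sup>2)"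
    by (rule real_sqrt_le_mono) (simp add: power_divide)
  also have "\<dots> = d0 S \<Gamma> / 2"
    by (simp add: d0_def setdist_pos_le)
  finally show ?thesis by (simp add: r_min_def)
qed

text \<open>A solution whose norm is bounded by \<open>r0\<close> is a \<open>basic_solution\<close> for every admissible
  contour for which it solves the equation.\<close>

lemma r0_le_r_min:
  assumes "admissible S l \<Gamma>"
  shows "r0 S l \<le> r_min S \<Gamma>"
  unfolding r0_def
proof (rule cInf_lower)
  show "bdd_below (r_min S ` {\<Gamma>. admissible S l \<Gamma>})"
    using r_min_nonneg by (intro bdd_belowI[of _ 0]) auto
qed (use assms in auto)

end

theory Submission
  imports Defs "HOL-Complex_Analysis.Conformal_Mappings"
begin

text \<open>On \<open>\<sigma>'(A\<^sub>0) \<union> \<Gamma>\<^sub>l\<close> one has \<open>H - \<mu> = (I + X (A\<^sub>1 - \<mu>)\<^sup>-\<^sup>1) (A\<^sub>1 - \<mu>)\<close> with \<open>\<parallel>(A\<^sub>1 - \<mu>)\<^sup>-\<^sup>1\<parallel> \<le> 1/d\<^sub>0\<close> and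
  \<open>\<parallel>X\<parallel> < d\<^sub>0/2\<close>, so \<open>\<mu>\<close> lies in the resolvent set of \<open>H\<close> and \<open>\<parallel>(H - \<mu>)\<^sup>-\<^sup>1\<parallel> \<le> 2/d\<^sub>0\<close>.
  Integrating the identity
  \<open>(\<mu> - z)\<^sup>-\<^sup>1 (H - \<mu>)\<^sup>-\<^sup>1 (H - z) = (\<mu> - z)\<^sup>-\<^sup>1 + (H - \<mu>)\<^sup>-\<^sup>1\<close> against \<open>K\<^sub>B\<close> and inserting the equation
  \<open>X = V\<^sub>1(A\<^sub>1 + X)\<close> gives the factorization.  If \<open>dist(z, \<sigma>(A\<^sub>1)) \<le> d\<^sub>0/2\<close>, then \<open>|\<mu> - z| \<ge> d\<^sub>0/2\<close>, and
  the integral in \<open>W\<^sub>1\<close> has norm at most \<open>V\<^sub>0 (2/d\<^sub>0)\<^sup>2 < 1\<close>.\<close>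

section \<open>Bounded complex-linear operators\<close>

text \<open>The integrals are THE-terms over nets, so each one has to be shown to exist before an
  identity between them can be used. Three kinds of limit occur: refinement of Borel partitions,
  shrinking meshes, and exhaustion of an open arc; one completeness principle for nets serves all
  three. The measure \<open>KB_measure S\<close> is countably additive only strongly, whereas its
  integral is a norm limit over a possibly unbounded set, so finite variation has to supply
  uniformity at infinity. Since \<open>blinfun\<close> knows only real linearity, complex linearity
  is carried along as a separate invariant: it survives limits because the complex-linear operators
  form a closed set, and it reaches \<open>Kp\<close> on an arc by analytic continuation from the
  real interval. The factor \<open>H - z\<close> is unbounded and cannot be moved under the integral
  as it stands; the identity is first multiplied on the right by one fixed resolvent
  \<open>R0\<close> of \<open>H\<close>, which leaves only bounded operators. The strict inequality
  for \<open>V0\<close> yields both \<open>d0 > 0\<close> and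
  \<open>norm X < d0 / 2\<close>.\<close>

lemma bounded_bilinear_scaleC:
  "bounded_bilinear (scaleC :: complex \<Rightarrow> 'a::complex_normed \<Rightarrow> 'a)"
proof
  fix a a' :: complex and b b' :: 'a and r :: real
  show "(a + a') *\<^sub>C b = a *\<^sub>C b + a' *\<^sub>C b"
    by (rule scaleC_add_left)
  show "a *\<^sub>C (b + b') = a *\<^sub>C b + a *\<^sub>C b'"
    by (rule scaleC_add_right)
  show "(r *\<^sub>R a) *\<^sub>C b = r *\<^sub>R (a *\<^sub>C b)"
    by (simp add: scaleR_scaleC[of r "a *\<^sub>C b"] scaleC_scaleC scaleR_conv_of_real)
  show "a *\<^sub>C (r *\<^sub>R b) = r *\<^sub>R (a *\<^sub>C b)"
    by (simp add: scaleR_scaleC[of r "a *\<^sub>C b"] scaleR_scaleC[of r b] scaleC_scaleC mult.commute)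
  show "\<exists>K. \<forall>a (b::'a). norm (a *\<^sub>C b) \<le> norm a * norm b * K"
    by (intro exI[of _ 1]) (simp add: norm_scaleC)
qed

interpretation scaleC: bounded_bilinear "scaleC :: complex \<Rightarrow> 'a::complex_normed \<Rightarrow> 'a"
  by (rule bounded_bilinear_scaleC)

lemma scaleC_one [simp]: "1 *\<^sub>C x = (x :: 'a::complex_normed)"
  using scaleR_scaleC[of 1 x] by simp

lemma scaleC_blinfun_apply [simp]:
  "blinfun_apply (c *\<^sub>C (T :: 'a::real_normed_vector \<Rightarrow>\<^sub>L 'b::complex_normed)) x = c *\<^sub>C T x"
  by (simp add: scaleC_blinfun.rep_eq)

lemma scaleC_blinfun_compose:
  "(c *\<^sub>C T) o\<^sub>L S = c *\<^sub>C (T o\<^sub>L (S :: 'a::real_normed_vector \<Rightarrow>\<^sub>L 'b::real_normed_vector))"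
  by (rule blinfun_eqI) simp

lemma blinfun_compose_right_distribs:
  fixes R S :: "'b::real_normed_vector \<Rightarrow>\<^sub>L 'c::real_normed_vector"
    and T :: "'a::real_normed_vector \<Rightarrow>\<^sub>L 'b"
  shows "(R + S) o\<^sub>L T = (R o\<^sub>L T) + (S o\<^sub>L T)" "(R - S) o\<^sub>L T = (R o\<^sub>L T) - (S o\<^sub>L T)"
  by (rule blinfun_eqI; simp add: blinfun.add_left blinfun.diff_left)+

lemma blinfun_compose_left_diff:
  fixes R :: "'b::real_normed_vector \<Rightarrow>\<^sub>L 'c::real_normed_vector"
    and S T :: "'a::real_normed_vector \<Rightarrow>\<^sub>L 'b"
  shows "R o\<^sub>L (S - T) = (R o\<^sub>L S) - (R o\<^sub>L T)"
  by (rule blinfun_eqI) (simp add: blinfun.diff_left blinfun.diff_right)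

lemma id_blinfun_compose [simp]: "id_blinfun o\<^sub>L T = T" "T o\<^sub>L id_blinfun = T"
  by (rule blinfun_eqI; simp)+

lemma clinear_op_id: "clinear_op id_blinfun"
  by (simp add: clinear_op_def)

lemma clinear_op_add: "clinear_op S \<Longrightarrow> clinear_op T \<Longrightarrow> clinear_op (S + T)"
  by (simp add: clinear_op_def blinfun.add_left scaleC_add_right)

lemma clinear_op_diff: "clinear_op S \<Longrightarrow> clinear_op T \<Longrightarrow> clinear_op (S - T)"
  by (simp add: clinear_op_def blinfun.diff_left scaleC.diff_right)

lemma clinear_op_uminus: "clinear_op T \<Longrightarrow> clinear_op (- T)"
  by (simp add: clinear_op_def blinfun.minus_left scaleC.minus_right)

lemma clinear_op_scaleC: "clinear_op T \<Longrightarrow> clinear_op (c *\<^sub>C T)"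
  by (simp add: clinear_op_def scaleC_scaleC mult.commute)

lemma clinear_op_compose: "clinear_op S \<Longrightarrow> clinear_op T \<Longrightarrow> clinear_op (S o\<^sub>L T)"
  by (simp add: clinear_op_def)

lemma clinear_op_zero: "clinear_op 0"
  by (simp add: clinear_op_def scaleC.zero_right)

lemma clinear_op_sum: "(\<And>i. i \<in> I \<Longrightarrow> clinear_op (T i)) \<Longrightarrow> clinear_op (\<Sum>i\<in>I. T i)"
  by (induction I rule: infinite_finite_induct) (auto intro: clinear_op_add clinear_op_zero)

text \<open>\<open>L\<close> measures how far \<open>T\<close> is from commuting with the scalar
  \<open>c\<close> at \<open>x\<close>. Being bounded and compatible with complex scalars, it passes
  through limits, derivatives and analytic continuation, which is how complex linearity is
  transported.\<close>

lemma clinear_op_defect: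
  fixes c :: complex and x :: "'a::complex_normed"
  defines "L \<equiv> \<lambda>T :: 'a \<Rightarrow>\<^sub>L 'b::complex_normed. T (c *\<^sub>C x) - c *\<^sub>C T x"
  shows "bounded_linear L" and "L (d *\<^sub>C T) = d *\<^sub>C L T"
proof -
  show "bounded_linear L"
    unfolding L_def
    by (intro bounded_linear_sub bounded_linear_compose[OF scaleC.bounded_linear_right]
        bounded_linear_intros)
  show "L (d *\<^sub>C T) = d *\<^sub>C L T"
    by (simp add: L_def scaleC.diff_right scaleC_scaleC mult.commute)
qed

text \<open>An intersection of kernels of the bounded maps from \<open>clinear_op_defect\<close>.
  Integrals inherit complex linearity from their approximating sums through this closedness.\<close>

lemma closed_clinear_op: "closed (Collect (clinear_op :: 'a::complex_normed \<Rightarrow>\<^sub>L 'b::complex_normed \<Rightarrow> bool))"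
proof -
  have "Collect clinear_op =
      (\<Inter>c. \<Inter>x. {T :: 'a \<Rightarrow>\<^sub>L 'b. T (c *\<^sub>C x) - c *\<^sub>C T x = 0})"
    by (auto simp: clinear_op_def)
  moreover have "closed {T :: 'a \<Rightarrow>\<^sub>L 'b. T (c *\<^sub>C x) - c *\<^sub>C T x = 0}" for c x
    using linear_continuous_on[OF clinear_op_defect(1), of UNIV c x]
    by (intro closed_Collect_eq) auto
  ultimately show ?thesis
    by (simp only:) (intro closed_INT ballI)
qed

lemma neumann_inverse:
  fixes T :: "'a::banach \<Rightarrow>\<^sub>L 'a"
  assumes "norm T < 1"
  obtains R where "(id_blinfun - T) o\<^sub>L R = id_blinfun" "R o\<^sub>L (id_blinfun - T) = id_blinfun"
    "norm R \<le> inverse (1 - norm T)"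
proof -
  define P where "P n = ((\<lambda>S. T o\<^sub>L S) ^^ n) id_blinfun" for n
  have P0: "P 0 = id_blinfun" and PS: "P (Suc n) = T o\<^sub>L P n" for n
    by (simp_all add: P_def)
  \<comment> \<open>The recursion multiplies by \<open>T\<close> on the left; the mirrored form
    yields the inverse on the other side.\<close>
  have PS': "P (Suc n) = P n o\<^sub>L T" for n
  proof (induction n)
    case (Suc n)
    have "P (Suc (Suc n)) = T o\<^sub>L (P n o\<^sub>L T)"
      by (simp only: PS[of "Suc n"] Suc)
    also have "\<dots> = P (Suc n) o\<^sub>L T"
      unfolding PS by (rule blinfun_eqI) simp
    finally show ?case .
  qed (simp add: P0 PS blinfun_eqI)
  have nP: "norm (P n) \<le> norm T ^ n" for n
  proof (induction n)
    case (Suc n)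
    have "norm (P (Suc n)) \<le> norm T * norm (P n)"
      unfolding PS by (rule norm_blinfun_compose)
    also have "\<dots> \<le> norm T * norm T ^ n"
      by (rule mult_left_mono[OF Suc norm_ge_zero])
    finally show ?case by simp
  qed (simp add: P0 norm_blinfun_id_le)
  have geo: "summable (\<lambda>n. norm T ^ n)"
    using assms by (intro summable_geometric) simp
  have sm: "summable P"
    by (rule summable_comparison_test'[OF geo nP])
  \<comment> \<open>Multiplication by \<open>T\<close> on either side shifts the series by one
    place, so it removes exactly the term \<open>P 0\<close>.\<close>
  have tail: "(\<lambda>n. P (Suc n)) sums (suminf P - id_blinfun)"
    using summable_sums[OF sm] by (subst sums_Suc_iff) (simp add: P0)
  have "bounded_linear (\<lambda>S. T o\<^sub>L S)" "bounded_linear (\<lambda>S. S o\<^sub>L T)"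
    by (rule bounded_bilinear.bounded_linear_right[OF bounded_bilinear_blinfun_compose]
        bounded_bilinear.bounded_linear_left[OF bounded_bilinear_blinfun_compose])+
  from this[THEN bounded_linear.sums, OF summable_sums[OF sm]]
  have "T o\<^sub>L suminf P = suminf P - id_blinfun" "suminf P o\<^sub>L T = suminf P - id_blinfun"
    using tail by (auto simp: PS[symmetric] PS'[symmetric] sums_unique2)
  moreover have "norm (suminf P) \<le> inverse (1 - norm T)"
  proof -
    have "norm (suminf P) \<le> (\<Sum>n. norm T ^ n)"
      by (rule order_trans[OF summable_norm suminf_le[OF nP _ geo]])
        (rule summable_comparison_test'[OF geo], simp add: nP)+
    then show ?thesis
      using assms by (simp add: suminf_geometric inverse_eq_divide)
  qed
  ultimately show ?thesis
    by (intro that[of "suminf P"])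
      (simp_all add: blinfun_compose_right_distribs blinfun_compose_left_diff)
qed

lemma clinear_op_inverse:
  assumes "clinear_op S" "S o\<^sub>L R = id_blinfun" "R o\<^sub>L S = id_blinfun"
  shows "clinear_op R"
  unfolding clinear_op_def
proof (intro allI)
  fix c x
  have "R (c *\<^sub>C x) = R (c *\<^sub>C S (R x))"
    using arg_cong[OF assms(2), of "\<lambda>T. blinfun_apply T x"] by simp
  also have "\<dots> = R (S (c *\<^sub>C R x))"
    using assms(1) by (simp add: clinear_op_def)
  also have "\<dots> = c *\<^sub>C R x"
    using arg_cong[OF assms(3), of "\<lambda>T. blinfun_apply T (c *\<^sub>C R x)"] by simp
  finally show "R (c *\<^sub>C x) = c *\<^sub>C R x" .
qed

section \<open>Resolvents\<close>

text \<open>A relational companion of the THE-term \<open>resolvent\<close>: a candidate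
  \<open>R\<close> can be studied first and identified with \<open>resolvent A z\<close>
  afterwards.\<close>

definition is_resolvent :: "'a::complex_normed opgraph \<Rightarrow> complex \<Rightarrow> 'a \<Rightarrow>\<^sub>L 'a \<Rightarrow> bool" where
  "is_resolvent A z R \<longleftrightarrow> clinear_op R \<and> (op_shift A z)\<inverse> = graph R"

text \<open>The graph equation packages two facts: \<open>R\<close> maps into the domain and is a
  right inverse of \<open>A - z\<close> on the whole space, and it is a left inverse on the domain
  of \<open>A\<close>.\<close>

lemma is_resolvent_iff:
  "is_resolvent A z R \<longleftrightarrow> clinear_op R \<and> (\<forall>w. (R w, w + z *\<^sub>C R w) \<in> A) \<and>
     (\<forall>x y. (x, y) \<in> A \<longrightarrow> R (y - z *\<^sub>C x) = x)"
proof -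
  have "(op_shift A z)\<inverse> = graph R \<longleftrightarrow> (\<forall>w. (R w, w + z *\<^sub>C R w) \<in> A) \<and>
     (\<forall>x y. (x, y) \<in> A \<longrightarrow> R (y - z *\<^sub>C x) = x)" (is "?l \<longleftrightarrow> ?r")
  proof
    assume l: ?l
    have "(R w, w + z *\<^sub>C R w) \<in> A" for w
    proof -
      have "(w, R w) \<in> (op_shift A z)\<inverse>"
        unfolding l by (auto simp: graph_def)
      then obtain y where "w = y - z *\<^sub>C R w" "(R w, y) \<in> A"
        unfolding op_shift_def by blast
      then show ?thesis by (metis diff_add_cancel)
    qed
    moreover have "R (y - z *\<^sub>C x) = x" if "(x, y) \<in> A" for x y
    proof -
      have "(y - z *\<^sub>C x, x) \<in> (op_shift A z)\<inverse>"
        using that by (auto simp: op_shift_def)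
      then show ?thesis unfolding l by (auto simp: graph_def)
    qed
    ultimately show ?r by blast
  next
    assume r: ?r
    have "(w, R w) \<in> (op_shift A z)\<inverse>" for w
      unfolding op_shift_def using r by (auto intro!: exI[of _ "w + z *\<^sub>C R w"])
    then show ?l
      using r by (force simp: op_shift_def graph_def)
  qed
  then show ?thesis by (simp add: is_resolvent_def)
qed

lemma resolvent_set_iff: "z \<in> resolvent_set A \<longleftrightarrow> (\<exists>R. is_resolvent A z R)"
  by (simp add: resolvent_set_def is_resolvent_def)

lemma is_resolvent_imp_resolvent:
  assumes "is_resolvent A z R"
  shows "resolvent A z = R"
  unfolding resolvent_def
proof (rule the_equality)
  show eq: "(op_shift A z)\<inverse> = graph R"
    using assms by (simp add: is_resolvent_def)
  fix Q assume "(op_shift A z)\<inverse> = graph Q"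
  then have "graph Q = graph R" using eq by simp
  then show "Q = R" by (force simp: graph_def intro!: blinfun_eqI)
qed

lemma is_resolvent_resolvent:
  assumes "z \<notin> op_spectrum A"
  shows "is_resolvent A z (resolvent A z)"
  using assms is_resolvent_imp_resolvent
  by (fastforce simp: op_spectrum_def resolvent_set_iff)

text \<open>From \<open>A + X - z = (I + X R) (A - z)\<close> the inverse is \<open>R N\<close> with
  \<open>N\<close> the Neumann inverse of \<open>I + X R\<close>. The factor \<open>R\<close> stands
  on the left, so the range stays inside the domain of \<open>A\<close>.\<close>

lemma is_resolvent_perturbed:
  fixes A :: "'a::{complex_normed,banach} opgraph"
  assumes R: "is_resolvent A z R" and X: "clinear_op X" and small: "norm (X o\<^sub>L R) < 1"
  obtains Q where "is_resolvent (op_add A X) z Q" "norm Q \<le> norm R / (1 - norm (X o\<^sub>L R))"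
proof -
  obtain N where N: "(id_blinfun - (- (X o\<^sub>L R))) o\<^sub>L N = id_blinfun"
      "N o\<^sub>L (id_blinfun - (- (X o\<^sub>L R))) = id_blinfun" "norm N \<le> inverse (1 - norm (X o\<^sub>L R))"
    using neumann_inverse[of "- (X o\<^sub>L R)"] small by auto
  have N1: "N w + X (R (N w)) = w" and N2: "N (w + X (R w)) = w" for w
    using N(1,2)[THEN arg_cong, of "\<lambda>T. blinfun_apply T w"] by (simp_all add: blinfun.add_left)
  have cR: "clinear_op R" and R1: "\<And>w. (R w, w + z *\<^sub>C R w) \<in> A"
    and R2: "\<And>x y. (x, y) \<in> A \<Longrightarrow> R (y - z *\<^sub>C x) = x"
    using R by (auto simp: is_resolvent_iff)
  have "clinear_op N"
    using cR X by (intro clinear_op_inverse[OF _ N(1,2)] clinear_op_diff clinear_op_uminus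
        clinear_op_compose clinear_op_id)
  then have "clinear_op (R o\<^sub>L N)"
    using cR by (intro clinear_op_compose)
  moreover have "((R o\<^sub>L N) w, w + z *\<^sub>C (R o\<^sub>L N) w) \<in> op_add A X" for w
    unfolding op_add_def using R1[of "N w"] N1[of w]
    by (auto intro!: exI[of _ "N w + z *\<^sub>C R (N w)"] simp: algebra_simps)
  moreover have "(R o\<^sub>L N) (y - z *\<^sub>C x) = x" if xy: "(x, y) \<in> op_add A X" for x y
  proof -
    obtain y' where y': "(x, y') \<in> A" "y = y' + X x"
      using xy unfolding op_add_def by blast
    have "N (y - z *\<^sub>C x) = y' - z *\<^sub>C x"
      using N2[of "y' - z *\<^sub>C x"] R2[OF y'(1)] y'(2) by (simp add: algebra_simps)
    then show ?thesis using R2[OF y'(1)] by simp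
  qed
  ultimately have "is_resolvent (op_add A X) z (R o\<^sub>L N)"
    by (simp add: is_resolvent_iff)
  moreover have "norm (R o\<^sub>L N) \<le> norm R / (1 - norm (X o\<^sub>L R))"
    using norm_blinfun_compose[of R N] mult_left_mono[OF N(3) norm_ge_zero[of R]]
    by (simp add: divide_inverse)
  ultimately show ?thesis by (rule that)
qed

text \<open>Moving the spectral parameter from \<open>z\<close> to \<open>w\<close> is the same as
  perturbing \<open>A\<close> by the scalar operator \<open>(z - w) I\<close> at fixed
  \<open>z\<close>, so openness of the resolvent set is a case of
  \<open>is_resolvent_perturbed\<close>.\<close>

lemma closed_op_spectrum:
  fixes A :: "'a::{complex_normed,banach} opgraph"
  shows "closed (op_spectrum A)"
proof -
  have "open (resolvent_set A)"
    unfolding open_dist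
  proof
    fix z assume "z \<in> resolvent_set A"
    then obtain R where R: "is_resolvent A z R" by (auto simp: resolvent_set_iff)
    \<comment> \<open>The summand 1 keeps \<open>e\<close> positive when \<open>R = 0\<close>, where
      \<open>inverse 0\<close> would be 0.\<close>
    define e where "e = inverse (norm R + 1)"
    have "0 < e" by (simp add: e_def add_nonneg_pos)
    moreover have "w \<in> resolvent_set A" if w: "dist w z < e" for w
    proof -
      define X :: "'a \<Rightarrow>\<^sub>L 'a" where "X = (z - w) *\<^sub>C id_blinfun"
      have "norm (X o\<^sub>L R) = cmod (z - w) * norm R"
        by (simp add: X_def scaleC_blinfun_compose norm_scaleC)
      also have "\<dots> \<le> e * norm R"
        using w by (intro mult_right_mono) (simp_all add: dist_norm norm_minus_commute)
      also have "\<dots> < 1"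
        unfolding e_def inverse_eq_divide using norm_ge_zero[of R]
        by (subst times_divide_eq_left, subst divide_less_eq_1_pos) linarith+
      finally have small: "norm (X o\<^sub>L R) < 1" .
      have X: "clinear_op X"
        unfolding X_def by (intro clinear_op_scaleC clinear_op_id)
      obtain Q where Q: "is_resolvent (op_add A X) z Q"
        by (rule is_resolvent_perturbed[OF R X small])
      have "y + X x - z *\<^sub>C x = y - w *\<^sub>C x" for x y
        by (simp add: X_def scaleC.diff_left blinfun.diff_left)
      then have "(x, v) \<in> op_shift (op_add A X) z \<longleftrightarrow> (x, v) \<in> op_shift A w" for x v
        unfolding op_shift_def op_add_def by (auto; metis)
      then have "op_shift (op_add A X) z = op_shift A w"
        by (auto intro: set_eqI)
      then show ?thesis
        using Q by (auto simp: resolvent_set_iff is_resolvent_def)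
    qed
    ultimately show "\<exists>e>0. \<forall>w. dist w z < e \<longrightarrow> w \<in> resolvent_set A" by blast
  qed
  then show ?thesis by (simp add: op_spectrum_def closed_Compl)
qed

text \<open>\<open>Q v\<close> lies in the domain of \<open>A\<close>, so \<open>R\<close> may be
  applied to \<open>(A - z) Q v = v - (z - w) Q v\<close>.\<close>

lemma resolvent_identity:
  assumes R: "is_resolvent A z R" and Q: "is_resolvent A w Q"
  shows "R - Q = (z - w) *\<^sub>C (R o\<^sub>L Q)"
proof (rule blinfun_eqI)
  fix v
  have "(Q v, v + w *\<^sub>C Q v) \<in> A"
    using Q by (simp add: is_resolvent_iff)
  then have "R (v + w *\<^sub>C Q v - z *\<^sub>C Q v) = Q v"
    using R by (simp add: is_resolvent_iff)
  moreover have "v + w *\<^sub>C Q v - z *\<^sub>C Q v = v - (z - w) *\<^sub>C Q v"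
    by (simp add: scaleC.diff_left)
  moreover have "R ((z - w) *\<^sub>C Q v) = (z - w) *\<^sub>C R (Q v)"
    using R by (simp add: is_resolvent_iff clinear_op_def)
  ultimately show "(R - Q) v = ((z - w) *\<^sub>C (R o\<^sub>L Q)) v"
    by (simp add: blinfun.diff_left blinfun.diff_right algebra_simps)
qed

text \<open>A uniform bound \<open>b\<close> turns the resolvent identity into a Lipschitz estimate
  with constant \<open>b * b\<close>.\<close>

lemma continuous_on_resolvent:
  assumes R: "\<And>z. z \<in> Z \<Longrightarrow> is_resolvent A z (resolvent A z)"
    and b: "\<And>z. z \<in> Z \<Longrightarrow> norm (resolvent A z) \<le> b"
  shows "continuous_on Z (resolvent A)"
proof (rule lipschitz_on_continuous_on)
  show "(b\<^sup>2 * (if Z = {} then 0 else 1))-lipschitz_on Z (resolvent A)"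
  proof (rule lipschitz_onI)
    fix z w assume zw: "z \<in> Z" "w \<in> Z"
    have "dist (resolvent A z) (resolvent A w)
        = cmod (z - w) * norm (resolvent A z o\<^sub>L resolvent A w)"
      using resolvent_identity[OF R[OF zw(1)] R[OF zw(2)]] by (simp add: dist_norm norm_scaleC)
    also have "\<dots> \<le> cmod (z - w) * (b * b)"
    proof (rule mult_left_mono)
      have "norm (resolvent A z) * norm (resolvent A w) \<le> b * b"
        using b[OF zw(1)] b[OF zw(2)] order_trans[OF norm_ge_zero b[OF zw(1)]]
        by (intro mult_mono) auto
      then show "norm (resolvent A z o\<^sub>L resolvent A w) \<le> b * b"
        using norm_blinfun_compose order_trans by blast
    qed simp
    finally show "dist (resolvent A z) (resolvent A w) \<le> b\<^sup>2 * (if Z = {} then 0 else 1) * dist z w"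
      using zw by (auto simp: dist_norm power2_eq_square mult_ac)
  qed simp
qed

section \<open>Resolvent bounds for self-adjoint operators\<close>

lemma cinner_scaleC_right: "cinner x (c *\<^sub>C y) = cnj c * cinner x (y :: 'a::complex_hilbert)"
  by (metis cinner_commute cinner_scaleC_left complex_cnj_mult)

lemma cinner_diff_left: "cinner (x - y) u = cinner x u - cinner y (u :: 'a::complex_hilbert)"
  using cinner_add_left[of "x - y" y u] by simp

lemma cinner_self_eq_0: "cinner x x = 0 \<Longrightarrow> x = (0 :: 'a::complex_hilbert)"
  using inner_eq_Re_cinner[of x x] by simp

lemma cinner_eqI: "(\<And>u. cinner u x = cinner u y) \<Longrightarrow> x = (y :: 'a::complex_hilbert)"
  by (metis cinner_commute cinner_diff_left cinner_self_eq_0 eq_iff_diff_eq_0)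

lemma self_adjoint_symmetric:
  assumes "self_adjoint_op A" "(u, v) \<in> A" "(x, y) \<in> A"
  shows "cinner v x = cinner u y"
proof -
  have "(x, y) \<in> adj_graph A" using assms by (simp add: self_adjoint_op_def)
  then show ?thesis using assms(2) by (auto simp: adj_graph_def)
qed

text \<open>Pythagoras: symmetry makes \<open>cinner y x\<close> real, so
  \<open>(A - Re \<mu>) x\<close> and the imaginary multiple of \<open>x\<close> are orthogonal in
  the real inner product. This reduces the resolvent bound at \<open>\<mu>\<close> to the real point
  \<open>Re \<mu>\<close>.\<close>

lemma norm_shift_self_adjoint:
  assumes A: "self_adjoint_op A" and xy: "(x, y) \<in> A"
  shows "(norm (y - \<mu> *\<^sub>C x))\<^sup>2 = (norm (y - Re \<mu> *\<^sub>R x))\<^sup>2 + (Im \<mu>)\<^sup>2 * (norm x)\<^sup>2"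
proof -
  define v where "v = y - Re \<mu> *\<^sub>R x"
  have split: "y - \<mu> *\<^sub>C x = v - (\<i> * Im \<mu>) *\<^sub>C x"
  proof -
    have "\<mu> *\<^sub>C x = complex_of_real (Re \<mu>) *\<^sub>C x + (\<i> * Im \<mu>) *\<^sub>C x"
      by (subst scaleC_add_left[symmetric]) (simp add: complex_eq[symmetric])
    then show ?thesis by (simp add: v_def scaleR_scaleC)
  qed
  have "cinner y x = cinner x y"
    by (rule self_adjoint_symmetric[OF A xy xy])
  then have "Im (cinner y x) = 0"
    using cinner_commute[of y x] by (metis Reals_cnj_iff complex_is_Real_iff)
  moreover have "Im (cinner x x) = 0"
    using cinner_commute[of x x] by (metis Reals_cnj_iff complex_is_Real_iff)
  ultimately have "Im (cinner v x) = 0"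
    by (simp add: v_def cinner_diff_left scaleR_scaleC cinner_scaleC_left)
  then have "inner v ((\<i> * Im \<mu>) *\<^sub>C x) = 0"
    by (simp add: inner_eq_Re_cinner cinner_scaleC_right)
  then have "(norm (v - (\<i> * Im \<mu>) *\<^sub>C x))\<^sup>2 = (norm v)\<^sup>2 + (norm ((\<i> * Im \<mu>) *\<^sub>C x))\<^sup>2"
    by (simp add: power2_norm_eq_inner inner_diff_left inner_diff_right inner_commute)
  then show ?thesis
    by (simp add: split v_def norm_scaleC norm_mult power_mult_distrib)
qed

lemma resolvent_bounded_below:
  assumes "is_resolvent A z R"
  obtains c where "0 < c" "\<And>x y. (x, y) \<in> A \<Longrightarrow> norm x \<le> c * norm (y - z *\<^sub>C x)"
proof (rule that[of "norm R + 1"])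
  show "norm x \<le> (norm R + 1) * norm (y - z *\<^sub>C x)" if "(x, y) \<in> A" for x y
    using norm_blinfun[of R "y - z *\<^sub>C x"] assms that
    by (simp add: is_resolvent_iff algebra_simps) (smt (verit) norm_ge_zero)
qed (simp add: add_nonneg_pos)

text \<open>Either \<open>n = \<parallel>R\<parallel>\<close> or \<open>-n\<close> is an approximate eigenvalue of the self-adjoint operator \<open>R\<close>,
  because \<open>\<parallel>(R\<^sup>2 - n\<^sup>2) w\<parallel>\<^sup>2 \<le> 2 n\<^sup>2 (n\<^sup>2 \<parallel>w\<parallel>\<^sup>2 - \<parallel>R w\<parallel>\<^sup>2)\<close>.\<close>

lemma self_adjoint_nearest_spectrum:
  assumes A: "self_adjoint_op A" and R: "is_resolvent A (complex_of_real a) R" and "R \<noteq> 0"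
  shows "\<exists>s. complex_of_real s \<in> op_spectrum A \<and> \<bar>s - a\<bar> = 1 / norm R"
proof (rule ccontr)
  assume no: "\<not> ?thesis"
  define n where "n = norm R"
  have n: "0 < n" using \<open>R \<noteq> 0\<close> by (simp add: n_def)
  \<comment> \<open>Spectral mapping for a sign \<open>e\<close>: the value \<open>e * n\<close> for
    \<open>R\<close> corresponds to \<open>a + e / n\<close> for \<open>A\<close>, and these are the
    two real points at distance \<open>1 / n\<close> from \<open>a\<close>.\<close>
  have "complex_of_real (a + e / n) \<notin> op_spectrum A" if "\<bar>e\<bar> = 1" for e
    using no[simplified, rule_format, of "a + e / n"] that n by (auto simp: n_def abs_divide)
  then have reg: "\<exists>Q. is_resolvent A (complex_of_real (a + e / n)) Q" if "\<bar>e\<bar> = 1" for e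
    using that by (auto simp: op_spectrum_def resolvent_set_iff)
  have RA: "(R w, w + a *\<^sub>R R w) \<in> A" for w
    using R by (simp add: is_resolvent_iff scaleR_scaleC)
  have below: "\<exists>c>0. \<forall>w. norm w \<le> c * norm (R w - (e * n) *\<^sub>R w)" if e: "\<bar>e\<bar> = 1" for e
  proof -
    obtain Q where Q: "is_resolvent A (complex_of_real (a + e / n)) Q"
      using reg[OF e] by blast
    obtain c where c: "0 < c"
      "\<And>x y. (x, y) \<in> A \<Longrightarrow> norm x \<le> c * norm (y - complex_of_real (a + e / n) *\<^sub>C x)"
      using resolvent_bounded_below[OF Q] by blast
    have ee: "e * e = 1" using e by (metis abs_mult_self_eq mult_1)
    \<comment> \<open>The constant comes from \<open>n * norm w \<le> norm (R w) + norm d\<close>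
      together with \<open>norm (R w) \<le> c * (norm d / n)\<close>, where \<open>d\<close> is the
      defect of \<open>w\<close> as an eigenvector for \<open>e * n\<close>.\<close>
    have "norm w \<le> ((c / n + 1) / n) * norm (R w - (e * n) *\<^sub>R w)" for w
    proof -
      define d where "d = R w - (e * n) *\<^sub>R w"
      have "w + a *\<^sub>R R w - complex_of_real (a + e / n) *\<^sub>C R w = w - (e / n) *\<^sub>R R w"
        by (simp only: scaleR_scaleC[symmetric] scaleR_add_left) simp
      also have "\<dots> = - (e / n) *\<^sub>R d"
        using n ee by (simp add: d_def scaleR_diff_right)
      finally have "norm (R w) \<le> c * (norm d / n)"
        using c(2)[OF RA[of w]] n e by (simp add: abs_divide)
      moreover have "(e * n) *\<^sub>R w = R w - d" by (simp add: d_def)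
      then have "n * norm w \<le> norm (R w) + norm d"
        using norm_triangle_ineq4[of "R w" d] n e by (metis abs_mult abs_of_pos mult_1 norm_scaleR)
      ultimately have "n * norm w \<le> c * (norm d / n) + norm d" by linarith
      then show ?thesis
        unfolding d_def[symmetric] using n by (simp add: field_simps)
    qed
    then show ?thesis
      using c(1) n by (intro exI[of _ "(c / n + 1) / n"]) (simp add: add_pos_pos)
  qed
  obtain c1 where c1: "0 < c1" "\<And>w. norm w \<le> c1 * norm (R w - n *\<^sub>R w)"
    using below[of 1] by auto
  obtain c2 where c2: "0 < c2" "\<And>w. norm w \<le> c2 * norm (R w + n *\<^sub>R w)"
    using below[of "-1"] by auto
  define c where "c = c1 * c2"
  have c: "0 < c" using c1(1) c2(1) by (simp add: c_def)
  \<comment> \<open>The two lower bounds multiply, because \<open>R^2 - n^2\<close> factors as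
    \<open>(R - n) (R + n)\<close>.\<close>
  have sq: "norm w \<le> c * norm (R (R w) - n\<^sup>2 *\<^sub>R w)" for w
  proof -
    have "norm w \<le> c2 * norm (R w + n *\<^sub>R w)" by (rule c2)
    also have "\<dots> \<le> c2 * (c1 * norm (R (R w + n *\<^sub>R w) - n *\<^sub>R (R w + n *\<^sub>R w)))"
      using c1(2) c2(1) by (intro mult_left_mono) auto
    also have "R (R w + n *\<^sub>R w) - n *\<^sub>R (R w + n *\<^sub>R w) = R (R w) - n\<^sup>2 *\<^sub>R w"
      by (simp add: blinfun.add_right blinfun.scaleR_right scaleR_add_right power2_eq_square)
    finally show ?thesis by (simp add: c_def mult_ac)
  qed
  have symm: "inner (R u) v = inner u (R v)" for u v
  proof -
    have "cinner (u + a *\<^sub>R R u) (R v) = cinner (R u) (v + a *\<^sub>R R v)"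
      by (rule self_adjoint_symmetric[OF A RA RA])
    then have "inner (u + a *\<^sub>R R u) (R v) = inner (R u) (v + a *\<^sub>R R v)"
      by (simp add: inner_eq_Re_cinner)
    then show ?thesis by (simp add: inner_add_left inner_add_right)
  qed
  have nb: "norm (R w) \<le> n * norm w" for w
    unfolding n_def by (rule norm_blinfun)
  have key: "(norm (R (R w) - n\<^sup>2 *\<^sub>R w))\<^sup>2 \<le> 2 * n\<^sup>2 * (n\<^sup>2 * (norm w)\<^sup>2 - (norm (R w))\<^sup>2)" for w
  proof -
    have "(norm (R (R w) - n\<^sup>2 *\<^sub>R w))\<^sup>2
        = (norm (R (R w)))\<^sup>2 - 2 * n\<^sup>2 * inner (R (R w)) w + n^4 * (norm w)\<^sup>2"
      by (simp add: power2_norm_eq_inner inner_diff_left inner_diff_right inner_commute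
          algebra_simps flip: power_add)
    also have "inner (R (R w)) w = (norm (R w))\<^sup>2"
      by (simp add: symm power2_norm_eq_inner)
    also have "(norm (R (R w)))\<^sup>2 \<le> (n * norm (R w))\<^sup>2"
      by (intro power_mono nb norm_ge_zero)
    also have "(n * norm (R w))\<^sup>2 \<le> (n * (n * norm w))\<^sup>2"
      using n by (intro power_mono mult_left_mono nb) auto
    finally show ?thesis
      by (simp add: algebra_simps power2_eq_square eval_nat_numeral)
  qed
  \<comment> \<open>Inserting \<open>key\<close> into the square of \<open>sq\<close> and solving
    for the square of \<open>norm (R w)\<close> gives the factor \<open>q\<close>. It is smaller
    than the square of \<open>n = norm R\<close>, which is the contradiction.\<close>
  define q where "q = n\<^sup>2 - 1 / (c\<^sup>2 * (2 * n\<^sup>2))"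
  have bnd: "(norm (R w))\<^sup>2 \<le> q * (norm w)\<^sup>2" for w
  proof -
    have "(norm w)\<^sup>2 \<le> c\<^sup>2 * (norm (R (R w) - n\<^sup>2 *\<^sub>R w))\<^sup>2"
      using power_mono[OF sq[of w] norm_ge_zero, of 2] by (simp add: power_mult_distrib)
    also have "\<dots> \<le> c\<^sup>2 * (2 * n\<^sup>2 * (n\<^sup>2 * (norm w)\<^sup>2 - (norm (R w))\<^sup>2))"
      by (intro mult_left_mono key) simp
    finally show ?thesis
      using c n by (simp add: q_def field_simps)
  qed
  \<comment> \<open>\<open>q\<close> may be negative, hence the maximum under the root; it is still
    below the square of \<open>n\<close>.\<close>
  have "norm R \<le> sqrt (max q 0)"
  proof (rule norm_blinfun_bound)
    show "norm (R w) \<le> sqrt (max q 0) * norm w" for w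
    proof -
      have "(norm (R w))\<^sup>2 \<le> max q 0 * (norm w)\<^sup>2"
        using bnd[of w] by (rule order_trans) (intro mult_right_mono, auto)
      then have "norm (R w) \<le> sqrt (max q 0 * (norm w)\<^sup>2)"
        by (rule real_le_rsqrt)
      then show ?thesis by (simp add: real_sqrt_mult)
    qed
  qed simp
  then have "n\<^sup>2 \<le> max q 0"
    using n by (metis max.cobounded2 n_def norm_ge_zero power_mono real_sqrt_pow2)
  moreover have "q < n\<^sup>2" "0 < n\<^sup>2"
    using c n by (simp_all add: q_def)
  ultimately show False by linarith
qed

text \<open>It suffices to bound \<open>A - \<mu>\<close> from below by \<open>d\<close>. With
  \<open>a = Re \<mu>\<close>, the real part contributes the distance from \<open>a\<close> to a
  nearest real spectral point \<open>s\<close>, the imaginary part contributes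
  \<open>Im \<mu>\<close>, and the two squares add up to the squared distance from \<open>s\<close>
  to \<open>\<mu>\<close>.\<close>

lemma self_adjoint_resolvent_bound:
  assumes A: "self_adjoint_op A" and d: "0 < d" "\<And>s. s \<in> op_spectrum A \<Longrightarrow> d \<le> dist s \<mu>"
  shows "is_resolvent A \<mu> (resolvent A \<mu>)" and "norm (resolvent A \<mu>) \<le> 1 / d"
proof -
  have "\<mu> \<notin> op_spectrum A" using d(2)[of \<mu>] d(1) by auto
  then show R: "is_resolvent A \<mu> (resolvent A \<mu>)" by (rule is_resolvent_resolvent)
  have low: "d * norm x \<le> norm (y - \<mu> *\<^sub>C x)" if xy: "(x, y) \<in> A" for x y
  proof (rule power2_le_imp_le)
    define a where "a = Re \<mu>"
    have "d\<^sup>2 * (norm x)\<^sup>2 \<le> (norm (y - a *\<^sub>R x))\<^sup>2 + (Im \<mu>)\<^sup>2 * (norm x)\<^sup>2"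
    proof (cases "complex_of_real a \<in> op_spectrum A")
      case True
      have "dist (complex_of_real a) \<mu> = \<bar>Im \<mu>\<bar>"
        by (simp add: dist_norm cmod_def a_def)
      then have "d\<^sup>2 \<le> (Im \<mu>)\<^sup>2"
        using d(2)[OF True] d(1) by (simp add: abs_le_square_iff[symmetric])
      then have "d\<^sup>2 * (norm x)\<^sup>2 \<le> (Im \<mu>)\<^sup>2 * (norm x)\<^sup>2"
        by (rule mult_right_mono) simp
      then show ?thesis by (rule order_trans) simp
    next
      case False
      define Q where "Q = resolvent A (complex_of_real a)"
      have Q: "is_resolvent A (complex_of_real a) Q"
        using False unfolding Q_def by (rule is_resolvent_resolvent)
      have Qx: "Q (y - a *\<^sub>R x) = x"
        using Q xy by (simp add: is_resolvent_iff scaleR_scaleC)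
      show ?thesis
      \<comment> \<open>A nearest spectral point exists only for \<open>Q \<noteq> 0\<close>; if
        \<open>Q = 0\<close>, then \<open>Qx\<close> forces \<open>x = 0\<close>.\<close>
      proof (cases "Q = 0")
        case True
        then show ?thesis using Qx by simp
      next
        case False
        then obtain s where s: "complex_of_real s \<in> op_spectrum A" "\<bar>s - a\<bar> = 1 / norm Q"
          using self_adjoint_nearest_spectrum[OF A Q] by blast
        have "d\<^sup>2 \<le> (dist (complex_of_real s) \<mu>)\<^sup>2"
          using d(2)[OF s(1)] d(1) by (intro power_mono) auto
        also have "\<dots> = (s - a)\<^sup>2 + (Im \<mu>)\<^sup>2"
          by (simp add: dist_norm cmod_power2 a_def)
        finally have "d\<^sup>2 * (norm x)\<^sup>2 \<le> (s - a)\<^sup>2 * (norm x)\<^sup>2 + (Im \<mu>)\<^sup>2 * (norm x)\<^sup>2"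
          by (metis distrib_right mult_right_mono zero_le_power2)
        moreover have "(\<bar>s - a\<bar> * norm x)\<^sup>2 \<le> (norm (y - a *\<^sub>R x))\<^sup>2"
        proof (rule power_mono)
          have "norm x \<le> norm Q * norm (y - a *\<^sub>R x)"
            using norm_blinfun[of Q "y - a *\<^sub>R x"] Qx by simp
          then show "\<bar>s - a\<bar> * norm x \<le> norm (y - a *\<^sub>R x)"
            using False by (simp add: s(2) field_simps)
        qed simp
        ultimately show ?thesis by (simp add: power_mult_distrib)
      qed
    qed
    then show "(d * norm x)\<^sup>2 \<le> (norm (y - \<mu> *\<^sub>C x))\<^sup>2"
      by (simp add: norm_shift_self_adjoint[OF A xy] power_mult_distrib a_def)
  qed simp
  show "norm (resolvent A \<mu>) \<le> 1 / d"
  proof (rule norm_blinfun_bound)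
    fix w
    have "(resolvent A \<mu> w, w + \<mu> *\<^sub>C resolvent A \<mu> w) \<in> A"
      using R by (simp add: is_resolvent_iff)
    from low[OF this] show "norm (resolvent A \<mu> w) \<le> 1 / d * norm w"
      using d(1) by (simp add: field_simps)
  qed (use d(1) in simp)
qed

section \<open>Integrals against operator-valued measures\<close>

text \<open>Read \<open>R i v\<close> as: \<open>v\<close> is a value of the net beyond the index
  \<open>i\<close>. Tails of diameter at most \<open>1 / (n + 1)\<close> are selected and one value
  is taken from each; directedness makes these values a Cauchy sequence. Taking \<open>i = j\<close>
  in \<open>dir\<close> gives nonempty tails.\<close>

lemma net_limit_exists:
  fixes R :: "'i \<Rightarrow> 'v::banach \<Rightarrow> bool"
  assumes cauchy: "\<And>e. 0 < e \<Longrightarrow> \<exists>i\<in>D. \<forall>v w. R i v \<longrightarrow> R i w \<longrightarrow> norm (v - w) \<le> e"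
    and dir: "\<And>i j. i \<in> D \<Longrightarrow> j \<in> D \<Longrightarrow> \<exists>v. R i v \<and> R j v"
  obtains I where "\<And>e. 0 < e \<Longrightarrow> \<exists>i\<in>D. \<forall>v. R i v \<longrightarrow> norm (v - I) < e"
proof -
  have "\<exists>i. i \<in> D \<and> (\<forall>v w. R i v \<longrightarrow> R i w \<longrightarrow> norm (v - w) \<le> 1 / real (Suc n))" for n
    using cauchy[of "1 / real (Suc n)"] by auto
  then obtain i where i: "\<And>n. i n \<in> D"
    "\<And>n v w. R (i n) v \<Longrightarrow> R (i n) w \<Longrightarrow> norm (v - w) \<le> 1 / real (Suc n)"
    by metis
  have "\<exists>v. R (i n) v" for n
    using dir[OF i(1) i(1)] by blast
  then obtain s where s: "\<And>n. R (i n) (s n)" by metis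
  have dist: "norm (s m - s n) \<le> 1 / real (Suc m) + 1 / real (Suc n)" for m n
  proof -
    \<comment> \<open>The chosen indices need not be ordered, so two tails are compared through a
      value that they share.\<close>
    obtain v where v: "R (i m) v" "R (i n) v"
      using dir[OF i(1) i(1)] by blast
    have "norm (s m - v) \<le> 1 / real (Suc m)" "norm (v - s n) \<le> 1 / real (Suc n)"
      by (rule i(2)[OF s v(1)] i(2)[OF v(2) s])+
    then show ?thesis
      using norm_triangle_ineq[of "s m - v" "v - s n"] by simp
  qed
  have small: "\<exists>N. \<forall>n\<ge>N. 1 / real (Suc n) < e" if e: "0 < e" for e
  proof -
    obtain N where N: "1 / real (Suc N) < e"
      using reals_Archimedean[OF e] by (auto simp: inverse_eq_divide)
    have "1 / real (Suc n) < e" if "N \<le> n" for n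
    proof -
      have "1 / real (Suc n) \<le> 1 / real (Suc N)"
        using that by (intro divide_left_mono) auto
      then show ?thesis using N by simp
    qed
    then show ?thesis by blast
  qed
  have "Cauchy s"
  proof (rule CauchyI)
    fix e :: real assume "0 < e"
    then obtain N where N: "\<And>n. N \<le> n \<Longrightarrow> 1 / real (Suc n) < e / 2"
      using small[of "e / 2"] by auto
    have "norm (s m - s n) < e" if "N \<le> m" "N \<le> n" for m n
      using dist[of m n] N[OF that(1)] N[OF that(2)] by linarith
    then show "\<exists>N. \<forall>m\<ge>N. \<forall>n\<ge>N. norm (s m - s n) < e" by blast
  qed
  then obtain I where I: "s \<longlonglongrightarrow> I"
    by (metis Cauchy_convergent_iff convergent_def)
  show ?thesis
  proof (rule that)
    fix e :: real assume e: "0 < e"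
    then obtain N where N: "\<And>n. N \<le> n \<Longrightarrow> 1 / real (Suc n) < e / 2"
      using small[of "e / 2"] by auto
    obtain N' where N': "\<And>n. N' \<le> n \<Longrightarrow> norm (s n - I) < e / 2"
      using LIMSEQ_D[OF I, of "e / 2"] e by auto
    define n where "n = max N N'"
    have "norm (v - I) < e" if "R (i n) v" for v
    proof -
      have "norm (v - s n) \<le> 1 / real (Suc n)" by (rule i(2)[OF that s])
      moreover have "1 / real (Suc n) < e / 2" "norm (s n - I) < e / 2"
        by (rule N N'; simp add: n_def)+
      ultimately show ?thesis
        using norm_triangle_ineq[of "v - s n" "s n - I"] by simp
    qed
    then show "\<exists>i\<in>D. \<forall>v. R i v \<longrightarrow> norm (v - I) < e"
      using i(1) by blast
  qed
qed

section \<open>Strongly additive operator measures and the variation of their tails\<close>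

text \<open>Countable additivity in the strong operator topology, the form that survives the
  compression of a spectral measure by \<open>opB10\<close> and \<open>opB01\<close>.\<close>

definition strong_measure :: "(real set \<Rightarrow> 'b::real_normed_vector \<Rightarrow>\<^sub>L 'c::real_normed_vector) \<Rightarrow> bool" where
  "strong_measure M \<longleftrightarrow> (\<forall>\<delta>::nat \<Rightarrow> real set. range \<delta> \<subseteq> sets borel \<and> disjoint_family \<delta> \<longrightarrow>
     (\<forall>x. (\<lambda>n. M (\<delta> n) x) sums M (\<Union>n. \<delta> n) x))"

definition variation_le :: "(real set \<Rightarrow> 'b::real_normed_vector \<Rightarrow>\<^sub>L 'c::real_normed_vector) \<Rightarrow>
    real set \<Rightarrow> real \<Rightarrow> bool" where
  "variation_le M S v \<longleftrightarrow> (\<forall>P. borel_partition S P \<longrightarrow> (\<Sum>\<delta>\<in>P. norm (M \<delta>)) \<le> v)"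

text \<open>For the constant sequence of empty sets, additivity says that a series with all terms
  equal to \<open>M {} x\<close> converges.\<close>

lemma strong_measure_empty:
  assumes "strong_measure M"
  shows "M {} = 0"
proof (rule blinfun_eqI)
  fix x
  have "(\<lambda>n::nat. M {} x) sums M (\<Union>n::nat. {}) x"
    using assms by (auto simp: strong_measure_def disjoint_family_on_def dest: spec[where x="\<lambda>n::nat. {}"])
  then show "M {} x = (0 :: _ \<Rightarrow>\<^sub>L _) x"
    using sums_summable summable_const_iff by fastforce
qed

lemma strong_measure_Un:
  assumes M: "strong_measure M" and "A \<in> sets borel" "B \<in> sets borel" "A \<inter> B = {}"
  shows "M (A \<union> B) = M A + M B"
proof (rule blinfun_eqI)
  fix x
  define \<delta> where "\<delta> n = (if n = 0 then A else if n = 1 then B else {})" for n :: nat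
  have "range \<delta> \<subseteq> sets borel" "disjoint_family \<delta>"
    using assms by (auto simp: \<delta>_def disjoint_family_on_def)
  then have "(\<lambda>n. M (\<delta> n) x) sums M (\<Union>n. \<delta> n) x"
    using M by (auto simp: strong_measure_def)
  moreover have "(\<Union>n. \<delta> n) = A \<union> B"
    by (force simp: \<delta>_def split: if_splits)
  moreover have "(\<lambda>n. M (\<delta> n) x) sums (\<Sum>n\<in>{0,1}. M (\<delta> n) x)"
    by (rule sums_finite) (auto simp: \<delta>_def strong_measure_empty[OF M])
  ultimately show "M (A \<union> B) x = (M A + M B) x"
    using sums_unique2 by (fastforce simp: \<delta>_def blinfun.add_left)
qed

lemma strong_measure_Union:
  assumes M: "strong_measure M" and P: "finite P" "P \<subseteq> sets borel" "disjoint P"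
  shows "M (\<Union>P) = (\<Sum>\<delta>\<in>P. M \<delta>)"
  using P
proof (induction P)
  case empty
  then show ?case by (simp add: strong_measure_empty[OF M])
next
  case (insert A P)
  have "A \<inter> \<Union>P = {}"
    using insert by (auto simp: pairwise_def disjnt_def)
  moreover have "\<Union>P \<in> sets borel"
    using insert by (intro sets.finite_Union) auto
  ultimately have "M (A \<union> \<Union>P) = M A + M (\<Union>P)"
    using insert by (intro strong_measure_Un[OF M]) auto
  then show ?case
    using insert by (simp add: pairwise_insert)
qed

text \<open>\<open>disjointed\<close> turns the growing intervals into disjoint shells, so strong
  countable additivity becomes convergence along the truncations.\<close>

lemma strong_measure_truncate:
  assumes M: "strong_measure M" and A: "A \<in> sets borel"
  shows "(\<lambda>n. M (A \<inter> {- real n..real n}) x) \<longlonglongrightarrow> M A x"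
proof -
  define I where "I n = {- real n..real n}" for n
  define \<delta> where "\<delta> n = A \<inter> disjointed I n" for n
  have I: "range I \<subseteq> sets borel" by (auto simp: I_def)
  have \<delta>: "range \<delta> \<subseteq> sets borel"
    using A sets.range_disjointed_sets[OF I] by (auto simp: \<delta>_def)
  moreover have dis: "disjoint_family \<delta>"
    using disjoint_family_disjointed[of I] by (auto simp: \<delta>_def disjoint_family_on_def)
  moreover have "(\<Union>n. \<delta> n) = A"
  proof -
    have "(\<Union>n. I n) = UNIV"
    proof -
      have "x \<in> I (nat \<lceil>\<bar>x\<bar>\<rceil>)" for x by (simp add: I_def) linarith
      then show ?thesis by blast
    qed
    then show ?thesis
      by (auto simp: \<delta>_def UN_disjointed_eq simp flip: Int_UN_distrib)
  qed
  ultimately have "(\<lambda>n. M (\<delta> n) x) sums M A x"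
    using M unfolding strong_measure_def by metis
  then have lim: "(\<lambda>n. \<Sum>i\<le>n. M (\<delta> i) x) \<longlonglongrightarrow> M A x"
    by (simp add: sums_def_le)
  have UN: "A \<inter> I n = (\<Union>i\<le>n. \<delta> i)" for n
  proof -
    have "(\<Union>i\<le>n. disjointed I i) = (\<Union>i\<le>n. I i)"
      using finite_UN_disjointed_eq[of I "Suc n"]
      by (simp only: atLeast0LessThan lessThan_Suc_atMost)
    also have "\<dots> = I n"
    proof
      show "(\<Union>i\<le>n. I i) \<subseteq> I n" by (auto simp: I_def)
    qed auto
    finally show ?thesis
      by (simp only: \<delta>_def Int_UN_distrib[symmetric])
  qed
  have "M (\<Union>i\<le>n. \<delta> i) x = (\<Sum>i\<le>n. M (\<delta> i) x)" for n
  proof (induction n)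
    case (Suc n)
    have "\<delta> (Suc n) \<inter> (\<Union>i\<le>n. \<delta> i) = {}"
      using disjoint_family_onD[OF dis, of "Suc n"] unfolding Int_UN_distrib by simp
    moreover have "(\<Union>i\<le>n. \<delta> i) \<in> sets borel"
      using \<delta> by (intro sets.finite_UN) auto
    ultimately have "M (\<delta> (Suc n) \<union> (\<Union>i\<le>n. \<delta> i)) = M (\<delta> (Suc n)) + M (\<Union>i\<le>n. \<delta> i)"
      using \<delta> by (intro strong_measure_Un[OF M]) auto
    then show ?case
      using Suc by (simp add: atMost_Suc blinfun.add_left)
  qed simp
  then show ?thesis
    using lim by (simp add: UN[unfolded I_def])
qed

text \<open>Lower semicontinuity of the operator norm: a single vector that nearly attains
  \<open>norm (M A)\<close> already witnesses the bound for all late truncations.\<close>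

lemma strong_measure_norm_truncate:
  assumes M: "strong_measure M" and A: "A \<in> sets borel" and e: "0 < e"
  shows "\<forall>\<^sub>F n in sequentially. norm (M A) - e < norm (M (A \<inter> {- real n..real n}))"
proof -
  \<comment> \<open>A nearly norming vector is available only while \<open>norm (M A) - e\<close> is
    nonnegative; otherwise the claim is trivial.\<close>
  have "\<exists>x. norm (M A x) > (norm (M A) - e) * norm x" if "e \<le> norm (M A)"
  proof (rule ccontr)
    assume "\<not> ?thesis"
    then have "norm (M A) \<le> norm (M A) - e"
      using that by (intro norm_blinfun_bound) (simp_all add: not_less)
    then show False using e by simp
  qed
  then consider x where "norm (M A x) > (norm (M A) - e) * norm x" | "norm (M A) < e"
    by (meson not_less)
  then show ?thesis
  proof cases
    case 2
    then have "norm (M A) - e < norm (M (A \<inter> {- real n..real n}))" for n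
      using norm_ge_zero[of "M (A \<inter> {- real n..real n})"] by linarith
    then show ?thesis by simp
  next
    case x: 1
    have "(\<lambda>n. norm (M (A \<inter> {- real n..real n}) x)) \<longlonglongrightarrow> norm (M A x)"
      by (intro tendsto_norm strong_measure_truncate[OF M A])
    then have "\<forall>\<^sub>F n in sequentially. (norm (M A) - e) * norm x < norm (M (A \<inter> {- real n..real n}) x)"
      using x by (rule order_tendstoD)
    then show ?thesis
    proof eventually_elim
      case (elim n)
      then have "(norm (M A) - e) * norm x < norm (M (A \<inter> {- real n..real n})) * norm x"
        using norm_blinfun[of "M (A \<inter> {- real n..real n})" x] by linarith
      then show ?case by (rule mult_right_less_imp_less) simp
    qed
  qed
qed

lemma borel_partition_Un:
  assumes "borel_partition A P" "borel_partition B Q" "A \<inter> B = {}"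
  shows "borel_partition (A \<union> B) (P \<union> Q)" "P \<inter> Q = {}"
proof -
  have dis: "p \<inter> q = {}" if "p \<in> P" "q \<in> Q" for p q
    using assms that unfolding borel_partition_def partition_on_def by blast
  have "disjoint (P \<union> Q)"
  proof (rule pairwiseI)
    have PQ: "disjoint P" "disjoint Q"
      using assms by (simp_all add: borel_partition_def partition_on_def)
    fix x y assume "x \<in> P \<union> Q" "y \<in> P \<union> Q" and ne: "x \<noteq> y"
    then consider "x \<in> P" "y \<in> P" | "x \<in> P" "y \<in> Q" | "x \<in> Q" "y \<in> P" | "x \<in> Q" "y \<in> Q"
      by blast
    then show "disjnt x y"
      by cases (use PQ ne dis[of x y] dis[of y x] in \<open>auto simp: disjnt_def pairwise_def\<close>)
  qed
  then show "borel_partition (A \<union> B) (P \<union> Q)"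
    using assms by (auto simp: borel_partition_def partition_on_def)
  have "{} \<notin> P"
    using assms(1) by (simp add: borel_partition_def partition_on_def)
  then show "P \<inter> Q = {}"
    using dis by (metis Int_absorb disjoint_iff)
qed

lemma borel_partition_single: "S \<in> sets borel \<Longrightarrow> borel_partition S ({S} - {{}})"
  by (cases "S = {}") (auto simp: borel_partition_def partition_on_def)

lemma borel_partition_truncate:
  assumes P: "borel_partition S P" and I: "I \<in> sets borel"
  shows "borel_partition (I \<inter> S) (((\<inter>) I) ` P - {{}})"
  using assms partition_on_restrict[of S P I] by (auto simp: borel_partition_def)

text \<open>Cells that meet \<open>I\<close> are disjoint and so have distinct traces on it; all
  other traces collapse to the empty set, where \<open>f\<close> is 0.\<close>

lemma sum_truncate:
  assumes P: "borel_partition S P" and f: "f {} = (0::real)"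
  shows "(\<Sum>\<delta>\<in>((\<inter>) I) ` P - {{}}. f \<delta>) = (\<Sum>\<delta>\<in>P. f (\<delta> \<inter> I))"
proof -
  have "(\<Sum>\<delta>\<in>((\<inter>) I) ` P - {{}}. f \<delta>) = (\<Sum>\<delta>\<in>((\<inter>) I) ` {\<delta>\<in>P. \<delta> \<inter> I \<noteq> {}}. f \<delta>)"
    by (rule sum.cong) auto
  also have "\<dots> = (\<Sum>\<delta>\<in>{\<delta>\<in>P. \<delta> \<inter> I \<noteq> {}}. f (\<delta> \<inter> I))"
  proof (subst sum.reindex)
    show "inj_on ((\<inter>) I) {\<delta> \<in> P. \<delta> \<inter> I \<noteq> {}}"
    proof (rule inj_onI)
      fix x y assume xy: "x \<in> {\<delta> \<in> P. \<delta> \<inter> I \<noteq> {}}" "y \<in> {\<delta> \<in> P. \<delta> \<inter> I \<noteq> {}}" "I \<inter> x = I \<inter> y"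
      then have "x \<inter> y \<noteq> {}" by blast
      moreover have "disjoint P" using P by (simp add: borel_partition_def partition_on_def)
      ultimately show "x = y"
        using xy by (metis (no_types, lifting) disjnt_def mem_Collect_eq pairwiseD)
    qed
  qed (simp add: Int_commute)
  also have "\<dots> = (\<Sum>\<delta>\<in>P. f (\<delta> \<inter> I))"
    using P f by (intro sum.mono_neutral_left) (auto simp: borel_partition_def)
  finally show ?thesis .
qed

text \<open>The measure is only strongly countably additive, but finite variation makes the variation
  of the tails small, by lower semicontinuity of the norm.\<close>

lemma variation_tail:
  assumes M: "strong_measure M" and v: "variation_le M S v" and S: "S \<in> sets borel"
    and e: "0 < e"
  obtains n where "variation_le M (S - {- real n..real n}) e"
proof -
  define V where "V = (\<lambda>P. \<Sum>\<delta>\<in>P. norm (M \<delta>)) ` {P. borel_partition S P}"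
  have bdd: "bdd_above V"
    using v by (auto simp: V_def variation_le_def intro: bdd_aboveI)
  have "borel_partition S ({S} - {{}})"
    using S by (rule borel_partition_single)
  then have ne: "V \<noteq> {}" by (auto simp: V_def)
  have "\<exists>y\<in>V. Sup V - e / 2 < y"
    using less_cSup_iff[OF ne bdd, of "Sup V - e / 2"] e by simp
  then obtain P where P: "borel_partition S P" and PV: "Sup V - e / 2 < (\<Sum>\<delta>\<in>P. norm (M \<delta>))"
    by (auto simp: V_def)
  have fin: "finite P" using P by (simp add: borel_partition_def)
  \<comment> \<open>Truncation loses at most \<open>c\<close> per cell, in total at most
    \<open>e / 2\<close>; the other half is the gap of \<open>P\<close> below the supremum. The
    added 1 covers an empty \<open>P\<close>.\<close>
  define c where "c = e / (2 * (card P + 1))"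
  have c: "0 < c" using e by (simp add: c_def)
  have "\<forall>\<^sub>F n in sequentially. \<forall>\<delta>\<in>P. norm (M \<delta>) - c < norm (M (\<delta> \<inter> {- real n..real n}))"
    using P by (intro eventually_ball_finite[OF fin] ballI strong_measure_norm_truncate[OF M _ c])
      (auto simp: borel_partition_def)
  then obtain n where n: "\<And>\<delta>. \<delta> \<in> P \<Longrightarrow> norm (M \<delta>) - c < norm (M (\<delta> \<inter> {- real n..real n}))"
    by (auto simp: eventually_sequentially)
  define I where "I = {- real n..real n}"
  have "variation_le M (S - I) e"
    unfolding variation_le_def
  proof (intro allI impI)
    fix Q assume Q: "borel_partition (S - I) Q"
    define P' where "P' = ((\<inter>) I) ` P - {{}}"
    have P': "borel_partition (I \<inter> S) P'"
      unfolding P'_def by (rule borel_partition_truncate[OF P]) (simp add: I_def)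
    \<comment> \<open>\<open>P\<close> cut down to \<open>I\<close> together with \<open>Q\<close>
      partitions all of \<open>S\<close>. Its total stays below \<open>Sup V\<close>, of which the
      truncated \<open>P\<close> already uses up all but \<open>e\<close>.\<close>
    have "I \<inter> S \<union> (S - I) = S" by blast
    then have R: "borel_partition S (P' \<union> Q)" "P' \<inter> Q = {}"
      using borel_partition_Un[OF P' Q] by auto
    have "(\<Sum>\<delta>\<in>P' \<union> Q. norm (M \<delta>)) \<le> Sup V"
      using R(1) by (intro cSup_upper[OF _ bdd]) (auto simp: V_def)
    moreover have "(\<Sum>\<delta>\<in>P' \<union> Q. norm (M \<delta>)) = (\<Sum>\<delta>\<in>P'. norm (M \<delta>)) + (\<Sum>\<delta>\<in>Q. norm (M \<delta>))"
      using P' Q R(2) by (intro sum.union_disjoint) (auto simp: borel_partition_def)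
    moreover have "(\<Sum>\<delta>\<in>P'. norm (M \<delta>)) = (\<Sum>\<delta>\<in>P. norm (M (\<delta> \<inter> I)))"
      unfolding P'_def by (rule sum_truncate[OF P]) (simp add: strong_measure_empty[OF M])
    moreover have "(\<Sum>\<delta>\<in>P. norm (M \<delta>) - c) \<le> (\<Sum>\<delta>\<in>P. norm (M (\<delta> \<inter> I)))"
      using n by (intro sum_mono less_imp_le) (simp add: I_def)
    moreover have "card P * c \<le> e / 2"
      using e by (simp add: c_def field_simps)
    ultimately show "(\<Sum>\<delta>\<in>Q. norm (M \<delta>)) \<le> e"
      using PV by (simp add: sum_subtractf)
  qed
  then show ?thesis
    unfolding I_def by (rule that)
qed

section \<open>Tagged Borel sums and the operator integral\<close>

lemma borel_partition_common_refinement: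
  assumes P: "borel_partition S P" and Q: "borel_partition S Q"
  obtains R where "borel_partition S R" "refines S R P" "refines S R Q"
proof -
  define R where "R = common_refinement {P, Q}"
  have P': "partition_on S P" "finite P" "P \<subseteq> sets borel" and Q': "partition_on S Q" "finite Q" "Q \<subseteq> sets borel"
    using P Q by (auto simp: borel_partition_def)
  have "partition_on S R"
    unfolding R_def using P' Q' by (intro partition_on_common_refinement) auto
  moreover have "finite R"
    unfolding R_def using P' Q' by (intro finite_common_refinement) auto
  moreover have "R \<subseteq> sets borel"
    using P' Q' by (auto simp: R_def common_refinement Pi_def)
  moreover have "refines S R P" "refines S R Q"
    unfolding R_def using P' Q' by (auto intro: refines_common_refinement)
  ultimately show ?thesis
    by (intro that) (auto simp: borel_partition_def)
qed

text \<open>Cells of a partition are nonempty, so each fine cell lies in exactly one coarse cell and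
  the grouping counts nothing twice.\<close>

lemma sum_refines:
  assumes "refines S P Q" "finite P" "finite Q"
  shows "(\<Sum>p\<in>P. f p) = (\<Sum>q\<in>Q. \<Sum>p\<in>{p\<in>P. p \<subseteq> q}. f p)"
proof -
  have ne: "\<And>p. p \<in> P \<Longrightarrow> p \<noteq> {}" and dis: "\<And>q q'. q \<in> Q \<Longrightarrow> q' \<in> Q \<Longrightarrow> q \<noteq> q' \<Longrightarrow> q \<inter> q' = {}"
    and sub: "\<And>p. p \<in> P \<Longrightarrow> \<exists>q\<in>Q. p \<subseteq> q"
    using assms(1) by (auto simp: refines_def partition_on_def pairwise_def disjnt_def)
  have "P = (\<Union>q\<in>Q. {p\<in>P. p \<subseteq> q})"
    using sub by blast
  also have "(\<Sum>p\<in>\<dots>. f p) = (\<Sum>q\<in>Q. \<Sum>p\<in>{p\<in>P. p \<subseteq> q}. f p)"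
    using assms(2,3) ne dis by (intro sum.UNION_disjoint ballI impI) (simp, simp, fast)
  finally show ?thesis .
qed

text \<open>Writing \<open>M q\<close> as the sum of its fine cells puts both sums over the same
  cells; only the difference of the tags remains. The oscillation is allowed to depend on the coarse
  cell because one unbounded cell has to be treated differently.\<close>

lemma op_sum_refines:
  assumes M: "strong_measure M" and P: "borel_partition S P" and Q: "borel_partition S Q"
    and ref: "refines S P Q"
    and osc: "\<And>p q. p \<in> P \<Longrightarrow> q \<in> Q \<Longrightarrow> p \<subseteq> q \<Longrightarrow> norm (T (\<xi> p) - T (\<zeta> q)) \<le> osc q"
  shows "norm ((\<Sum>p\<in>P. M p o\<^sub>L T (\<xi> p)) - (\<Sum>q\<in>Q. M q o\<^sub>L T (\<zeta> q)))
    \<le> (\<Sum>q\<in>Q. osc q * (\<Sum>p\<in>{p\<in>P. p \<subseteq> q}. norm (M p)))"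
proof -
  have fin: "finite P" "finite Q" using P Q by (auto simp: borel_partition_def)
  have "M q o\<^sub>L T (\<zeta> q) = (\<Sum>p\<in>{p\<in>P. p \<subseteq> q}. M p o\<^sub>L T (\<zeta> q))" if "q \<in> Q" for q
  proof -
    have "partition_on q {p\<in>P. p \<subseteq> q}"
      using refines_obtains_subset[OF ref that] .
    then have "M q = (\<Sum>p\<in>{p\<in>P. p \<subseteq> q}. M p)"
      using strong_measure_Union[OF M, of "{p\<in>P. p \<subseteq> q}"] P fin
      by (auto simp: partition_on_def borel_partition_def)
    then show ?thesis
      by (simp add: bounded_bilinear.sum_left[OF bounded_bilinear_blinfun_compose])
  qed
  then have "(\<Sum>p\<in>P. M p o\<^sub>L T (\<xi> p)) - (\<Sum>q\<in>Q. M q o\<^sub>L T (\<zeta> q))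
      = (\<Sum>q\<in>Q. \<Sum>p\<in>{p\<in>P. p \<subseteq> q}. M p o\<^sub>L (T (\<xi> p) - T (\<zeta> q)))"
    by (simp add: sum_refines[OF ref fin] blinfun_compose_left_diff sum_subtractf)
  also have "norm \<dots> \<le> (\<Sum>q\<in>Q. \<Sum>p\<in>{p\<in>P. p \<subseteq> q}. norm (M p) * osc q)"
  proof (intro sum_norm_le)
    fix q p assume "q \<in> Q" "p \<in> {p\<in>P. p \<subseteq> q}"
    then show "norm (M p o\<^sub>L (T (\<xi> p) - T (\<zeta> q))) \<le> norm (M p) * osc q"
      using norm_blinfun_compose[of "M p" "T (\<xi> p) - T (\<zeta> q)"]
        mult_left_mono[OF osc norm_ge_zero[of "M p"]] by fastforce
  qed
  finally show ?thesis
    by (simp add: sum_distrib_left mult.commute)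
qed

lemma borel_partition_vimage:
  fixes f :: "real \<Rightarrow> int"
  assumes "f \<in> borel_measurable borel" "finite (f ` S)" "S \<in> sets borel"
  shows "borel_partition S ((\<lambda>i. S \<inter> f -` {i}) ` f ` S)"
proof -
  have "f -` {i} \<in> sets borel" for i
    using measurable_sets[OF assms(1), of "{i}"] by simp
  then show ?thesis
    using assms by (auto simp: borel_partition_def partition_on_def pairwise_def disjnt_def)
qed

text \<open>Outside a large interval \<open>I\<close> the variation is small and \<open>T\<close> is
  merely bounded, so a single cell suffices there. On the compact part, uniform continuity gives
  small oscillation on the cells where \<open>\<lfloor>x / d\<rfloor>\<close> is constant.\<close>

lemma op_integral_cauchy:
  fixes T :: "real \<Rightarrow> 'a::complex_normed \<Rightarrow>\<^sub>L 'b::complex_normed"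
    and M :: "real set \<Rightarrow> 'b \<Rightarrow>\<^sub>L 'c::complex_normed"
  assumes M: "strong_measure M" and v: "variation_le M S v" and S: "closed S"
    and T: "continuous_on S T" "\<And>x. x \<in> S \<Longrightarrow> norm (T x) \<le> C" and e: "0 < e"
  obtains Q where "borel_partition S Q"
    "\<And>P \<xi> \<zeta>. borel_partition S P \<Longrightarrow> refines S P Q \<Longrightarrow> (\<And>p. p \<in> P \<Longrightarrow> \<xi> p \<in> p) \<Longrightarrow>
      (\<And>q. q \<in> Q \<Longrightarrow> \<zeta> q \<in> q) \<Longrightarrow>
      norm ((\<Sum>p\<in>P. M p o\<^sub>L T (\<xi> p)) - (\<Sum>q\<in>Q. M q o\<^sub>L T (\<zeta> q))) \<le> e"
proof -
  \<comment> \<open>The outer cell costs at most \<open>2 * \<bar>C\<bar> * c\<close> and the inner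
    cells at most \<open>h * \<bar>v\<bar>\<close>; each is made at most \<open>e / 2\<close>, and
    the added 1 avoids a zero denominator.\<close>
  define c where "c = e / (4 * (\<bar>C\<bar> + 1))"
  have c: "0 < c" using e by (simp add: c_def)
  define h where "h = e / (2 * (\<bar>v\<bar> + 1))"
  have h: "0 < h" using e by (simp add: h_def)
  have Sb: "S \<in> sets borel" using S by (rule borel_closed)
  obtain n where n: "variation_le M (S - {- real n..real n}) c"
    using variation_tail[OF M v Sb c] .
  define I where "I = {- real n..real n}"
  have "compact (S \<inter> I)"
    unfolding I_def by (intro closed_Int_compact S compact_Icc)
  then have "uniformly_continuous_on (S \<inter> I) T"
    by (intro compact_uniformly_continuous continuous_on_subset[OF T(1)]) auto
  then obtain d where d: "0 < d"
    "\<And>x y. x \<in> S \<inter> I \<Longrightarrow> y \<in> S \<inter> I \<Longrightarrow> dist y x < d \<Longrightarrow> dist (T y) (T x) < h"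
    using h unfolding uniformly_continuous_on_def by metis
  \<comment> \<open>\<open>k\<close> exceeds every \<open>\<lfloor>x / d\<rfloor>\<close> with
    \<open>x\<close> in \<open>I\<close>, so as a label it marks exactly the complement of
    \<open>I\<close>.\<close>
  define k where "k = \<lfloor>real n / d\<rfloor> + 1"
  define f where "f x = (if x \<in> I then \<lfloor>x / d\<rfloor> else k)" for x
  have fI: "- k - 1 \<le> f x \<and> f x < k" if "x \<in> I" for x
  proof -
    have "- (real n / d) \<le> x / d" "x / d \<le> real n / d"
      using that d(1) by (auto simp: I_def divide_simps)
    then show ?thesis
      using that unfolding f_def k_def by (simp, linarith)
  qed
  then have fI_iff: "x \<in> I \<longleftrightarrow> f x \<noteq> k" for x
    by (auto simp: f_def)
  have "f ` S \<subseteq> insert k {-k-1..k}"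
    using fI fI_iff by force
  then have "finite (f ` S)" by (rule finite_subset) simp
  moreover have "f \<in> borel_measurable borel"
  proof -
    have "(\<lambda>x::real. \<lfloor>x / d\<rfloor>) \<in> measurable borel (count_space UNIV)"
      by measurable
    then have "f \<in> measurable borel (count_space UNIV)"
      unfolding f_def I_def by measurable
    then show ?thesis
      by (rule measurable_compose) simp
  qed
  ultimately have Q: "borel_partition S ((\<lambda>i. S \<inter> f -` {i}) ` f ` S)" (is "borel_partition S ?Q")
    using Sb by (intro borel_partition_vimage)
  define osc where "osc q = (if q \<subseteq> I then h else 2 * \<bar>C\<bar>)" for q
  show ?thesis
  proof (rule that[OF Q])
    fix P \<xi> \<zeta>
    assume P: "borel_partition S P" and ref: "refines S P ?Q"
      and \<xi>: "\<And>p. p \<in> P \<Longrightarrow> \<xi> p \<in> p" and \<zeta>: "\<And>q. q \<in> ?Q \<Longrightarrow> \<zeta> q \<in> q"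
    have fin: "finite P" "finite ?Q"
      using P Q by (auto simp: borel_partition_def)
    have osc: "norm (T (\<xi> p) - T (\<zeta> q)) \<le> osc q" if pq: "p \<in> P" "q \<in> ?Q" "p \<subseteq> q" for p q
    proof -
      have mem: "\<xi> p \<in> q" "\<zeta> q \<in> q" using pq \<xi> \<zeta> by auto
      obtain i where q: "q = S \<inter> f -` {i}" using pq(2) by auto
      show ?thesis
      proof (cases "q \<subseteq> I")
        case True
        then have "f (\<xi> p) = \<lfloor>\<xi> p / d\<rfloor>" "f (\<zeta> q) = \<lfloor>\<zeta> q / d\<rfloor>"
          using mem by (auto simp: f_def)
        moreover have "f (\<xi> p) = i" "f (\<zeta> q) = i"
          using mem q by blast+
        ultimately have "\<lfloor>\<xi> p / d\<rfloor> = \<lfloor>\<zeta> q / d\<rfloor>" by simp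
        then have "\<bar>\<xi> p / d - \<zeta> q / d\<bar> < 1" by linarith
        then have "dist (\<xi> p) (\<zeta> q) < d"
          using d(1) by (simp add: dist_real_def flip: diff_divide_distrib)
        moreover have "\<xi> p \<in> S \<inter> I" "\<zeta> q \<in> S \<inter> I"
          using mem True q by blast+
        ultimately have "dist (T (\<xi> p)) (T (\<zeta> q)) < h"
          by (intro d(2))
        then show ?thesis
          using True by (simp add: osc_def dist_norm)
      next
        case False
        have "norm (T (\<xi> p)) \<le> C" "norm (T (\<zeta> q)) \<le> C"
          using mem q by (auto intro: T(2))
        then show ?thesis
          using False norm_triangle_ineq4[of "T (\<xi> p)" "T (\<zeta> q)"] by (simp add: osc_def)
      qed
    qed
    have out: "q = S - I" if q: "q \<in> ?Q" "\<not> q \<subseteq> I" for q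
    proof -
      obtain i where i: "q = S \<inter> f -` {i}" using q(1) by auto
      then obtain x where "x \<notin> I" "f x = i" using q(2) by blast
      then have "i = k" using fI_iff by metis
      then show ?thesis
        unfolding i using fI_iff by blast
    qed
    have "norm ((\<Sum>p\<in>P. M p o\<^sub>L T (\<xi> p)) - (\<Sum>q\<in>?Q. M q o\<^sub>L T (\<zeta> q)))
        \<le> (\<Sum>q\<in>?Q. osc q * (\<Sum>p\<in>{p\<in>P. p \<subseteq> q}. norm (M p)))"
      by (rule op_sum_refines[OF M P Q ref]) (rule osc)
    \<comment> \<open>Inner cells are charged the oscillation \<open>h\<close>; the one possible
      outer cell \<open>S - I\<close> is charged its full oscillation times its small
      variation.\<close>
    also have "\<dots> \<le> (\<Sum>q\<in>?Q. h * (\<Sum>p\<in>{p\<in>P. p \<subseteq> q}. norm (M p)) + (if q = S - I then 2 * \<bar>C\<bar> * c else 0))"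
    proof (rule sum_mono)
      fix q assume q: "q \<in> ?Q"
      show "osc q * (\<Sum>p\<in>{p\<in>P. p \<subseteq> q}. norm (M p))
        \<le> h * (\<Sum>p\<in>{p\<in>P. p \<subseteq> q}. norm (M p)) + (if q = S - I then 2 * \<bar>C\<bar> * c else 0)"
      proof (cases "q \<subseteq> I")
        case True
        then show ?thesis using c by (simp add: osc_def)
      next
        case False
        have "partition_on q {p\<in>P. p \<subseteq> q}"
          using refines_obtains_subset[OF ref q] .
        then have "borel_partition (S - I) {p\<in>P. p \<subseteq> q}"
          using out[OF q False] P by (auto simp: borel_partition_def)
        then have "(\<Sum>p\<in>{p\<in>P. p \<subseteq> q}. norm (M p)) \<le> c"
          using n by (auto simp: variation_le_def I_def)
        then have "2 * \<bar>C\<bar> * (\<Sum>p\<in>{p\<in>P. p \<subseteq> q}. norm (M p)) \<le> 2 * \<bar>C\<bar> * c"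
          by (intro mult_left_mono) auto
        moreover have "0 \<le> h * (\<Sum>p\<in>{p\<in>P. p \<subseteq> q}. norm (M p))"
          using h by (intro mult_nonneg_nonneg sum_nonneg) auto
        ultimately show ?thesis
          using out[OF q False] False by (simp add: osc_def)
      qed
    qed
    also have "\<dots> = h * (\<Sum>p\<in>P. norm (M p)) + (\<Sum>q\<in>?Q. if q = S - I then 2 * \<bar>C\<bar> * c else 0)"
      by (simp add: sum.distrib sum_refines[OF ref fin] sum_distrib_left)
    also have "\<dots> \<le> h * \<bar>v\<bar> + 2 * \<bar>C\<bar> * c"
    proof (rule add_mono)
      have "(\<Sum>p\<in>P. norm (M p)) \<le> \<bar>v\<bar>"
        using v P unfolding variation_le_def by force
      then show "h * (\<Sum>p\<in>P. norm (M p)) \<le> h * \<bar>v\<bar>"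
        using h by (intro mult_left_mono) auto
      show "(\<Sum>q\<in>?Q. if q = S - I then 2 * \<bar>C\<bar> * c else 0) \<le> 2 * \<bar>C\<bar> * c"
        using c by (subst sum.delta[OF fin(2)]) auto
    qed
    also have "\<dots> \<le> e / 2 + e / 2"
    proof (rule add_mono)
      show "h * \<bar>v\<bar> \<le> e / 2"
        using e by (simp add: h_def field_simps)
      show "2 * \<bar>C\<bar> * c \<le> e / 2"
        using e by (simp add: c_def field_simps)
    qed
    finally show "norm ((\<Sum>p\<in>P. M p o\<^sub>L T (\<xi> p)) - (\<Sum>q\<in>?Q. M q o\<^sub>L T (\<zeta> q))) \<le> e"
      by simp
  qed
qed

lemma partition_tags:
  assumes "borel_partition S P"
  obtains \<xi> where "\<forall>p\<in>P. \<xi> p \<in> p"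
proof
  show "\<forall>p\<in>P. (SOME x. x \<in> p) \<in> p"
    using assms by (metis borel_partition_def partition_on_def ex_in_conv someI_ex)
qed

text \<open>The net is indexed by partitions, with common refinements for directedness. Two sums
  beyond \<open>Q\<close> are each within \<open>e / 2\<close> of one tagged sum over
  \<open>Q\<close> itself.\<close>

lemma has_op_integral_exists:
  fixes T :: "real \<Rightarrow> 'a::complex_normed \<Rightarrow>\<^sub>L 'b::complex_normed"
    and M :: "real set \<Rightarrow> 'b \<Rightarrow>\<^sub>L 'c::{complex_normed,banach}"
  assumes M: "strong_measure M" and v: "variation_le M S v" and S: "closed S"
    and T: "continuous_on S T" "\<And>x. x \<in> S \<Longrightarrow> norm (T x) \<le> C"
  obtains I where "has_op_integral M S T I"
proof -
  define s where "s P \<xi> = (\<Sum>p\<in>P. M p o\<^sub>L T (\<xi> p))" for P \<xi>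
  define R where "R Q w \<longleftrightarrow> (\<exists>P \<xi>. borel_partition S P \<and> refines S P Q \<and> (\<forall>p\<in>P. \<xi> p \<in> p) \<and> w = s P \<xi>)"
    for Q w
  have "\<exists>Q\<in>Collect (borel_partition S). \<forall>w w'. R Q w \<longrightarrow> R Q w' \<longrightarrow> norm (w - w') \<le> e"
    if "0 < e" for e
  proof -
    have e: "0 < e / 2" using that by simp
    obtain Q where Q: "borel_partition S Q"
      "\<And>P \<xi> \<zeta>. borel_partition S P \<Longrightarrow> refines S P Q \<Longrightarrow> (\<And>p. p \<in> P \<Longrightarrow> \<xi> p \<in> p) \<Longrightarrow>
      (\<And>q. q \<in> Q \<Longrightarrow> \<zeta> q \<in> q) \<Longrightarrow>
      norm ((\<Sum>p\<in>P. M p o\<^sub>L T (\<xi> p)) - (\<Sum>q\<in>Q. M q o\<^sub>L T (\<zeta> q))) \<le> e / 2"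
      by (rule op_integral_cauchy[OF M v S T e]) auto
    obtain \<zeta> where \<zeta>: "\<forall>q\<in>Q. \<zeta> q \<in> q"
      using partition_tags[OF Q(1)] .
    have near: "norm (w - s Q \<zeta>) \<le> e / 2" if "R Q w" for w
      using that unfolding R_def s_def
      by (elim exE conjE) (simp only:, rule Q(2); use \<zeta> in blast)
    have "norm (w - w') \<le> e" if "R Q w" "R Q w'" for w w'
      using near[OF that(1)] near[OF that(2)] norm_triangle_ineq4[of "w - s Q \<zeta>" "w' - s Q \<zeta>"]
      by simp
    then show ?thesis
      using Q(1) by blast
  qed
  moreover have "\<exists>w. R P w \<and> R Q w"
    if "P \<in> Collect (borel_partition S)" "Q \<in> Collect (borel_partition S)" for P Q
  proof -
    have PQ: "borel_partition S P" "borel_partition S Q" using that by simp_all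
    obtain P' where P': "borel_partition S P'" "refines S P' P" "refines S P' Q"
      using borel_partition_common_refinement[OF PQ] .
    obtain \<xi> where "\<forall>p\<in>P'. \<xi> p \<in> p"
      using partition_tags[OF P'(1)] .
    then show ?thesis
      unfolding R_def using P' by blast
  qed
  ultimately obtain I where I: "\<And>e. 0 < e \<Longrightarrow>
      \<exists>Q\<in>Collect (borel_partition S). \<forall>w. R Q w \<longrightarrow> norm (w - I) < e"
    using net_limit_exists[of "Collect (borel_partition S)" R] by blast
  have "has_op_integral M S T I"
    unfolding has_op_integral_def
  proof (intro allI impI)
    fix e :: real assume "0 < e"
    from I[OF this] obtain Q where Q: "borel_partition S Q" "\<forall>w. R Q w \<longrightarrow> norm (w - I) < e"
      by blast
    show "\<exists>P\<^sub>0. borel_partition S P\<^sub>0 \<and> (\<forall>P \<xi>. borel_partition S P \<and> refines S P P\<^sub>0 \<and>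
        (\<forall>\<delta>\<in>P. \<xi> \<delta> \<in> \<delta>) \<longrightarrow> norm ((\<Sum>\<delta>\<in>P. M \<delta> o\<^sub>L T (\<xi> \<delta>)) - I) < e)"
    proof (intro exI[of _ Q] conjI allI impI Q(1))
      fix P \<xi> assume "borel_partition S P \<and> refines S P Q \<and> (\<forall>\<delta>\<in>P. \<xi> \<delta> \<in> \<delta>)"
      then have "R Q (s P \<xi>)" unfolding R_def by blast
      then show "norm ((\<Sum>\<delta>\<in>P. M \<delta> o\<^sub>L T (\<xi> \<delta>)) - I) < e"
        using Q(2) unfolding s_def by blast
    qed
  qed
  then show ?thesis by (rule that)
qed

lemma has_op_integralE:
  assumes "has_op_integral M S T I" "0 < e"
  obtains Q where "borel_partition S Q"
    "\<forall>P \<xi>. borel_partition S P \<and> refines S P Q \<and> (\<forall>\<delta>\<in>P. \<xi> \<delta> \<in> \<delta>) \<longrightarrow>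
      norm ((\<Sum>p\<in>P. M p o\<^sub>L T (\<xi> p)) - I) < e"
proof -
  from assms have "\<exists>Q. borel_partition S Q \<and> (\<forall>P \<xi>. borel_partition S P \<and> refines S P Q \<and>
      (\<forall>\<delta>\<in>P. \<xi> \<delta> \<in> \<delta>) \<longrightarrow> norm ((\<Sum>p\<in>P. M p o\<^sub>L T (\<xi> p)) - I) < e)"
    unfolding has_op_integral_def by (elim allE[of _ e] impE) auto
  then show ?thesis
    using that by (elim exE conjE)
qed

lemma has_op_integral_approx2:
  assumes I: "has_op_integral M S T I" and J: "has_op_integral M' S T' J" and e: "0 < e"
  obtains P \<xi> where "borel_partition S P" "\<forall>p\<in>P. \<xi> p \<in> p"
    "norm ((\<Sum>p\<in>P. M p o\<^sub>L T (\<xi> p)) - I) < e" "norm ((\<Sum>p\<in>P. M' p o\<^sub>L T' (\<xi> p)) - J) < e"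
proof -
  obtain P1 where P1: "borel_partition S P1"
    "\<forall>P \<xi>. borel_partition S P \<and> refines S P P1 \<and> (\<forall>\<delta>\<in>P. \<xi> \<delta> \<in> \<delta>) \<longrightarrow>
      norm ((\<Sum>p\<in>P. M p o\<^sub>L T (\<xi> p)) - I) < e"
    using has_op_integralE[OF I e] .
  obtain P2 where P2: "borel_partition S P2"
    "\<forall>P \<xi>. borel_partition S P \<and> refines S P P2 \<and> (\<forall>\<delta>\<in>P. \<xi> \<delta> \<in> \<delta>) \<longrightarrow>
      norm ((\<Sum>p\<in>P. M' p o\<^sub>L T' (\<xi> p)) - J) < e"
    using has_op_integralE[OF J e] .
  obtain R where R: "borel_partition S R" "refines S R P1" "refines S R P2"
    using borel_partition_common_refinement[OF P1(1) P2(1)] .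
  obtain \<xi> where \<xi>: "\<forall>p\<in>R. \<xi> p \<in> p"
    using partition_tags[OF R(1)] .
  show ?thesis
    by (rule that[OF R(1) \<xi> P1(2)[THEN spec, THEN spec, THEN mp] P2(2)[THEN spec, THEN spec, THEN mp]])
      (intro conjI R \<xi>)+
qed

lemma has_op_integral_approx:
  assumes I: "has_op_integral M S T I" and e: "0 < e"
  obtains P \<xi> where "borel_partition S P" "\<forall>p\<in>P. \<xi> p \<in> p"
    "norm ((\<Sum>p\<in>P. M p o\<^sub>L T (\<xi> p)) - I) < e"
  using has_op_integral_approx2[OF I I e] .

lemma has_op_integral_unique:
  assumes I: "has_op_integral M S T I" and J: "has_op_integral M S T J"
  shows "I = J"
proof (rule ccontr)
  assume "I \<noteq> J"
  then have "0 < norm (I - J) / 2" by simp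
  then obtain P \<xi> where "norm ((\<Sum>p\<in>P. M p o\<^sub>L T (\<xi> p)) - I) < norm (I - J) / 2"
    "norm ((\<Sum>p\<in>P. M p o\<^sub>L T (\<xi> p)) - J) < norm (I - J) / 2"
    by (rule has_op_integral_approx2[OF I J])
  then show False
    using norm_triangle_ineq4[of "(\<Sum>p\<in>P. M p o\<^sub>L T (\<xi> p)) - J" "(\<Sum>p\<in>P. M p o\<^sub>L T (\<xi> p)) - I"]
    by simp
qed

lemma op_integral_eq: "has_op_integral M S T I \<Longrightarrow> op_integral M S T = I"
  unfolding op_integral_def by (blast intro: the_equality has_op_integral_unique)

lemma has_op_integral_add:
  assumes I: "has_op_integral M S T I" and J: "has_op_integral M S U J"
  shows "has_op_integral M S (\<lambda>x. T x + U x) (I + J)"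
  unfolding has_op_integral_def
proof (intro allI impI)
  fix e :: real assume "0 < e"
  then have e: "0 < e / 2" by simp
  obtain P1 where P1: "borel_partition S P1"
    "\<forall>P \<xi>. borel_partition S P \<and> refines S P P1 \<and> (\<forall>\<delta>\<in>P. \<xi> \<delta> \<in> \<delta>) \<longrightarrow>
      norm ((\<Sum>p\<in>P. M p o\<^sub>L T (\<xi> p)) - I) < e / 2"
    using has_op_integralE[OF I e] .
  obtain P2 where P2: "borel_partition S P2"
    "\<forall>P \<xi>. borel_partition S P \<and> refines S P P2 \<and> (\<forall>\<delta>\<in>P. \<xi> \<delta> \<in> \<delta>) \<longrightarrow>
      norm ((\<Sum>p\<in>P. M p o\<^sub>L U (\<xi> p)) - J) < e / 2"
    using has_op_integralE[OF J e] .
  obtain R where R: "borel_partition S R" "refines S R P1" "refines S R P2"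
    using borel_partition_common_refinement[OF P1(1) P2(1)] .
  show "\<exists>P\<^sub>0. borel_partition S P\<^sub>0 \<and> (\<forall>P \<xi>. borel_partition S P \<and> refines S P P\<^sub>0 \<and>
        (\<forall>\<delta>\<in>P. \<xi> \<delta> \<in> \<delta>) \<longrightarrow> norm ((\<Sum>\<delta>\<in>P. M \<delta> o\<^sub>L (T (\<xi> \<delta>) + U (\<xi> \<delta>))) - (I + J)) < e)"
  proof (intro exI[of _ R] conjI allI impI R(1))
    fix P \<xi> assume P: "borel_partition S P \<and> refines S P R \<and> (\<forall>\<delta>\<in>P. \<xi> \<delta> \<in> \<delta>)"
    have le: "norm ((\<Sum>p\<in>P. M p o\<^sub>L T (\<xi> p)) - I) < e / 2"
      "norm ((\<Sum>p\<in>P. M p o\<^sub>L U (\<xi> p)) - J) < e / 2"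
      by (rule P1(2)[THEN spec, THEN spec, THEN mp] P2(2)[THEN spec, THEN spec, THEN mp];
          use P R refines_trans in blast)+
    have eq: "(\<Sum>\<delta>\<in>P. M \<delta> o\<^sub>L (T (\<xi> \<delta>) + U (\<xi> \<delta>))) - (I + J)
        = ((\<Sum>p\<in>P. M p o\<^sub>L T (\<xi> p)) - I) + ((\<Sum>p\<in>P. M p o\<^sub>L U (\<xi> p)) - J)"
      by (simp add: bounded_bilinear.add_right[OF bounded_bilinear_blinfun_compose] sum.distrib)
    show "norm ((\<Sum>\<delta>\<in>P. M \<delta> o\<^sub>L (T (\<xi> \<delta>) + U (\<xi> \<delta>))) - (I + J)) < e"
      unfolding eq using norm_add_less[OF le] by simp
  qed
qed

lemma has_op_integral_compose_right:
  assumes I: "has_op_integral M S T I"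
  shows "has_op_integral M S (\<lambda>x. T x o\<^sub>L R) (I o\<^sub>L R)"
  unfolding has_op_integral_def
proof (intro allI impI)
  fix e :: real assume e: "0 < e"
  define c where "c = norm R + 1"
  have c: "0 < c" by (simp add: c_def add_nonneg_pos)
  obtain Q where Q: "borel_partition S Q"
    "\<forall>P \<xi>. borel_partition S P \<and> refines S P Q \<and> (\<forall>\<delta>\<in>P. \<xi> \<delta> \<in> \<delta>) \<longrightarrow>
      norm ((\<Sum>p\<in>P. M p o\<^sub>L T (\<xi> p)) - I) < e / c"
    using has_op_integralE[OF I divide_pos_pos[OF e c]] .
  show "\<exists>P\<^sub>0. borel_partition S P\<^sub>0 \<and> (\<forall>P \<xi>. borel_partition S P \<and> refines S P P\<^sub>0 \<and>
        (\<forall>\<delta>\<in>P. \<xi> \<delta> \<in> \<delta>) \<longrightarrow> norm ((\<Sum>\<delta>\<in>P. M \<delta> o\<^sub>L (T (\<xi> \<delta>) o\<^sub>L R)) - (I o\<^sub>L R)) < e)"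
  proof (intro exI[of _ Q] conjI allI impI Q(1))
    fix P \<xi> assume P: "borel_partition S P \<and> refines S P Q \<and> (\<forall>\<delta>\<in>P. \<xi> \<delta> \<in> \<delta>)"
    define D where "D = (\<Sum>p\<in>P. M p o\<^sub>L T (\<xi> p)) - I"
    have "M \<delta> o\<^sub>L (T (\<xi> \<delta>) o\<^sub>L R) = (M \<delta> o\<^sub>L T (\<xi> \<delta>)) o\<^sub>L R" for \<delta>
      by (rule blinfun_eqI) simp
    then have "(\<Sum>\<delta>\<in>P. M \<delta> o\<^sub>L (T (\<xi> \<delta>) o\<^sub>L R)) - (I o\<^sub>L R) = D o\<^sub>L R"
      by (simp add: D_def blinfun_compose_right_distribs
          bounded_bilinear.sum_left[OF bounded_bilinear_blinfun_compose])
    moreover have "norm (D o\<^sub>L R) \<le> norm D * c"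
      by (rule order_trans[OF norm_blinfun_compose]) (simp add: c_def mult_left_mono)
    moreover have "norm D < e / c"
      unfolding D_def by (rule Q(2)[THEN spec, THEN spec, THEN mp, OF P])
    ultimately show "norm ((\<Sum>\<delta>\<in>P. M \<delta> o\<^sub>L (T (\<xi> \<delta>) o\<^sub>L R)) - (I o\<^sub>L R)) < e"
      using c by (simp add: field_simps)
  qed
qed

lemma has_op_integral_norm_le:
  assumes I: "has_op_integral M S T I" and v: "variation_le M S v" and "0 \<le> C"
    and T: "\<And>x. x \<in> S \<Longrightarrow> norm (T x) \<le> C"
  shows "norm I \<le> C * v"
proof (rule field_le_epsilon)
  fix e :: real assume "0 < e"
  then obtain P \<xi> where P: "borel_partition S P" "\<forall>p\<in>P. \<xi> p \<in> p"
    "norm ((\<Sum>p\<in>P. M p o\<^sub>L T (\<xi> p)) - I) < e"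
    by (rule has_op_integral_approx[OF I])
  have "norm (\<Sum>p\<in>P. M p o\<^sub>L T (\<xi> p)) \<le> (\<Sum>p\<in>P. norm (M p) * C)"
  proof (rule sum_norm_le)
    fix p assume "p \<in> P"
    then have "\<xi> p \<in> S"
      using P(1,2) by (auto simp: borel_partition_def partition_on_def)
    then show "norm (M p o\<^sub>L T (\<xi> p)) \<le> norm (M p) * C"
      by (intro order_trans[OF norm_blinfun_compose] mult_left_mono T) auto
  qed
  also have "\<dots> = C * (\<Sum>p\<in>P. norm (M p))"
    by (simp add: sum_distrib_left mult.commute)
  also have "\<dots> \<le> C * v"
    using v P(1) \<open>0 \<le> C\<close> by (intro mult_left_mono) (auto simp: variation_le_def)
  finally show "norm I \<le> C * v + e"
    using P(3) norm_triangle_ineq4[of "\<Sum>p\<in>P. M p o\<^sub>L T (\<xi> p)" "(\<Sum>p\<in>P. M p o\<^sub>L T (\<xi> p)) - I"]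
    by simp
qed

lemma has_op_integral_clinear:
  assumes I: "has_op_integral M S T I" and M: "\<And>\<delta>. \<delta> \<in> sets borel \<Longrightarrow> clinear_op (M \<delta>)"
    and T: "\<And>x. x \<in> S \<Longrightarrow> clinear_op (T x)"
  shows "clinear_op I"
proof -
  have "\<exists>J\<in>Collect clinear_op. dist J I < e" if e: "0 < e" for e
  proof -
    obtain P \<xi> where P: "borel_partition S P" "\<forall>p\<in>P. \<xi> p \<in> p"
      "norm ((\<Sum>p\<in>P. M p o\<^sub>L T (\<xi> p)) - I) < e"
      by (rule has_op_integral_approx[OF I e])
    have "clinear_op (\<Sum>p\<in>P. M p o\<^sub>L T (\<xi> p))"
      using P(1,2) by (intro clinear_op_sum clinear_op_compose M T)
        (auto simp: borel_partition_def partition_on_def)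
    then show ?thesis using P(3) by (auto simp: dist_norm)
  qed
  then have "I \<in> closure (Collect clinear_op)"
    by (auto simp: closure_approachable)
  then show ?thesis
    by (simp add: closure_closed[OF closed_clinear_op])
qed

section \<open>Line integrals\<close>

text \<open>The value 0 on the empty set lets double sums run over all pairs of cells, whether or
  not they meet.\<close>

definition increment :: "(real \<Rightarrow> complex) \<Rightarrow> real set \<Rightarrow> complex" where
  "increment \<gamma> J = (if J = {} then 0 else \<gamma> (Sup J) - \<gamma> (Inf J))"

lemma increment_degenerate: "K = {a..b} \<Longrightarrow> interior K = {} \<Longrightarrow> increment \<gamma> K = 0"
  by (simp add: increment_def)

lemma tagged_division_interval:
  assumes "p tagged_division_of {s..t::real}" "(x, J) \<in> p"
  obtains u v where "J = {u..v}" "u \<le> v" "s \<le> u" "v \<le> t" "x \<in> J"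
proof -
  obtain u v where "J = {u..v}"
    using tagged_division_ofD(4)[OF assms] by auto
  then show ?thesis
    using tagged_division_ofD(2,3)[OF assms] by (intro that[of u v]) auto
qed

text \<open>Telescoping over the pieces into which \<open>q\<close> cuts \<open>{u..v}\<close>. The
  work lies in presenting these pieces as a tagged division although some are empty and some may
  coincide.\<close>

lemma increment_split:
  assumes q: "q tagged_division_of {s..t}" and uv: "u \<le> v" "{u..v} \<subseteq> {s..t}"
  shows "increment \<gamma> {u..v} = (\<Sum>(y, K)\<in>q. increment \<gamma> ({u..v} \<inter> K))"
proof -
  \<comment> \<open>The tag is reset to the left end of the piece, since the original tag of the
    cell may lie outside \<open>{u..v}\<close>.\<close>
  define g where "g yK = (Inf ({u..v} \<inter> snd yK), {u..v} \<inter> snd yK)" for yK :: "real \<times> real set"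
  define q0 where "q0 = {yK \<in> q. {u..v} \<inter> snd yK \<noteq> {}}"
  have fin: "finite q" "finite q0"
    using q by (auto simp: q0_def)
  have int: "\<exists>a b. {u..v} \<inter> K = {a..b}" if "(y, K) \<in> q" for y K
    using tagged_division_ofD(4)[OF q that] by (force simp: Int_atLeastAtMost simp del: atLeastAtMost_iff)
  have td: "g ` q0 tagged_division_of {u..v}"
  proof (rule tagged_division_ofI)
    show "finite (g ` q0)" using fin by simp
    fix x K assume xK: "(x, K) \<in> g ` q0"
    then obtain yJ where yJ: "yJ \<in> q0" "(x, K) = g yJ" by blast
    obtain y J where "yJ = (y, J)" by (cases yJ)
    then have J: "(y, J) \<in> q" "K = {u..v} \<inter> J" "x = Inf K" "K \<noteq> {}"
      using yJ by (simp_all add: g_def q0_def)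
    obtain a b where ab: "K = {a..b}" using int J by blast
    then have "x = a" using J(3,4) by simp
    then show "x \<in> K" using ab J(4) by simp
    show "K \<subseteq> {u..v}" using J by blast
    show "\<exists>a b. K = cbox a b" using ab by auto
    fix x' K' assume xK': "(x', K') \<in> g ` q0" and ne: "(x, K) \<noteq> (x', K')"
    then obtain yJ' where yJ': "yJ' \<in> q0" "(x', K') = g yJ'" by blast
    obtain y' J' where "yJ' = (y', J')" by (cases yJ')
    then have J': "(y', J') \<in> q" "K' = {u..v} \<inter> J'" "x' = Inf K'"
      using yJ' by (simp_all add: g_def q0_def)
    have "(y, J) \<noteq> (y', J')" using ne J J' by auto
    then have "interior J \<inter> interior J' = {}"
      by (rule tagged_division_ofD(5)[OF q J(1) J'(1)])
    then show "interior K \<inter> interior K' = {}"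
      unfolding J(2) J'(2) interior_Int by blast
  next
    have "\<Union>{K. \<exists>x. (x, K) \<in> q} = {s..t}"
      by (rule tagged_division_ofD(6)[OF q])
    moreover have snd_eq: "{K. \<exists>x. (x, K) \<in> r} = snd ` r" for r :: "(real \<times> real set) set"
      by force
    ultimately have "\<Union>(snd ` q) = {s..t}" by simp
    then have "{u..v} = {u..v} \<inter> \<Union>(snd ` q)"
      using uv(2) by (simp only: Int_absorb2)
    then have "{u..v} = (\<Union>yK\<in>q. {u..v} \<inter> snd yK)"
      by (simp only: Int_UN_distrib)
    also have "\<dots> = (\<Union>yK\<in>q0. {u..v} \<inter> snd yK)"
      unfolding q0_def by blast
    finally show "\<Union>{K. \<exists>x. (x, K) \<in> g ` q0} = {u..v}"
      by (simp add: snd_eq image_image g_def)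
  qed
  have "increment \<gamma> {u..v} = \<gamma> v - \<gamma> u"
    using uv by (simp add: increment_def)
  also have "\<dots> = (\<Sum>(x, K)\<in>g ` q0. \<gamma> (Sup K) - \<gamma> (Inf K))"
    by (rule additive_tagged_division_1[OF uv(1) td, symmetric])
  also have "\<dots> = (\<Sum>(x, K)\<in>g ` q0. increment \<gamma> K)"
  proof (rule sum.cong)
    have "snd xK \<noteq> {}" if "xK \<in> g ` q0" for xK
      using that unfolding g_def q0_def by force
    then show "(case xK of (x, K) \<Rightarrow> \<gamma> (Sup K) - \<gamma> (Inf K)) = (case xK of (x, K) \<Rightarrow> increment \<gamma> K)"
      if "xK \<in> g ` q0" for xK
      using that by (simp add: increment_def case_prod_unfold)
  qed simp
  also have "\<dots> = (\<Sum>yK\<in>q0. increment \<gamma> ({u..v} \<inter> snd yK))"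
  \<comment> \<open>\<open>g\<close> need not be injective, but two cells with disjoint interiors
    and the same trace on \<open>{u..v}\<close> have a degenerate trace, whose increment is
    0.\<close>
  proof (subst sum.reindex_nontrivial[OF fin(2)])
    fix yK yK' assume *: "yK \<in> q0" "yK' \<in> q0" "yK \<noteq> yK'" "g yK = g yK'"
    obtain y K y' K' where eq: "yK = (y, K)" "yK' = (y', K')" by (metis surj_pair)
    have "interior K \<inter> interior K' = {}"
      using * eq tagged_division_ofD(5)[OF q, of y K y' K'] by (auto simp: q0_def)
    moreover have "{u..v} \<inter> K = {u..v} \<inter> K'" using * eq by (simp add: g_def)
    then have "interior ({u..v} \<inter> K) = interior ({u..v} \<inter> K')" by simp
    then have "interior ({u..v} \<inter> K) \<subseteq> interior K \<inter> interior K'"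
      unfolding interior_Int by blast
    ultimately have "interior ({u..v} \<inter> K) = {}" by blast
    moreover have "(y, K) \<in> q"
      using * eq by (simp add: q0_def)
    then obtain a b where "{u..v} \<inter> K = {a..b}"
      using int by blast
    ultimately show "(case g yK of (x, K) \<Rightarrow> increment \<gamma> K) = 0"
      using increment_degenerate eq by (simp add: g_def)
  qed (simp add: g_def)
  also have "\<dots> = (\<Sum>yK\<in>q. increment \<gamma> ({u..v} \<inter> snd yK))"
    using fin by (intro sum.mono_neutral_left) (auto simp: q0_def increment_def)
  finally show ?thesis by (simp add: case_prod_unfold)
qed

lemma division_sum_le_arc_length:
  assumes "d division_of {s..t}" "arc_length \<gamma> s t < \<infinity>"
  shows "(\<Sum>J\<in>d. dist (\<gamma> (Inf J)) (\<gamma> (Sup J))) \<le> enn2real (arc_length \<gamma> s t)"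
proof -
  have "ennreal (\<Sum>J\<in>d. dist (\<gamma> (Inf J)) (\<gamma> (Sup J))) \<le> arc_length \<gamma> s t"
    unfolding arc_length_def using assms(1)
    by (subst sum_ennreal[symmetric]) (auto intro!: SUP_upper)
  from enn2real_mono[OF this] show ?thesis
    using assms(2) by (simp add: sum_nonneg)
qed

text \<open>The nonempty intersections form the common refinement of both divisions, so their chords
  add up to at most the arc length. Pairs with equal intersections are degenerate and contribute
  0.\<close>

lemma double_increment_le:
  assumes p: "p tagged_division_of {s..t}" and q: "q tagged_division_of {s..t}"
    and fin: "arc_length \<gamma> s t < \<infinity>"
  shows "(\<Sum>(x, J)\<in>p. \<Sum>(y, K)\<in>q. norm (increment \<gamma> (J \<inter> K))) \<le> enn2real (arc_length \<gamma> s t)"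
proof -
  define g where "g a = snd (fst a) \<inter> snd (snd a)" for a :: "(real \<times> real set) \<times> (real \<times> real set)"
  define r where "r = {a \<in> p \<times> q. g a \<noteq> {}}"
  have finr: "finite (p \<times> q)" "finite r"
    using tagged_division_ofD(1)[OF p] tagged_division_ofD(1)[OF q] by (simp_all add: r_def)
  have int: "\<exists>a b. J \<inter> K = {a..b}" if JK: "(x, J) \<in> p" "(y, K) \<in> q" for x y J K
  proof -
    obtain a b c d where "J = {a..b}" "K = {c..d}"
      using tagged_division_ofD(4)[OF p JK(1)] tagged_division_ofD(4)[OF q JK(2)] by auto
    then show ?thesis by (auto simp only: Int_atLeastAtMost)
  qed
  have "g ` r = {k1 \<inter> k2 | k1 k2. k1 \<in> snd ` p \<and> k2 \<in> snd ` q \<and> k1 \<inter> k2 \<noteq> {}}"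
  proof (intro equalityI subsetI)
    fix X assume "X \<in> g ` r"
    then obtain a where a: "a \<in> p \<times> q" "g a \<noteq> {}" "X = g a"
      unfolding r_def by blast
    then show "X \<in> {k1 \<inter> k2 | k1 k2. k1 \<in> snd ` p \<and> k2 \<in> snd ` q \<and> k1 \<inter> k2 \<noteq> {}}"
      unfolding mem_Collect_eq
      by (intro exI[of _ "snd (fst a)"] exI[of _ "snd (snd a)"]) (auto simp: g_def)
  next
    fix X assume "X \<in> {k1 \<inter> k2 | k1 k2. k1 \<in> snd ` p \<and> k2 \<in> snd ` q \<and> k1 \<inter> k2 \<noteq> {}}"
    then obtain a b where "a \<in> p" "b \<in> q" "X = snd a \<inter> snd b" "X \<noteq> {}" by blast
    then show "X \<in> g ` r"
      by (intro image_eqI[of _ _ "(a, b)"]) (simp_all add: g_def r_def)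
  qed
  then have d: "g ` r division_of {s..t}"
    using division_inter[OF division_of_tagged_division[OF p] division_of_tagged_division[OF q]]
    by simp
  have "(\<Sum>(x, J)\<in>p. \<Sum>(y, K)\<in>q. norm (increment \<gamma> (J \<inter> K))) = (\<Sum>a\<in>p \<times> q. norm (increment \<gamma> (g a)))"
    by (simp add: sum.cartesian_product case_prod_unfold g_def)
  also have "\<dots> = (\<Sum>a\<in>r. norm (increment \<gamma> (g a)))"
    using finr by (intro sum.mono_neutral_right) (auto simp: r_def increment_def)
  also have "\<dots> = (\<Sum>J\<in>g ` r. norm (increment \<gamma> J))"
  proof (subst sum.reindex_nontrivial[OF finr(2)])
    fix a b assume *: "a \<in> r" "b \<in> r" "a \<noteq> b" "g a = g b"
    obtain x J y K x' J' y' K' where eq: "a = ((x, J), (y, K))" "b = ((x', J'), (y', K'))"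
      by (metis surj_pair)
    have "interior J \<inter> interior J' = {} \<or> interior K \<inter> interior K' = {}"
      using * eq tagged_division_ofD(5)[OF p, of x J x' J'] tagged_division_ofD(5)[OF q, of y K y' K']
      by (auto simp: r_def)
    moreover have "J \<inter> K = J' \<inter> K'" using * eq by (simp add: g_def)
    then have "interior J \<inter> interior K = interior J' \<inter> interior K'"
      by (metis interior_Int)
    ultimately have "interior (J \<inter> K) = {}"
      unfolding interior_Int by blast
    moreover have "(x, J) \<in> p" "(y, K) \<in> q"
      using * eq by (simp_all add: r_def)
    then obtain a' b' where "J \<inter> K = {a'..b'}"
      using int by blast
    ultimately show "norm (increment \<gamma> (g a)) = 0"
      using increment_degenerate eq by (simp add: g_def)
  qed simp
  also have "\<dots> = (\<Sum>J\<in>g ` r. dist (\<gamma> (Inf J)) (\<gamma> (Sup J)))"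
    by (rule sum.cong) (auto simp: increment_def dist_norm norm_minus_commute r_def)
  also have "\<dots> \<le> enn2real (arc_length \<gamma> s t)"
    by (rule division_sum_le_arc_length[OF d fin])
  finally show ?thesis .
qed

section \<open>Riemann-Stieltjes integrals along rectifiable curves\<close>

definition rs_sum :: "(real \<Rightarrow> complex) \<Rightarrow> (complex \<Rightarrow> 'c::complex_normed) \<Rightarrow> (real \<times> real set) set \<Rightarrow> 'c" where
  "rs_sum \<gamma> F p = (\<Sum>(x, J)\<in>p. (\<gamma> (Sup J) - \<gamma> (Inf J)) *\<^sub>C F (\<gamma> x))"

lemma rs_sum_eq:
  assumes p: "p tagged_division_of {s..t}"
  shows "rs_sum \<gamma> F p = (\<Sum>(x, J)\<in>p. increment \<gamma> J *\<^sub>C F (\<gamma> x))"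
  unfolding rs_sum_def
  by (rule sum.cong) (auto simp: increment_def dest: tagged_division_ofD(2)[OF p])

text \<open>Both sums are rewritten over the common refinement, where corresponding terms share the
  increment and differ only in the tag. This compares two arbitrary divisions without assuming that
  one refines the other.\<close>

lemma rs_sum_diff_le:
  assumes p: "p tagged_division_of {s..t}" and q: "q tagged_division_of {s..t}"
    and fin: "arc_length \<gamma> s t < \<infinity>" and w: "0 \<le> w"
    and osc: "\<And>x J y K. (x, J) \<in> p \<Longrightarrow> (y, K) \<in> q \<Longrightarrow> J \<inter> K \<noteq> {} \<Longrightarrow>
      norm (F (\<gamma> x) - F (\<gamma> y)) \<le> w"
  shows "norm (rs_sum \<gamma> F p - rs_sum \<gamma> F q) \<le> w * enn2real (arc_length \<gamma> s t)"
proof -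
  have "rs_sum \<gamma> F p = (\<Sum>(x, J)\<in>p. \<Sum>(y, K)\<in>q. increment \<gamma> (J \<inter> K) *\<^sub>C F (\<gamma> x))"
    unfolding rs_sum_eq[OF p]
  proof (rule sum.cong, rule refl, clarify)
    fix x J assume xJ: "(x, J) \<in> p"
    obtain u v where J: "J = {u..v}" "u \<le> v" "s \<le> u" "v \<le> t"
      using tagged_division_interval[OF p xJ] by metis
    show "increment \<gamma> J *\<^sub>C F (\<gamma> x) = (\<Sum>(y, K)\<in>q. increment \<gamma> (J \<inter> K) *\<^sub>C F (\<gamma> x))"
      unfolding J(1) using J(2-4)
      by (subst increment_split[OF q]) (auto simp: scaleC.sum_left case_prod_unfold)
  qed
  moreover have "rs_sum \<gamma> F q = (\<Sum>(x, J)\<in>p. \<Sum>(y, K)\<in>q. increment \<gamma> (J \<inter> K) *\<^sub>C F (\<gamma> y))"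
  proof -
    have "rs_sum \<gamma> F q = (\<Sum>(y, K)\<in>q. \<Sum>(x, J)\<in>p. increment \<gamma> (K \<inter> J) *\<^sub>C F (\<gamma> y))"
      unfolding rs_sum_eq[OF q]
    proof (rule sum.cong, rule refl, clarify)
      fix x J assume xJ: "(x, J) \<in> q"
      obtain u v where J: "J = {u..v}" "u \<le> v" "s \<le> u" "v \<le> t"
        using tagged_division_interval[OF q xJ] by metis
      show "increment \<gamma> J *\<^sub>C F (\<gamma> x) = (\<Sum>(y, K)\<in>p. increment \<gamma> (J \<inter> K) *\<^sub>C F (\<gamma> x))"
        unfolding J(1) using J(2-4)
        by (subst increment_split[OF p]) (auto simp: scaleC.sum_left case_prod_unfold)
    qed
    also have "\<dots> = (\<Sum>(x, J)\<in>p. \<Sum>(y, K)\<in>q. increment \<gamma> (J \<inter> K) *\<^sub>C F (\<gamma> y))"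
      unfolding case_prod_unfold by (subst sum.swap) (simp add: Int_commute)
    finally show ?thesis .
  qed
  ultimately have "rs_sum \<gamma> F p - rs_sum \<gamma> F q
      = (\<Sum>(x, J)\<in>p. \<Sum>(y, K)\<in>q. increment \<gamma> (J \<inter> K) *\<^sub>C (F (\<gamma> x) - F (\<gamma> y)))"
    by (simp add: sum_subtractf[symmetric] scaleC.diff_right case_prod_unfold)
  also have "norm \<dots> \<le> (\<Sum>(x, J)\<in>p. \<Sum>(y, K)\<in>q. w * norm (increment \<gamma> (J \<inter> K)))"
    unfolding case_prod_unfold
  proof (intro sum_norm_le)
    fix xJ yK assume *: "xJ \<in> p" "yK \<in> q"
    obtain x J y K where eq: "xJ = (x, J)" "yK = (y, K)" by (metis surj_pair)
    show "norm (increment \<gamma> (snd xJ \<inter> snd yK) *\<^sub>C (F (\<gamma> (fst xJ)) - F (\<gamma> (fst yK))))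
      \<le> w * norm (increment \<gamma> (snd xJ \<inter> snd yK))"
    proof (cases "J \<inter> K = {}")
      case True
      then show ?thesis by (simp add: eq increment_def scaleC.zero_left)
    next
      case False
      then show ?thesis
        using osc[of x J y K] * by (simp add: eq norm_scaleC mult.commute[of w] mult_left_mono)
    qed
  qed
  also have "\<dots> = w * (\<Sum>(x, J)\<in>p. \<Sum>(y, K)\<in>q. norm (increment \<gamma> (J \<inter> K)))"
    by (simp add: sum_distrib_left case_prod_unfold)
  also have "\<dots> \<le> w * enn2real (arc_length \<gamma> s t)"
    by (intro mult_left_mono double_increment_le p q fin w)
  finally show ?thesis .
qed

lemma has_rs_integral_iff:
  "has_rs_integral \<gamma> F s t I \<longleftrightarrow> (\<forall>e>0. \<exists>d>0. \<forall>p. p tagged_division_of {s..t} \<and>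
     (\<lambda>x. ball x d) fine p \<longrightarrow> norm (rs_sum \<gamma> F p - I) < e)"
  by (simp add: has_rs_integral_def rs_sum_def)

lemma fine_ball_exists:
  assumes "0 < d"
  obtains p where "p tagged_division_of {s..t::real}" "(\<lambda>x. ball x d) fine p"
  using fine_division_exists_real[OF gauge_ball[OF assms], of s t] by blast

lemma fine_ball_mono: "(\<lambda>x. ball x d) fine p \<Longrightarrow> d \<le> d' \<Longrightarrow> (\<lambda>x. ball x d') fine p"
  for d :: real
  unfolding fine_def by (fastforce dest: subset_ball[of d d', THEN subsetD])

lemma has_rs_integral_exists:
  fixes F :: "complex \<Rightarrow> 'c::{complex_normed,banach}"
  assumes F: "continuous_on {s..t} (\<lambda>x. F (\<gamma> x))" and fin: "arc_length \<gamma> s t < \<infinity>"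
  obtains I where "has_rs_integral \<gamma> F s t I"
proof -
  define R where "R d v \<longleftrightarrow> (\<exists>p. p tagged_division_of {s..t} \<and> (\<lambda>x. ball x d) fine p \<and> v = rs_sum \<gamma> F p)"
    for d v
  define L where "L = enn2real (arc_length \<gamma> s t) + 1"
  have L: "0 < L" by (simp add: L_def add_nonneg_pos)
  have "\<exists>d\<in>{0<..}. \<forall>v w. R d v \<longrightarrow> R d w \<longrightarrow> norm (v - w) \<le> e" if e: "0 < e" for e
  proof -
    have "uniformly_continuous_on {s..t} (\<lambda>x. F (\<gamma> x))"
      by (intro compact_uniformly_continuous F compact_Icc)
    then obtain d where d: "0 < d" "\<And>x y. x \<in> {s..t} \<Longrightarrow> y \<in> {s..t} \<Longrightarrow> dist y x < d \<Longrightarrow>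
        dist (F (\<gamma> y)) (F (\<gamma> x)) < e / L"
      using divide_pos_pos[OF e L] unfolding uniformly_continuous_on_def by metis
    \<comment> \<open>If two cells share a point, each tag is within \<open>d / 2\<close> of it, so
      the tags are less than \<open>d\<close> apart.\<close>
    have "norm (rs_sum \<gamma> F p - rs_sum \<gamma> F q) \<le> e"
      if p: "p tagged_division_of {s..t}" "(\<lambda>x. ball x (d / 2)) fine p"
        and q: "q tagged_division_of {s..t}" "(\<lambda>x. ball x (d / 2)) fine q" for p q
    proof -
      have "norm (rs_sum \<gamma> F p - rs_sum \<gamma> F q) \<le> e / L * enn2real (arc_length \<gamma> s t)"
      proof (rule rs_sum_diff_le[OF p(1) q(1) fin])
        fix x J y K assume xy: "(x, J) \<in> p" "(y, K) \<in> q" "J \<inter> K \<noteq> {}"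
        then obtain z where "z \<in> J" "z \<in> K" by blast
        then have "dist x z < d / 2" "dist y z < d / 2"
          using fineD[OF p(2) xy(1)] fineD[OF q(2) xy(2)] by auto
        then have "dist x y < d"
          using dist_triangle_half_l[of x z d y] by (simp add: dist_commute)
        moreover have "x \<in> {s..t}" "y \<in> {s..t}"
          using tagged_division_ofD(2,3)[OF p(1) xy(1)] tagged_division_ofD(2,3)[OF q(1) xy(2)]
          by auto
        ultimately show "norm (F (\<gamma> x) - F (\<gamma> y)) \<le> e / L"
          using d(2)[of y x] by (simp add: dist_norm)
      qed (use e L in simp)
      also have "\<dots> \<le> e"
        using e L by (simp add: field_simps L_def)
      finally show ?thesis .
    qed
    then show ?thesis
      using d(1) by (intro bexI[of _ "d / 2"]) (auto simp: R_def)
  qed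
  moreover have "\<exists>v. R i v \<and> R j v" if "i \<in> {0<..}" "j \<in> {0<..}" for i j
  proof -
    have "0 < min i j" using that by simp
    then obtain p where "p tagged_division_of {s..t}" "(\<lambda>x. ball x (min i j)) fine p"
      by (rule fine_ball_exists)
    then show ?thesis
      using fine_ball_mono[of "min i j" p i] fine_ball_mono[of "min i j" p j]
      unfolding R_def by auto
  qed
  ultimately obtain I where I: "\<And>e. 0 < e \<Longrightarrow> \<exists>d\<in>{0<..}. \<forall>v. R d v \<longrightarrow> norm (v - I) < e"
    using net_limit_exists[of "{0<..}" R] by blast
  have "has_rs_integral \<gamma> F s t I"
    unfolding has_rs_integral_iff
  proof (intro allI impI)
    fix e :: real assume "0 < e"
    from I[OF this] show "\<exists>d>0. \<forall>p. p tagged_division_of {s..t} \<and> (\<lambda>x. ball x d) fine p \<longrightarrow>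
        norm (rs_sum \<gamma> F p - I) < e"
      unfolding R_def by (metis greaterThan_iff)
  qed
  then show ?thesis by (rule that)
qed

lemma has_rs_integral_approx:
  assumes I: "has_rs_integral \<gamma> F s t I" and e: "0 < e" and d: "0 < d"
  obtains p where "p tagged_division_of {s..t}" "(\<lambda>x. ball x d) fine p" "norm (rs_sum \<gamma> F p - I) < e"
proof -
  obtain d' where d': "0 < d'" "\<forall>p. p tagged_division_of {s..t} \<and> (\<lambda>x. ball x d') fine p \<longrightarrow>
      norm (rs_sum \<gamma> F p - I) < e"
    using I e unfolding has_rs_integral_iff by blast
  have "0 < min d d'" using d d'(1) by simp
  then obtain p where p: "p tagged_division_of {s..t}" "(\<lambda>x. ball x (min d d')) fine p"
    by (rule fine_ball_exists)
  show ?thesis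
    by (rule that[OF p(1) fine_ball_mono[OF p(2)]])
      (use d'(2) p fine_ball_mono[OF p(2), of d'] in auto)
qed

lemma has_rs_integral_unique:
  assumes I: "has_rs_integral \<gamma> F s t I" and J: "has_rs_integral \<gamma> F s t J"
  shows "I = J"
proof (rule ccontr)
  assume "I \<noteq> J"
  then have e: "0 < norm (I - J) / 2" by simp
  obtain d where d: "0 < d" "\<forall>p. p tagged_division_of {s..t} \<and> (\<lambda>x. ball x d) fine p \<longrightarrow>
      norm (rs_sum \<gamma> F p - I) < norm (I - J) / 2"
    using I e unfolding has_rs_integral_iff by blast
  obtain p where p: "p tagged_division_of {s..t}" "(\<lambda>x. ball x d) fine p"
    "norm (rs_sum \<gamma> F p - J) < norm (I - J) / 2"
    by (rule has_rs_integral_approx[OF J e d(1)])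
  then show False
    using d(2) norm_triangle_ineq4[of "rs_sum \<gamma> F p - J" "rs_sum \<gamma> F p - I"] by fastforce
qed

text \<open>The union may identify members, but a member common to both divisions lives on
  \<open>{u}\<close> and has zero increment.\<close>

lemma rs_sum_Un:
  assumes p: "p tagged_division_of {s..u}" and q: "q tagged_division_of {u..t}"
  shows "rs_sum \<gamma> F (p \<union> q) = rs_sum \<gamma> F p + rs_sum \<gamma> F q"
  unfolding rs_sum_def
proof (rule sum.union_inter_neutral)
  show "\<forall>a\<in>p \<inter> q. (case a of (x, J) \<Rightarrow> (\<gamma> (Sup J) - \<gamma> (Inf J)) *\<^sub>C F (\<gamma> x)) = 0"
  proof clarify
    fix x J assume "(x, J) \<in> p" "(x, J) \<in> q"
    then have "x \<in> J" "J \<subseteq> {s..u}" "J \<subseteq> {u..t}"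
      using tagged_division_ofD(2,3)[OF p] tagged_division_ofD(3)[OF q] by blast+
    then have "J = {u}" by force
    then show "(\<gamma> (Sup J) - \<gamma> (Inf J)) *\<^sub>C F (\<gamma> x) = 0"
      by (simp add: scaleC.zero_left)
  qed
qed (use p q in auto)

text \<open>One fine division of each half, pasted at \<open>u\<close>, is a fine division of the
  whole, so three sums approximate three integrals at once.\<close>

lemma has_rs_integral_split:
  assumes I: "has_rs_integral \<gamma> F s t I" and J: "has_rs_integral \<gamma> F s u J"
    and K: "has_rs_integral \<gamma> F u t K" and "s \<le> u" "u \<le> t"
  shows "I = J + K"
proof (rule ccontr)
  assume "I \<noteq> J + K"
  then have e: "0 < norm (I - (J + K)) / 3" (is "0 < ?e") by simp
  obtain d where d: "0 < d" "\<forall>p. p tagged_division_of {s..t} \<and> (\<lambda>x. ball x d) fine p \<longrightarrow>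
      norm (rs_sum \<gamma> F p - I) < ?e"
    using I e unfolding has_rs_integral_iff by blast
  obtain p where p: "p tagged_division_of {s..u}" "(\<lambda>x. ball x d) fine p" "norm (rs_sum \<gamma> F p - J) < ?e"
    by (rule has_rs_integral_approx[OF J e d(1)])
  obtain q where q: "q tagged_division_of {u..t}" "(\<lambda>x. ball x d) fine q" "norm (rs_sum \<gamma> F q - K) < ?e"
    by (rule has_rs_integral_approx[OF K e d(1)])
  have "{s..u} \<union> {u..t} = {s..t}" using assms(4,5) by auto
  then have "p \<union> q tagged_division_of {s..t}"
    using tagged_division_Un[OF p(1) q(1)] by (auto simp: interior_atLeastAtMost_real)
  then have "norm (rs_sum \<gamma> F (p \<union> q) - I) < ?e"
    using d(2) fine_Un[OF p(2) q(2)] by blast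
  moreover have "I - (J + K) = (rs_sum \<gamma> F p - J) + (rs_sum \<gamma> F q - K) - (rs_sum \<gamma> F (p \<union> q) - I)"
    by (simp add: rs_sum_Un[OF p(1) q(1)])
  then have "norm (I - (J + K)) \<le> norm (rs_sum \<gamma> F p - J) + norm (rs_sum \<gamma> F q - K)
      + norm (rs_sum \<gamma> F (p \<union> q) - I)"
    by (metis (no_types, opaque_lifting) add_right_mono norm_triangle_ineq norm_triangle_ineq4 order_trans)
  ultimately show False
    using p(3) q(3) by linarith
qed

lemma has_rs_integral_add:
  assumes I: "has_rs_integral \<gamma> F s t I" and J: "has_rs_integral \<gamma> G s t J"
  shows "has_rs_integral \<gamma> (\<lambda>\<mu>. F \<mu> + G \<mu>) s t (I + J)"
  unfolding has_rs_integral_iff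
proof (intro allI impI)
  fix e :: real assume "0 < e"
  then have e: "0 < e / 2" by simp
  obtain d where d: "0 < d" "\<forall>p. p tagged_division_of {s..t} \<and> (\<lambda>x. ball x d) fine p \<longrightarrow>
      norm (rs_sum \<gamma> F p - I) < e / 2"
    using I e unfolding has_rs_integral_iff by blast
  obtain d' where d': "0 < d'" "\<forall>p. p tagged_division_of {s..t} \<and> (\<lambda>x. ball x d') fine p \<longrightarrow>
      norm (rs_sum \<gamma> G p - J) < e / 2"
    using J e unfolding has_rs_integral_iff by blast
  have "norm (rs_sum \<gamma> (\<lambda>\<mu>. F \<mu> + G \<mu>) p - (I + J)) < e"
    if p: "p tagged_division_of {s..t}" "(\<lambda>x. ball x (min d d')) fine p" for p
  proof -
    have le: "norm (rs_sum \<gamma> F p - I) < e / 2" "norm (rs_sum \<gamma> G p - J) < e / 2"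
      using p(1) fine_ball_mono[OF p(2)] d(2) d'(2) by auto
    have eq: "rs_sum \<gamma> (\<lambda>\<mu>. F \<mu> + G \<mu>) p - (I + J) = (rs_sum \<gamma> F p - I) + (rs_sum \<gamma> G p - J)"
      by (simp add: rs_sum_def scaleC_add_right sum.distrib case_prod_unfold)
    show ?thesis
      unfolding eq using norm_add_less[OF le] by simp
  qed
  then show "\<exists>d>0. \<forall>p. p tagged_division_of {s..t} \<and> (\<lambda>x. ball x d) fine p \<longrightarrow>
      norm (rs_sum \<gamma> (\<lambda>\<mu>. F \<mu> + G \<mu>) p - (I + J)) < e"
    using d(1) d'(1) by (intro exI[of _ "min d d'"]) auto
qed

lemma has_rs_integral_linear:
  fixes F :: "complex \<Rightarrow> 'c::complex_normed" and L :: "'c \<Rightarrow> 'd::complex_normed"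
  assumes I: "has_rs_integral \<gamma> F s t I" and L: "bounded_linear L" "\<And>c x. L (c *\<^sub>C x) = c *\<^sub>C L x"
  shows "has_rs_integral \<gamma> (\<lambda>\<mu>. L (F \<mu>)) s t (L I)"
  unfolding has_rs_integral_iff
proof (intro allI impI)
  fix e :: real assume e: "0 < e"
  obtain K where K: "0 < K" "\<And>x. norm (L x) \<le> norm x * K"
    using bounded_linear.pos_bounded[OF L(1)] by blast
  obtain d where d: "0 < d" "\<forall>p. p tagged_division_of {s..t} \<and> (\<lambda>x. ball x d) fine p \<longrightarrow>
      norm (rs_sum \<gamma> F p - I) < e / K"
    using I divide_pos_pos[OF e K(1)] unfolding has_rs_integral_iff by blast
  have "norm (rs_sum \<gamma> (\<lambda>\<mu>. L (F \<mu>)) p - L I) < e"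
    if p: "p tagged_division_of {s..t}" "(\<lambda>x. ball x d) fine p" for p
  proof -
    have "rs_sum \<gamma> (\<lambda>\<mu>. L (F \<mu>)) p = L (rs_sum \<gamma> F p)"
      by (simp add: rs_sum_def linear_sum[OF bounded_linear.linear[OF L(1)]] L(2) case_prod_unfold)
    then have "norm (rs_sum \<gamma> (\<lambda>\<mu>. L (F \<mu>)) p - L I) \<le> norm (rs_sum \<gamma> F p - I) * K"
      using K(2) by (simp add: linear_diff[OF bounded_linear.linear[OF L(1)], symmetric])
    moreover have "norm (rs_sum \<gamma> F p - I) < e / K" using d(2) p by blast
    ultimately show ?thesis using K(1) by (simp add: field_simps)
  qed
  then show "\<exists>d>0. \<forall>p. p tagged_division_of {s..t} \<and> (\<lambda>x. ball x d) fine p \<longrightarrow>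
      norm (rs_sum \<gamma> (\<lambda>\<mu>. L (F \<mu>)) p - L I) < e"
    using d(1) by blast
qed

lemma has_rs_integral_clinear:
  assumes I: "has_rs_integral \<gamma> F s t I" and F: "\<And>x. x \<in> {s..t} \<Longrightarrow> clinear_op (F (\<gamma> x))"
  shows "clinear_op I"
proof -
  have "\<exists>J\<in>Collect clinear_op. dist J I < e" if e: "0 < e" for e
  proof -
    obtain p where p: "p tagged_division_of {s..t}" "norm (rs_sum \<gamma> F p - I) < e"
      using has_rs_integral_approx[OF I e zero_less_one] .
    have "clinear_op (rs_sum \<gamma> F p)"
      unfolding rs_sum_def case_prod_unfold using tagged_division_ofD(2,3)[OF p(1)]
      by (intro clinear_op_sum clinear_op_scaleC F) (metis prod.collapse subsetD)
    then show ?thesis using p(2) by (auto simp: dist_norm)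
  qed
  then have "I \<in> closure (Collect clinear_op)"
    by (auto simp: closure_approachable)
  then show ?thesis
    by (simp add: closure_closed[OF closed_clinear_op])
qed

section \<open>Lower Darboux sums for the arc length integral\<close>

lemma arc_length_refl: "arc_length \<gamma> u u = 0"
proof -
  have "(\<Sum>J\<in>d. ennreal (dist (\<gamma> (Inf J)) (\<gamma> (Sup J)))) = 0" if d: "d division_of {u..u}" for d
  proof (rule sum.neutral, rule ballI)
    fix J assume "J \<in> d"
    then have "J = {u}" using division_ofD(2,3)[OF d, of J] by auto
    then show "ennreal (dist (\<gamma> (Inf J)) (\<gamma> (Sup J))) = 0" by simp
  qed
  then have "arc_length \<gamma> u u \<le> 0"
    unfolding arc_length_def by (intro SUP_least) auto
  then show ?thesis by simp
qed

lemma dist_le_arc_length: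
  assumes "s \<le> t"
  shows "ennreal (dist (\<gamma> s) (\<gamma> t)) \<le> arc_length \<gamma> s t"
proof -
  have "{{s..t}} division_of {s..t}"
    using assms division_of_self[of s t] by simp
  then show ?thesis
    unfolding arc_length_def using assms by (intro SUP_upper2[of "{{s..t}}"]) auto
qed

definition darboux_sum :: "(real \<Rightarrow> complex) \<Rightarrow> (complex \<Rightarrow> real) \<Rightarrow> real set set \<Rightarrow> ennreal" where
  "darboux_sum \<gamma> h d = (\<Sum>J\<in>d. (INF x\<in>J. ennreal (h (\<gamma> x))) * arc_length \<gamma> (Inf J) (Sup J))"

lemma arc_length_integral_eq:
  "arc_length_integral a b \<gamma> h =
    (SUP d \<in> {d. \<exists>s t. {s..t} \<subseteq> einterval a b \<and> d division_of {s..t}}. darboux_sum \<gamma> h d)"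
  by (simp add: arc_length_integral_def darboux_sum_def)

lemma darboux_sum_le:
  "{s..t} \<subseteq> einterval a b \<Longrightarrow> d division_of {s..t} \<Longrightarrow> darboux_sum \<gamma> h d \<le> arc_length_integral a b \<gamma> h"
  unfolding arc_length_integral_eq by (intro SUP_upper) auto

text \<open>A cell shared by both divisions must be \<open>{u}\<close>, whose arc length is
  0.\<close>

lemma darboux_sum_Un:
  assumes d: "d division_of {s..u}" and d': "d' division_of {u..t}"
  shows "darboux_sum \<gamma> h (d \<union> d') = darboux_sum \<gamma> h d + darboux_sum \<gamma> h d'"
  unfolding darboux_sum_def
proof (rule sum.union_inter_neutral)
  show "\<forall>J\<in>d \<inter> d'. (INF x\<in>J. ennreal (h (\<gamma> x))) * arc_length \<gamma> (Inf J) (Sup J) = 0"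
  proof
    fix J assume "J \<in> d \<inter> d'"
    then have "J \<subseteq> {s..u}" "J \<subseteq> {u..t}" "J \<noteq> {}"
      using division_ofD(2,3)[OF d] division_ofD(2)[OF d'] by blast+
    then have "J = {u}" by force
    then show "(INF x\<in>J. ennreal (h (\<gamma> x))) * arc_length \<gamma> (Inf J) (Sup J) = 0"
      by (simp add: arc_length_refl)
  qed
qed (use division_ofD(1)[OF d] division_ofD(1)[OF d'] in auto)

lemma division_Un_Icc:
  fixes s u t :: real
  assumes "d division_of {s..u}" "d' division_of {u..t}" "s \<le> u" "u \<le> t"
  shows "d \<union> d' division_of {s..t}"
proof -
  have "{s..u} \<union> {u..t} = {s..t}" using assms(3,4) by auto
  then show ?thesis
    using division_disjoint_union[OF assms(1,2)] by (auto simp: interior_atLeastAtMost_real)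
qed

text \<open>On a fine division \<open>h\<close> at the tag exceeds its infimum over the cell by at
  most \<open>w\<close>, and the chord is at most the arc length. Hence the sum of chords weighted
  by \<open>h\<close> is at most a lower Darboux sum plus \<open>w\<close> times the length.\<close>

lemma rs_integral_norm_le:
  fixes F :: "complex \<Rightarrow> 'c::complex_normed"
  assumes I: "has_rs_integral \<gamma> F s t I" and fin: "arc_length \<gamma> s t < \<infinity>"
    and h: "continuous_on {s..t} (\<lambda>x. h (\<gamma> x))" "\<And>x. x \<in> {s..t} \<Longrightarrow> 0 \<le> h (\<gamma> x)"
    and F: "\<And>x. x \<in> {s..t} \<Longrightarrow> norm (F (\<gamma> x)) \<le> c * h (\<gamma> x)" and c: "0 \<le> c"
    and A: "\<And>d. d division_of {s..t} \<Longrightarrow> darboux_sum \<gamma> h d \<le> ennreal A" "0 \<le> A"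
  shows "norm I \<le> c * A"
proof (rule field_le_epsilon)
  fix e :: real assume e: "0 < e"
  define L where "L = enn2real (arc_length \<gamma> s t)"
  have L: "0 \<le> L" by (simp add: L_def)
  \<comment> \<open>Chosen so that the accumulated error \<open>c * (w * L)\<close> is at most
    \<open>e / 2\<close>; the other half of \<open>e\<close> is spent on approximating
    \<open>I\<close>.\<close>
  define w where "w = e / (2 * (c * L + 1))"
  have cL: "0 \<le> c * L" using c L by simp
  have w: "0 < w" using e cL by (simp add: w_def add_nonneg_pos)
  have "uniformly_continuous_on {s..t} (\<lambda>x. h (\<gamma> x))"
    by (intro compact_uniformly_continuous h compact_Icc)
  then obtain r where r: "0 < r" "\<And>x y. x \<in> {s..t} \<Longrightarrow> y \<in> {s..t} \<Longrightarrow> dist y x < r \<Longrightarrow>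
      dist (h (\<gamma> y)) (h (\<gamma> x)) < w"
    using w unfolding uniformly_continuous_on_def by metis
  have e2: "0 < e / 2" using e by simp
  obtain p where p: "p tagged_division_of {s..t}" "(\<lambda>x. ball x r) fine p"
    "norm (rs_sum \<gamma> F p - I) < e / 2"
    by (rule has_rs_integral_approx[OF I e2 r(1)])
  have mem: "x \<in> {s..t}" "J \<subseteq> {s..t}" "J \<noteq> {}" "Inf J \<le> Sup J" if xJ: "(x, J) \<in> p" for x J
  proof -
    obtain u v where "J = {u..v}" "u \<le> v" "s \<le> u" "v \<le> t" "x \<in> J"
      by (rule tagged_division_interval[OF p(1) xJ])
    then show "x \<in> {s..t}" "J \<subseteq> {s..t}" "J \<noteq> {}" "Inf J \<le> Sup J" by auto
  qed
  define T where "T = (\<Sum>(x, J)\<in>p. norm (increment \<gamma> J) * h (\<gamma> x))"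
  have "norm (rs_sum \<gamma> F p) \<le> (\<Sum>(x, J)\<in>p. c * (norm (increment \<gamma> J) * h (\<gamma> x)))"
    unfolding rs_sum_eq[OF p(1)] case_prod_unfold
  proof (rule sum_norm_le)
    fix xJ assume "xJ \<in> p"
    then have "norm (F (\<gamma> (fst xJ))) \<le> c * h (\<gamma> (fst xJ))"
      using mem(1)[of "fst xJ" "snd xJ"] by (intro F) simp
    from mult_left_mono[OF this norm_ge_zero[of "increment \<gamma> (snd xJ)"]]
    show "norm (increment \<gamma> (snd xJ) *\<^sub>C F (\<gamma> (fst xJ)))
      \<le> c * (norm (increment \<gamma> (snd xJ)) * h (\<gamma> (fst xJ)))"
      by (simp add: norm_scaleC mult_ac)
  qed
  then have rs_le: "norm (rs_sum \<gamma> F p) \<le> c * T"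
    by (simp add: T_def sum_distrib_left case_prod_unfold)
  \<comment> \<open>The tags are about to be dropped, which is harmless when \<open>g\<close>
    vanishes on degenerate intervals; the value 0 on the empty set covers \<open>cbox u v\<close>
    with \<open>v < u\<close>.\<close>
  define g where "g J = (if J = {} then 0 else (INF x\<in>J. ennreal (h (\<gamma> x))) * arc_length \<gamma> (Inf J) (Sup J))" for J
  have g: "(\<Sum>(x, J)\<in>p. g J) \<le> ennreal A"
  proof -
    have "(\<Sum>(x, J)\<in>p. g J) = (\<Sum>J\<in>snd ` p. g J)"
    proof (rule sum.over_tagged_division_lemma[OF p(1)])
      fix u v :: real assume "box u v = {}"
      then have "v \<le> u" by (simp add: box_eq_empty)
      then show "g (cbox u v) = 0"
        by (cases "u = v") (auto simp: g_def arc_length_refl)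
    qed
    also have "\<dots> = darboux_sum \<gamma> h (snd ` p)"
      unfolding darboux_sum_def using mem(3) by (intro sum.cong) (auto simp: g_def)
    also have "\<dots> \<le> ennreal A"
      by (intro A division_of_tagged_division p)
    finally show ?thesis .
  qed
  have inc: "(\<Sum>(x, J)\<in>p. norm (increment \<gamma> J)) \<le> L"
  proof -
    have "(\<Sum>(x, J)\<in>p. norm (increment \<gamma> J)) = (\<Sum>J\<in>snd ` p. norm (increment \<gamma> J))"
    proof (rule sum.over_tagged_division_lemma[OF p(1)])
      fix u v :: real assume "box u v = {}"
      then have "v \<le> u" by (simp add: box_eq_empty)
      then show "norm (increment \<gamma> (cbox u v)) = 0"
        by (cases "u = v") (auto simp: increment_def)
    qed
    also have "\<dots> = (\<Sum>J\<in>snd ` p. dist (\<gamma> (Inf J)) (\<gamma> (Sup J)))"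
      using mem(3) by (intro sum.cong) (auto simp: increment_def dist_norm norm_minus_commute)
    also have "\<dots> \<le> L"
      unfolding L_def by (intro division_sum_le_arc_length division_of_tagged_division p fin)
    finally show ?thesis .
  qed
  have term_le: "ennreal (norm (increment \<gamma> J) * h (\<gamma> x)) \<le> g J + ennreal (w * norm (increment \<gamma> J))"
    if xJ: "(x, J) \<in> p" for x J
  proof -
    have "ennreal (h (\<gamma> x) - w) \<le> (INF y\<in>J. ennreal (h (\<gamma> y)))"
    proof (rule INF_greatest)
      fix y assume y: "y \<in> J"
      then have "dist y x < r" "y \<in> {s..t}"
        using fineD[OF p(2) xJ] mem(2)[OF xJ] by (auto simp: dist_commute)
      then have "dist (h (\<gamma> y)) (h (\<gamma> x)) < w"
        using mem(1)[OF xJ] by (intro r(2))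
      then show "ennreal (h (\<gamma> x) - w) \<le> ennreal (h (\<gamma> y))"
        by (intro ennreal_leI) (simp add: dist_real_def)
    qed
    moreover have "ennreal (norm (increment \<gamma> J)) \<le> arc_length \<gamma> (Inf J) (Sup J)"
      using dist_le_arc_length[OF mem(4)[OF xJ], of \<gamma>] mem(3)[OF xJ]
      by (simp add: increment_def dist_norm norm_minus_commute)
    ultimately have "ennreal (h (\<gamma> x) - w) * ennreal (norm (increment \<gamma> J)) \<le> g J"
      using mem(3)[OF xJ] by (auto simp: g_def intro: mult_mono)
    \<comment> \<open>\<open>ennreal\<close> sends negative reals to 0, so the minorant
      \<open>h (\<gamma> x) - w\<close> of the infimum acts as its positive part.\<close>
    moreover have "ennreal (norm (increment \<gamma> J) * h (\<gamma> x))
        \<le> ennreal (max 0 (h (\<gamma> x) - w) * norm (increment \<gamma> J) + w * norm (increment \<gamma> J))"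
    proof (rule ennreal_leI)
      have "h (\<gamma> x) \<le> max 0 (h (\<gamma> x) - w) + w" by simp
      from mult_left_mono[OF this norm_ge_zero[of "increment \<gamma> J"]]
      show "norm (increment \<gamma> J) * h (\<gamma> x) \<le> max 0 (h (\<gamma> x) - w) * norm (increment \<gamma> J) + w * norm (increment \<gamma> J)"
        by (simp add: algebra_simps)
    qed
    moreover have "\<dots> = ennreal (h (\<gamma> x) - w) * ennreal (norm (increment \<gamma> J)) + ennreal (w * norm (increment \<gamma> J))"
      using w by (simp add: ennreal_plus ennreal_mult ennreal_max_0)
    ultimately show ?thesis
      by (metis add_right_mono order_trans)
  qed
  have "ennreal T = (\<Sum>(x, J)\<in>p. ennreal (norm (increment \<gamma> J) * h (\<gamma> x)))"
    unfolding T_def case_prod_unfold using mem(1) h(2)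
    by (subst sum_ennreal) (auto intro!: mult_nonneg_nonneg)
  also have "\<dots> \<le> (\<Sum>(x, J)\<in>p. g J + ennreal (w * norm (increment \<gamma> J)))"
    unfolding case_prod_unfold using term_le by (intro sum_mono) auto
  also have "\<dots> = (\<Sum>(x, J)\<in>p. g J) + ennreal (w * (\<Sum>(x, J)\<in>p. norm (increment \<gamma> J)))"
    using w unfolding case_prod_unfold sum.distrib sum_distrib_left
    by (subst sum_ennreal) auto
  also have "\<dots> \<le> ennreal A + ennreal (w * L)"
    using w inc by (intro add_mono g ennreal_leI mult_left_mono) auto
  also have "\<dots> = ennreal (A + w * L)"
    using A(2) w L by (simp add: ennreal_plus)
  finally have "T \<le> A + w * L"
    using A(2) w L by (subst (asm) ennreal_le_iff) auto
  then have "c * T \<le> c * A + c * (w * L)"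
    using mult_left_mono[OF _ c] by (fastforce simp: distrib_left)
  moreover have "c * (w * L) \<le> e / 2"
    using cL e by (simp add: w_def divide_simps)
  moreover have "norm I \<le> norm (rs_sum \<gamma> F p) + norm (rs_sum \<gamma> F p - I)"
    using norm_triangle_ineq4[of "rs_sum \<gamma> F p" "rs_sum \<gamma> F p - I"] by simp
  ultimately show "norm I \<le> c * A + e"
    using rs_le p(3) by linarith
qed

section \<open>Line integrals over open, possibly infinite, parameter intervals\<close>

lemma einterval_Icc_subset:
  "s \<in> einterval a b \<Longrightarrow> t \<in> einterval a b \<Longrightarrow> {s..t} \<subseteq> einterval a b"
  using less_le_trans[of a "ereal s"] le_less_trans[of _ "ereal t" b]
  by (auto simp: einterval_iff)

text \<open>A division that nearly attains the finite supremum leaves at most \<open>e\<close> for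
  anything appended at either end.\<close>

lemma arc_length_integral_tails:
  assumes fin: "arc_length_integral a b \<gamma> h < \<infinity>" and ne: "einterval a b \<noteq> {}" and e: "0 < e"
  obtains s\<^sub>0 t\<^sub>0 where "s\<^sub>0 \<in> einterval a b" "t\<^sub>0 \<in> einterval a b" "s\<^sub>0 \<le> t\<^sub>0"
    "\<And>s d. s \<in> einterval a b \<Longrightarrow> s \<le> s\<^sub>0 \<Longrightarrow> d division_of {s..s\<^sub>0} \<Longrightarrow> darboux_sum \<gamma> h d \<le> ennreal e"
    "\<And>t d. t \<in> einterval a b \<Longrightarrow> t\<^sub>0 \<le> t \<Longrightarrow> d division_of {t\<^sub>0..t} \<Longrightarrow> darboux_sum \<gamma> h d \<le> ennreal e"
proof -
  define A where "A = arc_length_integral a b \<gamma> h"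
  have A: "A < top" using fin by (simp add: A_def)
  obtain c where c: "c \<in> einterval a b" using ne by blast
  have "\<exists>s\<^sub>0 t\<^sub>0 d. s\<^sub>0 \<in> einterval a b \<and> t\<^sub>0 \<in> einterval a b \<and> s\<^sub>0 \<le> t\<^sub>0 \<and> d division_of {s\<^sub>0..t\<^sub>0} \<and>
      A \<le> darboux_sum \<gamma> h d + ennreal e"
  \<comment> \<open>For \<open>A = 0\<close> nothing lies strictly below the supremum, so a
    one-point division is given by hand.\<close>
  proof (cases "A = 0")
    case True
    then show ?thesis
      using c division_of_self[of c c] by (intro exI[of _ c] exI[of _ "{{c..c}}"]) simp
  next
    case False
    then have "A - ennreal e < A"
      using A e by (simp add: ennreal_between zero_less_iff_neq_zero)
    then obtain s t d where d: "{s..t} \<subseteq> einterval a b" "d division_of {s..t}" "A - ennreal e < darboux_sum \<gamma> h d"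
      unfolding A_def arc_length_integral_eq less_SUP_iff by auto
    have "d \<noteq> {}"
      using d(3) by (auto simp: darboux_sum_def)
    then have "s \<le> t" using d(2) by auto
    moreover have "A \<le> darboux_sum \<gamma> h d + ennreal e"
    \<comment> \<open>Subtraction on \<open>ennreal\<close> is truncated at 0, hence the separate
      case in which \<open>e\<close> exceeds \<open>A\<close>.\<close>
    proof (cases "ennreal e \<le> A")
      case True
      then have "A = (A - ennreal e) + ennreal e" by (simp add: diff_add_cancel_ennreal)
      then show ?thesis using d(3) by (metis add_right_mono less_imp_le)
    next
      case False
      then show ?thesis by (meson le_add2 le_cases order_trans zero_le add_increasing)
    qed
    ultimately show ?thesis
      using d by (intro exI[of _ s] exI[of _ t] exI[of _ d]) auto
  qed
  then obtain s\<^sub>0 t\<^sub>0 d\<^sub>0 where st: "s\<^sub>0 \<in> einterval a b" "t\<^sub>0 \<in> einterval a b" "s\<^sub>0 \<le> t\<^sub>0"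
    and d\<^sub>0: "d\<^sub>0 division_of {s\<^sub>0..t\<^sub>0}" "A \<le> darboux_sum \<gamma> h d\<^sub>0 + ennreal e" by blast
  have fin0: "darboux_sum \<gamma> h d\<^sub>0 < top"
    using darboux_sum_le[OF einterval_Icc_subset[OF st(1,2)] d\<^sub>0(1), of \<gamma> h] A
    unfolding A_def by (rule le_less_trans)
  have cancel: "x \<le> ennreal e" if "darboux_sum \<gamma> h d\<^sub>0 + x \<le> A" for x
  proof -
    have "darboux_sum \<gamma> h d\<^sub>0 + x \<le> darboux_sum \<gamma> h d\<^sub>0 + ennreal e"
      using that d\<^sub>0(2) by (rule order_trans)
    then show ?thesis
      using fin0 by (auto simp: ennreal_add_left_cancel_le)
  qed
  show ?thesis
  proof (rule that[OF st])
    fix s d assume s: "s \<in> einterval a b" "s \<le> s\<^sub>0" "d division_of {s..s\<^sub>0}"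
    have "darboux_sum \<gamma> h (d \<union> d\<^sub>0) \<le> A"
      unfolding A_def using division_Un_Icc[OF s(3) d\<^sub>0(1) s(2) st(3)]
      by (rule darboux_sum_le[OF einterval_Icc_subset[OF s(1) st(2)]])
    then show "darboux_sum \<gamma> h d \<le> ennreal e"
      by (intro cancel) (simp add: darboux_sum_Un[OF s(3) d\<^sub>0(1)] add.commute)
  next
    fix t d assume t: "t \<in> einterval a b" "t\<^sub>0 \<le> t" "d division_of {t\<^sub>0..t}"
    have "darboux_sum \<gamma> h (d\<^sub>0 \<union> d) \<le> A"
      unfolding A_def using division_Un_Icc[OF d\<^sub>0(1) t(3) st(3) t(2)]
      by (rule darboux_sum_le[OF einterval_Icc_subset[OF st(1) t(1)]])
    then show "darboux_sum \<gamma> h d \<le> ennreal e"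
      by (intro cancel) (simp add: darboux_sum_Un[OF d\<^sub>0(1) t(3)])
  qed
qed

text \<open>The integrals over compact subintervals form a net under exhaustion. Beyond a suitable
  \<open>[s0, t0]\<close> two of them differ only by end pieces, and these are dominated by the
  tails of the arc length integral of \<open>h\<close>.\<close>

lemma has_line_integral_exists:
  fixes F :: "complex \<Rightarrow> 'c::{complex_normed,banach}"
  assumes ne: "einterval a b \<noteq> {}"
    and rect: "\<And>s t. {s..t} \<subseteq> einterval a b \<Longrightarrow> arc_length \<gamma> s t < \<infinity>"
    and h: "continuous_on (einterval a b) (\<lambda>x. h (\<gamma> x))" "\<And>x. x \<in> einterval a b \<Longrightarrow> 0 \<le> h (\<gamma> x)"
    and fin: "arc_length_integral a b \<gamma> h < \<infinity>"
    and F: "continuous_on (einterval a b) (\<lambda>x. F (\<gamma> x))"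
      "\<And>x. x \<in> einterval a b \<Longrightarrow> norm (F (\<gamma> x)) \<le> c * h (\<gamma> x)" and c: "0 \<le> c"
  obtains I where "has_line_integral a b \<gamma> F I"
proof -
  have rs: "\<exists>J. has_rs_integral \<gamma> F s t J" if st: "s \<in> einterval a b" "t \<in> einterval a b" for s t
  proof -
    obtain J where "has_rs_integral \<gamma> F s t J"
      by (rule has_rs_integral_exists[OF continuous_on_subset[OF F(1)] rect])
        (use einterval_Icc_subset[OF st] in auto)
    then show ?thesis ..
  qed
  have bound: "norm J \<le> c * A"
    if "s \<in> einterval a b" "t \<in> einterval a b" "has_rs_integral \<gamma> F s t J" "0 \<le> A"
      "\<And>d. d division_of {s..t} \<Longrightarrow> darboux_sum \<gamma> h d \<le> ennreal A" for s t J A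
  proof -
    have sub: "{s..t} \<subseteq> einterval a b" by (rule einterval_Icc_subset[OF that(1,2)])
    show ?thesis
      by (rule rs_integral_norm_le[OF that(3) rect[OF sub] continuous_on_subset[OF h(1) sub]])
        (use sub h(2) F(2) c that(4,5) in auto)
  qed
  define D where "D = {(s, t). s \<in> einterval a b \<and> t \<in> einterval a b \<and> s \<le> t}"
  define R where "R i J \<longleftrightarrow> (\<exists>s\<in>einterval a b. \<exists>t\<in>einterval a b. s \<le> fst i \<and> snd i \<le> t \<and>
      has_rs_integral \<gamma> F s t J)" for i :: "real \<times> real" and J
  have "\<exists>i\<in>D. \<forall>v w. R i v \<longrightarrow> R i w \<longrightarrow> norm (v - w) \<le> e" if e: "0 < e" for e
  proof -
    \<comment> \<open>Each value has two end pieces of norm at most \<open>c * e'\<close>, and two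
      values are compared, which makes \<open>4 * (c * e')\<close>; the added 1 admits
      \<open>c = 0\<close>.\<close>
    define e' where "e' = e / (4 * (c + 1))"
    have e': "0 < e'" using e c by (simp add: e'_def)
    obtain s\<^sub>0 t\<^sub>0 where st: "s\<^sub>0 \<in> einterval a b" "t\<^sub>0 \<in> einterval a b" "s\<^sub>0 \<le> t\<^sub>0"
      and left: "\<And>s d. s \<in> einterval a b \<Longrightarrow> s \<le> s\<^sub>0 \<Longrightarrow> d division_of {s..s\<^sub>0} \<Longrightarrow> darboux_sum \<gamma> h d \<le> ennreal e'"
      and right: "\<And>t d. t \<in> einterval a b \<Longrightarrow> t\<^sub>0 \<le> t \<Longrightarrow> d division_of {t\<^sub>0..t} \<Longrightarrow> darboux_sum \<gamma> h d \<le> ennreal e'"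
      using arc_length_integral_tails[OF fin ne e'] by blast
    obtain J where J: "has_rs_integral \<gamma> F s\<^sub>0 t\<^sub>0 J" using rs[OF st(1,2)] by blast
    have near: "norm (v - J) \<le> 2 * (c * e')" if Rv: "R (s\<^sub>0, t\<^sub>0) v" for v
    proof -
      obtain s t where s: "s \<in> einterval a b" "t \<in> einterval a b" "s \<le> s\<^sub>0" "t\<^sub>0 \<le> t"
        "has_rs_integral \<gamma> F s t v"
        using Rv by (auto simp: R_def)
      obtain J1 J2 J3 where J1: "has_rs_integral \<gamma> F s s\<^sub>0 J1" and J2: "has_rs_integral \<gamma> F t\<^sub>0 t J2"
        and J3: "has_rs_integral \<gamma> F s\<^sub>0 t J3"
        using rs[OF s(1) st(1)] rs[OF st(2) s(2)] rs[OF st(1) s(2)] by blast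
      have "v = J1 + J3"
        by (rule has_rs_integral_split[OF s(5) J1 J3]) (use s st in auto)
      moreover have "J3 = J + J2"
        by (rule has_rs_integral_split[OF J3 J J2]) (use s st in auto)
      ultimately have "v - J = J1 + J2" by simp
      moreover have "norm J1 \<le> c * e'"
        by (rule bound[OF s(1) st(1) J1]) (use e' left s in auto)
      moreover have "norm J2 \<le> c * e'"
        by (rule bound[OF st(2) s(2) J2]) (use e' right s in auto)
      ultimately show ?thesis
        using norm_triangle_ineq[of J1 J2] by simp
    qed
    have "norm (v - w) \<le> e" if "R (s\<^sub>0, t\<^sub>0) v" "R (s\<^sub>0, t\<^sub>0) w" for v w
    proof -
      have "norm (v - w) \<le> norm (v - J) + norm (w - J)"
        using norm_triangle_ineq4[of "v - J" "w - J"] by simp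
      also have "\<dots> \<le> 4 * (c * e')"
        using near[OF that(1)] near[OF that(2)] by simp
      also have "\<dots> \<le> e"
        using e c by (simp add: e'_def field_simps)
      finally show ?thesis .
    qed
    then show ?thesis
      using st by (intro bexI[of _ "(s\<^sub>0, t\<^sub>0)"]) (auto simp: D_def)
  qed
  moreover have "\<exists>v. R i v \<and> R j v" if "i \<in> D" "j \<in> D" for i j
  proof -
    have mem: "min (fst i) (fst j) \<in> einterval a b" "max (snd i) (snd j) \<in> einterval a b"
      using that by (auto simp: D_def min_def max_def)
    obtain v where "has_rs_integral \<gamma> F (min (fst i) (fst j)) (max (snd i) (snd j)) v"
      using rs[OF mem] by blast
    then show ?thesis
      unfolding R_def using mem
      by (intro exI[of _ v] conjI bexI[of _ "min (fst i) (fst j)"] bexI[of _ "max (snd i) (snd j)"]) auto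
  qed
  ultimately obtain I where I: "\<And>e. 0 < e \<Longrightarrow> \<exists>i\<in>D. \<forall>v. R i v \<longrightarrow> norm (v - I) < e"
    using net_limit_exists[of D R] by blast
  have "has_line_integral a b \<gamma> F I"
    unfolding has_line_integral_def
  proof (intro allI impI)
    fix e :: real assume "0 < e"
    from I[OF this] obtain s\<^sub>0 t\<^sub>0 where st: "(s\<^sub>0, t\<^sub>0) \<in> D" "\<And>v. R (s\<^sub>0, t\<^sub>0) v \<Longrightarrow> norm (v - I) < e"
      by auto
    show "\<exists>s\<^sub>0\<in>einterval a b. \<exists>t\<^sub>0\<in>einterval a b. s\<^sub>0 \<le> t\<^sub>0 \<and>
        (\<forall>s\<in>einterval a b. \<forall>t\<in>einterval a b. s \<le> s\<^sub>0 \<and> t\<^sub>0 \<le> t \<longrightarrow>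
           (\<exists>J. has_rs_integral \<gamma> F s t J \<and> norm (J - I) < e))"
    proof (rule bexI[of _ s\<^sub>0], rule bexI[of _ t\<^sub>0], intro conjI ballI impI)
      fix s t assume s: "s \<in> einterval a b" "t \<in> einterval a b" "s \<le> s\<^sub>0 \<and> t\<^sub>0 \<le> t"
      obtain J where J: "has_rs_integral \<gamma> F s t J" using rs[OF s(1,2)] by blast
      then have "R (s\<^sub>0, t\<^sub>0) J" using s by (auto simp: R_def)
      then show "\<exists>J. has_rs_integral \<gamma> F s t J \<and> norm (J - I) < e"
        using J st(2) by blast
    qed (use st(1) in \<open>auto simp: D_def\<close>)
  qed
  then show ?thesis by (rule that)
qed

lemma has_line_integralE:
  assumes "has_line_integral a b \<gamma> F I" "0 < e"
  obtains s\<^sub>0 t\<^sub>0 where "s\<^sub>0 \<in> einterval a b" "t\<^sub>0 \<in> einterval a b"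
    "\<And>s t. s \<in> einterval a b \<Longrightarrow> t \<in> einterval a b \<Longrightarrow> s \<le> s\<^sub>0 \<Longrightarrow> t\<^sub>0 \<le> t \<Longrightarrow>
      \<exists>J. has_rs_integral \<gamma> F s t J \<and> norm (J - I) < e"
proof -
  have "\<exists>s\<^sub>0\<in>einterval a b. \<exists>t\<^sub>0\<in>einterval a b. s\<^sub>0 \<le> t\<^sub>0 \<and>
      (\<forall>s\<in>einterval a b. \<forall>t\<in>einterval a b. s \<le> s\<^sub>0 \<and> t\<^sub>0 \<le> t \<longrightarrow>
         (\<exists>J. has_rs_integral \<gamma> F s t J \<and> norm (J - I) < e))"
    using assms by (simp add: has_line_integral_def)
  then obtain s\<^sub>0 t\<^sub>0 where "s\<^sub>0 \<in> einterval a b" "t\<^sub>0 \<in> einterval a b"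
    "\<forall>s\<in>einterval a b. \<forall>t\<in>einterval a b. s \<le> s\<^sub>0 \<and> t\<^sub>0 \<le> t \<longrightarrow>
         (\<exists>J. has_rs_integral \<gamma> F s t J \<and> norm (J - I) < e)"
    by (elim bexE conjE)
  then show ?thesis by (intro that; blast)
qed

lemma has_line_integral_unique:
  assumes I: "has_line_integral a b \<gamma> F I" and J: "has_line_integral a b \<gamma> F J"
  shows "I = J"
proof (rule ccontr)
  assume "I \<noteq> J"
  then have e: "0 < norm (I - J) / 2" by simp
  obtain s t where st: "s \<in> einterval a b" "t \<in> einterval a b"
    "\<And>s' t'. s' \<in> einterval a b \<Longrightarrow> t' \<in> einterval a b \<Longrightarrow> s' \<le> s \<Longrightarrow> t \<le> t' \<Longrightarrow>
      \<exists>K. has_rs_integral \<gamma> F s' t' K \<and> norm (K - I) < norm (I - J) / 2"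
    using has_line_integralE[OF I e] by blast
  obtain u v where uv: "u \<in> einterval a b" "v \<in> einterval a b"
    "\<And>s' t'. s' \<in> einterval a b \<Longrightarrow> t' \<in> einterval a b \<Longrightarrow> s' \<le> u \<Longrightarrow> v \<le> t' \<Longrightarrow>
      \<exists>K. has_rs_integral \<gamma> F s' t' K \<and> norm (K - J) < norm (I - J) / 2"
    using has_line_integralE[OF J e] by blast
  have mem: "min s u \<in> einterval a b" "max t v \<in> einterval a b"
    using st uv by (auto simp: min_def max_def)
  obtain K where K: "has_rs_integral \<gamma> F (min s u) (max t v) K" "norm (K - I) < norm (I - J) / 2"
    using st(3)[OF mem] by auto
  obtain K' where K': "has_rs_integral \<gamma> F (min s u) (max t v) K'" "norm (K' - J) < norm (I - J) / 2"
    using uv(3)[OF mem] by auto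
  have "K' = K" by (rule has_rs_integral_unique[OF K'(1) K(1)])
  then show False
    using K(2) K'(2) norm_triangle_ineq4[of "K - J" "K - I"] by simp
qed

lemma line_integral_eq: "has_line_integral a b \<gamma> F I \<Longrightarrow> line_integral a b \<gamma> F = I"
  unfolding line_integral_def by (blast intro: the_equality has_line_integral_unique)

lemma has_line_integral_add:
  assumes I: "has_line_integral a b \<gamma> F I" and J: "has_line_integral a b \<gamma> G J"
  shows "has_line_integral a b \<gamma> (\<lambda>\<mu>. F \<mu> + G \<mu>) (I + J)"
  unfolding has_line_integral_def
proof (intro allI impI)
  fix e :: real assume "0 < e"
  then have e: "0 < e / 2" by simp
  obtain s t where st: "s \<in> einterval a b" "t \<in> einterval a b"
    "\<And>s' t'. s' \<in> einterval a b \<Longrightarrow> t' \<in> einterval a b \<Longrightarrow> s' \<le> s \<Longrightarrow> t \<le> t' \<Longrightarrow>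
      \<exists>K. has_rs_integral \<gamma> F s' t' K \<and> norm (K - I) < e / 2"
    using has_line_integralE[OF I e] by blast
  obtain u v where uv: "u \<in> einterval a b" "v \<in> einterval a b"
    "\<And>s' t'. s' \<in> einterval a b \<Longrightarrow> t' \<in> einterval a b \<Longrightarrow> s' \<le> u \<Longrightarrow> v \<le> t' \<Longrightarrow>
      \<exists>K. has_rs_integral \<gamma> G s' t' K \<and> norm (K - J) < e / 2"
    using has_line_integralE[OF J e] by blast
  define s\<^sub>0 where "s\<^sub>0 = min s u"
  \<comment> \<open>Including the left end point in the maximum secures the required order of the
    two parameters, which \<open>has_line_integralE\<close> does not return.\<close>
  define t\<^sub>0 where "t\<^sub>0 = max s\<^sub>0 (max t v)"
  have mem: "s\<^sub>0 \<in> einterval a b" "t\<^sub>0 \<in> einterval a b"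
    using st uv by (auto simp: s\<^sub>0_def t\<^sub>0_def min_def max_def)
  show "\<exists>s\<^sub>0\<in>einterval a b. \<exists>t\<^sub>0\<in>einterval a b. s\<^sub>0 \<le> t\<^sub>0 \<and>
      (\<forall>s\<in>einterval a b. \<forall>t\<in>einterval a b. s \<le> s\<^sub>0 \<and> t\<^sub>0 \<le> t \<longrightarrow>
         (\<exists>K. has_rs_integral \<gamma> (\<lambda>\<mu>. F \<mu> + G \<mu>) s t K \<and> norm (K - (I + J)) < e))"
  proof (rule bexI[of _ s\<^sub>0], rule bexI[of _ t\<^sub>0], intro conjI ballI impI)
    fix s' t' assume s': "s' \<in> einterval a b" "t' \<in> einterval a b" "s' \<le> s\<^sub>0 \<and> t\<^sub>0 \<le> t'"
    obtain K K' where K: "has_rs_integral \<gamma> F s' t' K" "norm (K - I) < e / 2"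
      "has_rs_integral \<gamma> G s' t' K'" "norm (K' - J) < e / 2"
      using st(3)[OF s'(1,2)] uv(3)[OF s'(1,2)] s'(3) by (auto simp: s\<^sub>0_def t\<^sub>0_def)
    have "norm ((K + K') - (I + J)) < e"
      using norm_add_less[OF K(2,4)] by (simp add: algebra_simps)
    then show "\<exists>K. has_rs_integral \<gamma> (\<lambda>\<mu>. F \<mu> + G \<mu>) s' t' K \<and> norm (K - (I + J)) < e"
      using has_rs_integral_add[OF K(1,3)] by blast
  qed (use mem in \<open>auto simp: t\<^sub>0_def\<close>)
qed

lemma has_line_integral_linear:
  fixes F :: "complex \<Rightarrow> 'c::complex_normed" and L :: "'c \<Rightarrow> 'd::complex_normed"
  assumes I: "has_line_integral a b \<gamma> F I"
    and L: "bounded_linear L" "\<And>c x. L (c *\<^sub>C x) = c *\<^sub>C L x"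
  shows "has_line_integral a b \<gamma> (\<lambda>\<mu>. L (F \<mu>)) (L I)"
  unfolding has_line_integral_def
proof (intro allI impI)
  fix e :: real assume e: "0 < e"
  obtain K where K: "0 < K" "\<And>x. norm (L x) \<le> norm x * K"
    using bounded_linear.pos_bounded[OF L(1)] by blast
  obtain s\<^sub>0 t\<^sub>0 where st: "s\<^sub>0 \<in> einterval a b" "t\<^sub>0 \<in> einterval a b" "s\<^sub>0 \<le> t\<^sub>0"
    "\<forall>s\<in>einterval a b. \<forall>t\<in>einterval a b. s \<le> s\<^sub>0 \<and> t\<^sub>0 \<le> t \<longrightarrow>
         (\<exists>J. has_rs_integral \<gamma> F s t J \<and> norm (J - I) < e / K)"
    using I divide_pos_pos[OF e K(1)] unfolding has_line_integral_def by meson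
  show "\<exists>s\<^sub>0\<in>einterval a b. \<exists>t\<^sub>0\<in>einterval a b. s\<^sub>0 \<le> t\<^sub>0 \<and>
      (\<forall>s\<in>einterval a b. \<forall>t\<in>einterval a b. s \<le> s\<^sub>0 \<and> t\<^sub>0 \<le> t \<longrightarrow>
         (\<exists>J. has_rs_integral \<gamma> (\<lambda>\<mu>. L (F \<mu>)) s t J \<and> norm (J - L I) < e))"
  proof (rule bexI[of _ s\<^sub>0], rule bexI[of _ t\<^sub>0], intro conjI ballI impI)
    fix s t assume s: "s \<in> einterval a b" "t \<in> einterval a b" "s \<le> s\<^sub>0 \<and> t\<^sub>0 \<le> t"
    obtain J where J: "has_rs_integral \<gamma> F s t J" "norm (J - I) < e / K"
      using st(4) s by blast
    have "norm (L J - L I) \<le> norm (J - I) * K"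
      using K(2) by (simp add: linear_diff[OF bounded_linear.linear[OF L(1)], symmetric])
    also have "\<dots> < e" using J(2) K(1) by (simp add: field_simps)
    finally show "\<exists>J. has_rs_integral \<gamma> (\<lambda>\<mu>. L (F \<mu>)) s t J \<and> norm (J - L I) < e"
      using has_rs_integral_linear[OF J(1) L] by blast
  qed (use st in auto)
qed

lemma has_line_integral_clinear:
  assumes I: "has_line_integral a b \<gamma> F I" and F: "\<And>x. x \<in> einterval a b \<Longrightarrow> clinear_op (F (\<gamma> x))"
  shows "clinear_op I"
proof -
  have "\<exists>J\<in>Collect clinear_op. dist J I < e" if e: "0 < e" for e
  proof -
    obtain s t where st: "s \<in> einterval a b" "t \<in> einterval a b"
      "\<And>s' t'. s' \<in> einterval a b \<Longrightarrow> t' \<in> einterval a b \<Longrightarrow> s' \<le> s \<Longrightarrow> t \<le> t' \<Longrightarrow>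
        \<exists>J. has_rs_integral \<gamma> F s' t' J \<and> norm (J - I) < e"
      using has_line_integralE[OF I e] by blast
    obtain J where J: "has_rs_integral \<gamma> F s t J" "norm (J - I) < e"
      using st(3)[OF st(1,2)] by auto
    have "clinear_op J"
      by (rule has_rs_integral_clinear[OF J(1)]) (use F einterval_Icc_subset[OF st(1,2)] in auto)
    then show ?thesis using J(2) by (auto simp: dist_norm)
  qed
  then have "I \<in> closure (Collect clinear_op)"
    by (auto simp: closure_approachable)
  then show ?thesis
    by (simp add: closure_closed[OF closed_clinear_op])
qed

lemma has_line_integral_norm_le:
  fixes F :: "complex \<Rightarrow> 'c::complex_normed"
  assumes I: "has_line_integral a b \<gamma> F I"
    and rect: "\<And>s t. {s..t} \<subseteq> einterval a b \<Longrightarrow> arc_length \<gamma> s t < \<infinity>"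
    and h: "continuous_on (einterval a b) (\<lambda>x. h (\<gamma> x))" "\<And>x. x \<in> einterval a b \<Longrightarrow> 0 \<le> h (\<gamma> x)"
    and fin: "arc_length_integral a b \<gamma> h < \<infinity>"
    and F: "\<And>x. x \<in> einterval a b \<Longrightarrow> norm (F (\<gamma> x)) \<le> c * h (\<gamma> x)" and c: "0 \<le> c"
  shows "norm I \<le> c * enn2real (arc_length_integral a b \<gamma> h)"
proof (rule field_le_epsilon)
  fix e :: real assume e: "0 < e"
  obtain s t where st: "s \<in> einterval a b" "t \<in> einterval a b"
    "\<And>s' t'. s' \<in> einterval a b \<Longrightarrow> t' \<in> einterval a b \<Longrightarrow> s' \<le> s \<Longrightarrow> t \<le> t' \<Longrightarrow>
      \<exists>J. has_rs_integral \<gamma> F s' t' J \<and> norm (J - I) < e"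
    using has_line_integralE[OF I e] by blast
  obtain J where J: "has_rs_integral \<gamma> F s t J" "norm (J - I) < e"
    using st(3)[OF st(1,2)] by auto
  have sub: "{s..t} \<subseteq> einterval a b" by (rule einterval_Icc_subset[OF st(1,2)])
  have "norm J \<le> c * enn2real (arc_length_integral a b \<gamma> h)"
  proof (rule rs_integral_norm_le[OF J(1) rect[OF sub] continuous_on_subset[OF h(1) sub]])
    fix d assume "d division_of {s..t}"
    from darboux_sum_le[OF sub this, of \<gamma> h] fin
    show "darboux_sum \<gamma> h d \<le> ennreal (enn2real (arc_length_integral a b \<gamma> h))"
      by simp
  qed (use sub h(2) F c in auto)
  then show "norm I \<le> c * enn2real (arc_length_integral a b \<gamma> h) + e"
    using J(2) norm_triangle_ineq4[of J "J - I"] by simp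
qed

section \<open>Integrals over contours\<close>

lemma clinear_op_adjoint:
  assumes "clinear_op B" "is_adjoint B' B"
  shows "clinear_op B'"
  unfolding clinear_op_def
proof (rule allI, rule allI, rule cinner_eqI)
  fix c x u
  have "cinner u (B' (c *\<^sub>C x)) = cnj c * cinner (B u) x"
    using assms(2) unfolding is_adjoint_def by (metis cinner_scaleC_right)
  also have "\<dots> = cinner u (c *\<^sub>C B' x)"
    using assms(2) unfolding is_adjoint_def by (metis cinner_scaleC_right)
  finally show "cinner u (B' (c *\<^sub>C x)) = cinner u (c *\<^sub>C B' x)" .
qed

lemma bounded_linear_cinner_left: "bounded_linear (\<lambda>x. cinner x (y :: 'a::complex_hilbert))"
proof (rule bounded_linear_intro)
  fix x x' :: 'a and r :: real
  show "cinner (x + x') y = cinner x y + cinner x' y" by (rule cinner_add_left)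
  show "cinner (r *\<^sub>R x) y = r *\<^sub>R cinner x y"
    by (simp add: scaleR_scaleC[of r x] cinner_scaleC_left scaleR_conv_of_real)
  have "\<bar>Re (cinner x y)\<bar> \<le> norm x * norm y"
    using Cauchy_Schwarz_ineq2[of x y] by (simp add: inner_eq_Re_cinner)
  \<comment> \<open>Multiplying the first argument by \<open>- \<i>\<close> turns the imaginary part
    into a real part, to which the real Cauchy-Schwarz inequality applies.\<close>
  moreover have "\<bar>Im (cinner x y)\<bar> \<le> norm x * norm y"
    using Cauchy_Schwarz_ineq2[of "(- \<i>) *\<^sub>C x" y]
    by (simp add: inner_eq_Re_cinner cinner_scaleC_left norm_scaleC)
  ultimately show "norm (cinner x y) \<le> norm x * (2 * norm y)"
    using cmod_le[of "cinner x y"] by linarith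
qed

lemma op_holomorphic_on_continuous:
  assumes "op_holomorphic_on F U"
  shows "continuous_on U F"
  using assms unfolding op_holomorphic_on_def
  by (meson continuous_at_imp_continuous_on has_derivative_continuous)

lemma op_holomorphic_on_functional:
  assumes F: "op_holomorphic_on F U"
    and L: "bounded_linear L" "\<And>c x. L (c *\<^sub>C x) = c * (L x :: complex)" and "open U"
  shows "(\<lambda>z. L (F z)) holomorphic_on U"
proof -
  have "(\<lambda>z. L (F z)) field_differentiable at z" if z: "z \<in> U" for z
  proof -
    obtain F' where "(F has_derivative (\<lambda>w. w *\<^sub>C F')) (at z)"
      using F z unfolding op_holomorphic_on_def by blast
    from bounded_linear.has_derivative[OF L(1) this]
    have "((\<lambda>z. L (F z)) has_derivative (\<lambda>w. L F' * w)) (at z)"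
      by (simp add: L(2) mult.commute)
    then show ?thesis
      unfolding field_differentiable_def has_field_derivative_def by blast
  qed
  then show ?thesis
    using \<open>open U\<close> by (simp add: holomorphic_on_open field_differentiable_def)
qed

text \<open>The scalar identity theorem is used twice: from the real set \<open>\<Delta>\<close> to
  a ball around \<open>p\<close>, and from the overlap of this ball with \<open>D\<close> to all of
  \<open>D\<close>. The detour through the ball is needed because \<open>\<Delta>\<close> need not
  lie in \<open>D\<close> and \<open>U\<close> need not be connected.\<close>

lemma clinear_op_analytic_continuation:
  fixes F :: "complex \<Rightarrow> 'a::complex_hilbert \<Rightarrow>\<^sub>L 'b::complex_hilbert"
  assumes F: "op_holomorphic_on F U" and U: "open U" "complex_of_real ` \<Delta> \<subseteq> U" "D \<subseteq> U"
    and D: "open D" "connected D" and \<Delta>: "open \<Delta>" "p \<in> \<Delta>" "complex_of_real p \<in> closure D"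
    and lin: "\<And>\<mu>. \<mu> \<in> \<Delta> \<Longrightarrow> clinear_op (F (complex_of_real \<mu>))" and w: "w \<in> D"
  shows "clinear_op (F w)"
  unfolding clinear_op_def
proof (intro allI)
  fix c x
  define L where "L T = T (c *\<^sub>C x) - c *\<^sub>C T x" for T :: "'a \<Rightarrow>\<^sub>L 'b"
  have L: "bounded_linear L" "\<And>d T. L (d *\<^sub>C T) = d *\<^sub>C L T"
    unfolding L_def by (rule clinear_op_defect)+
  \<comment> \<open>Pairing with the fixed vector \<open>L (F w)\<close> makes the defect scalar; at
    \<open>z = w\<close> the value is its squared norm, so vanishing of \<open>f w\<close> is
    enough.\<close>
  define f where "f z = cinner (L (F z)) (L (F w))" for z
  have f: "f holomorphic_on U"
    unfolding f_def
  proof (rule op_holomorphic_on_functional[OF F _ _ U(1)])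
    show "bounded_linear (\<lambda>T. cinner (L T) (L (F w)))"
      by (rule bounded_linear_compose[OF bounded_linear_cinner_left L(1)])
  qed (simp add: L(2) cinner_scaleC_left)
  have zero: "f (complex_of_real \<mu>) = 0" if "\<mu> \<in> \<Delta>" for \<mu>
    using lin[OF that] cinner_scaleC_left[of 0 0]
    by (simp add: f_def L_def clinear_op_def scaleC.zero_left)
  have "complex_of_real p \<in> U" using U(2) \<Delta>(2) by blast
  then obtain e where e: "0 < e" "ball (complex_of_real p) e \<subseteq> U"
    using U(1) open_contains_ball by blast
  have ball0: "f z = 0" if "z \<in> ball (complex_of_real p) e" for z
  proof (rule analytic_continuation[of f "ball (complex_of_real p) e" "complex_of_real ` \<Delta> \<inter> ball (complex_of_real p) e" "complex_of_real p"])
    show "f holomorphic_on ball (complex_of_real p) e"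
      by (rule holomorphic_on_subset[OF f e(2)])
    show "complex_of_real p islimpt complex_of_real ` \<Delta> \<inter> ball (complex_of_real p) e"
      unfolding islimpt_approachable
    proof (intro allI impI)
      fix r :: real assume r: "0 < r"
      obtain r' where r': "0 < r'" "ball p r' \<subseteq> \<Delta>"
        using \<Delta>(1,2) open_contains_ball by blast
      define h where "h = min r (min r' e) / 2"
      have h: "0 < h" "h < r" "h < r'" "h < e" using r r' e by (auto simp: h_def)
      have "dist (complex_of_real (p + h)) (complex_of_real p) = h"
        using h by (simp add: dist_norm)
      moreover have "p + h \<in> \<Delta>" using r'(2) h by (auto simp: subset_iff dist_real_def)
      ultimately show "\<exists>y\<in>complex_of_real ` \<Delta> \<inter> ball (complex_of_real p) e.
          y \<noteq> complex_of_real p \<and> dist y (complex_of_real p) < r"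
        using h by (intro bexI[of _ "complex_of_real (p + h)"] IntI imageI) (auto simp: dist_commute)
    qed
  qed (use that zero e in auto)
  obtain q where "q \<in> D" "dist q (complex_of_real p) < e"
    using \<Delta>(3) e(1) unfolding closure_approachable by blast
  then have q: "q \<in> ball (complex_of_real p) e \<inter> D" by (simp add: dist_commute)
  have "f w = 0"
  proof (rule analytic_continuation[of f D "ball (complex_of_real p) e \<inter> D" q])
    show "f holomorphic_on D"
      by (rule holomorphic_on_subset[OF f U(3)])
    show "q islimpt ball (complex_of_real p) e \<inter> D"
      using q D(1) by (intro interior_limit_point) (auto simp: interior_open open_Int)
  qed (use D q w ball0 in auto)
  then have "L (F w) = 0"
    unfolding f_def by (rule cinner_self_eq_0)
  then show "F w (c *\<^sub>C x) = c *\<^sub>C F w x" by (simp add: L_def)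
qed

lemma closure_cnj: "complex_of_real p \<in> closure D \<Longrightarrow> complex_of_real p \<in> closure (cnj ` D)"
  unfolding closure_approachable
proof (intro allI impI)
  fix e :: real assume "\<forall>e>0. \<exists>y\<in>D. dist y (complex_of_real p) < e" "0 < e"
  then obtain y where y: "y \<in> D" "dist y (complex_of_real p) < e" by blast
  have "dist (cnj y) (complex_of_real p) = dist y (complex_of_real p)"
    by (metis complex_cnj_complex_of_real complex_cnj_diff complex_mod_cnj dist_norm)
  then show "\<exists>y\<in>cnj ` D. dist y (complex_of_real p) < e"
    using y by (intro bexI[of _ "cnj y"]) auto
qed

section \<open>The contour, its separation from \<open>z\<close>, and the density on it\<close>

text \<open>Finite variation is what the integration theory uses; the smallness of \<open>V0\<close>
  enters only in the final theorem.\<close>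

locale bounded_contour =
  fixes S :: "('a::complex_hilbert, 'b::complex_hilbert) block_data"
    and l :: "nat \<Rightarrow> int" and \<Gamma> :: "nat \<Rightarrow> real \<Rightarrow> complex"
  assumes standing: "standing_assumptions S" and contour: "contour S l \<Gamma>"
    and bounded: "KB_bounded S \<Gamma>"
begin

abbreviation "I \<equiv> {1..num S}"

definition rest :: "real set" where
  "rest = complex_of_real -` sigma_rest S"

text \<open>Exactly the points at which the integrals evaluate their integrand: the real points of
  \<open>sigma_rest S\<close> and the open arcs. Bounds and continuity are therefore required on
  \<open>Z\<close> only.\<close>

definition Z :: "complex set" where
  "Z = complex_of_real ` rest \<union> trace_of S \<Gamma>"

definition rest_variation :: ennreal where
  "rest_variation = (SUP \<delta> \<in> {\<delta> :: nat \<Rightarrow> real set. range \<delta> \<subseteq> sets borel \<and> disjoint_family \<delta> \<and>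
     (\<Union>n. \<delta> n) = complex_of_real -` op_spectrum (opA0 S)}.
     \<Sum>n. ennreal (norm (KB_measure S (\<delta> n \<inter> rest))))"

definition arc_variation :: "nat \<Rightarrow> ennreal" where
  "arc_variation k = arc_length_integral (lo S k) (hi S k) (\<Gamma> k) (\<lambda>\<mu>. norm (Kp S k \<mu>))"

lemma V0_eq: "V0 S \<Gamma> = rest_variation + (\<Sum>k\<in>I. arc_variation k)"
  by (simp add: V0_def rest_variation_def arc_variation_def rest_def)

lemma variations_finite: "rest_variation < top" "k \<in> I \<Longrightarrow> arc_variation k < top"
proof -
  have fin: "rest_variation + (\<Sum>k\<in>I. arc_variation k) < top"
    using bounded by (simp add: KB_bounded_def V0_eq)
  then show "rest_variation < top"
    by (simp add: ennreal_add_less_top)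
  show "arc_variation k < top" if "k \<in> I"
    using fin member_le_sum[OF that, of arc_variation] by (simp add: ennreal_add_less_top le_less_trans)
qed

lemma enn2real_V0: "enn2real (V0 S \<Gamma>) = enn2real rest_variation + (\<Sum>k\<in>I. enn2real (arc_variation k))"
proof -
  have "V0 S \<Gamma> = ennreal (enn2real rest_variation) + (\<Sum>k\<in>I. ennreal (enn2real (arc_variation k)))"
    unfolding V0_eq using variations_finite by simp
  also have "\<dots> = ennreal (enn2real rest_variation + (\<Sum>k\<in>I. enn2real (arc_variation k)))"
    by (simp add: sum_nonneg ennreal_plus)
  finally have "V0 S \<Gamma> = ennreal (enn2real rest_variation + (\<Sum>k\<in>I. enn2real (arc_variation k)))" .
  then show ?thesis
    by (simp only:) (intro enn2real_ennreal add_nonneg_nonneg sum_nonneg enn2real_nonneg)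
qed

lemma closed_rest: "closed rest" and closed_spectrum: "closed (complex_of_real -` op_spectrum (opA0 S))"
  and rest_eq: "rest = complex_of_real -` op_spectrum (opA0 S) - (\<Union>k\<in>I. Delta S k)"
proof -
  show cl: "closed (complex_of_real -` op_spectrum (opA0 S))"
    by (intro continuous_closed_vimage closed_op_spectrum) (intro continuous_intros)
  show eq: "rest = complex_of_real -` op_spectrum (opA0 S) - (\<Union>k\<in>I. Delta S k)"
    by (auto simp: rest_def sigma_rest_def)
  have "open (\<Union>k\<in>I. Delta S k)"
    by (intro open_UN) (simp add: Delta_def)
  then show "closed rest"
    unfolding eq using cl by (rule closed_Diff[rotated])
qed

lemma Delta_nonempty: "k \<in> I \<Longrightarrow> Delta S k \<noteq> {}"
  using standing unfolding standing_assumptions_def spectral_assumptions_def by blast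

text \<open>An end point is a limit of points of the closed spectrum, and no other open interval can
  contain it, since disjoint open sets avoid each other's closure. Thus the ends missing from the
  open arcs are recovered in \<open>rest\<close>.\<close>

lemma endpoints_rest:
  assumes k: "k \<in> I" and x: "x \<in> closure (Delta S k) - Delta S k"
  shows "x \<in> rest"
proof -
  have "\<forall>k\<in>I. complex_of_real ` Delta S k \<subseteq> continuous_spectrum (opA0 S)"
    using standing unfolding standing_assumptions_def spectral_assumptions_def ball_conj_distrib
    by (elim conjE)
  then have spec: "Delta S k \<subseteq> complex_of_real -` op_spectrum (opA0 S)"
    using k by (force simp: continuous_spectrum_def)
  then have "closure (Delta S k) \<subseteq> complex_of_real -` op_spectrum (opA0 S)"
    using closed_spectrum by (rule closure_minimal)
  moreover have "x \<notin> Delta S j" if j: "j \<in> I" for j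
  proof
    assume xj: "x \<in> Delta S j"
    then have "j \<noteq> k" using x by auto
    then have "Delta S j \<inter> Delta S k = {}"
      using standing j k unfolding standing_assumptions_def spectral_assumptions_def disjoint_family_on_def
      by blast
    moreover have "open (Delta S j)" by (simp add: Delta_def)
    ultimately have "Delta S j \<inter> closure (Delta S k) = {}"
      by (metis open_Int_closure_eq_empty)
    then show False using x xj by blast
  qed
  ultimately show ?thesis
    using x by (auto simp: rest_eq)
qed

lemma deformation:
  assumes "k \<in> I"
  shows "continuous_on (closure (Delta S k)) (\<Gamma> k)" "\<Gamma> k ` Delta S k \<subseteq> sheet S l k"
    "\<And>s t. {s..t} \<subseteq> Delta S k \<Longrightarrow> arc_length (\<Gamma> k) s t < \<infinity>"
    "fixes_ends (lo S k) (hi S k) (\<Gamma> k)"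
proof -
  have jd: "jordan_deformation (lo S k) (hi S k) (sheet S l k) (\<Gamma> k)"
    using contour assms by (auto simp: contour_def)
  show "continuous_on (closure (Delta S k)) (\<Gamma> k)" "\<Gamma> k ` Delta S k \<subseteq> sheet S l k"
    using jd by (auto simp: jordan_deformation_def Delta_def)
  show "arc_length (\<Gamma> k) s t < \<infinity>" if "{s..t} \<subseteq> Delta S k" for s t
    using jd that closure_subset unfolding jordan_deformation_def Delta_def by blast
  show "fixes_ends (lo S k) (hi S k) (\<Gamma> k)"
    using jd unfolding jordan_deformation_def by (blast dest: homotopic_with_imp_property)
qed

text \<open>The open arc is not closed and may run to infinity, so a positive distance is not
  automatic. Finite ends lie in \<open>Z\<close> and infinite ends escape every bounded set, which
  confines the relevant parameters to a compact set.\<close>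

lemma arc_separated:
  assumes k: "k \<in> I" and z: "z \<notin> Z"
  obtains r where "0 < r" "\<forall>x\<in>Delta S k. r \<le> dist z (\<Gamma> k x)"
proof -
  define C where "C = closure (Delta S k)"
  \<comment> \<open>The parameters whose points come within distance 1 of \<open>z\<close>; off
    \<open>P\<close> the distance already exceeds 1.\<close>
  define P where "P = {x \<in> C. dist z (\<Gamma> k x) \<le> 1}"
  have cont: "continuous_on C (\<lambda>x. dist z (\<Gamma> k x))"
    unfolding C_def by (intro continuous_on_dist continuous_on_const deformation[OF k])
  have "closed P"
    unfolding P_def by (intro continuous_on_closed_Collect_le cont continuous_on_const) (simp add: C_def)
  moreover have "bounded P"
  proof -
    have ab: "lo S k < hi S k"
      using Delta_nonempty[OF k] by (auto simp: Delta_def einterval_def)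
    have "\<exists>u. \<forall>x\<in>P. u \<le> x"
    proof (cases "lo S k")
      case (real u)
      have "C \<subseteq> {u..}"
        unfolding C_def by (rule closure_minimal) (auto simp: Delta_def einterval_def real)
      then show ?thesis by (auto simp: P_def)
    next
      case MInf
      then have "filterlim (\<Gamma> k) at_infinity at_bot"
        using deformation(4)[OF k] by (simp add: fixes_ends_def)
      then have "\<forall>\<^sub>F x in at_bot. norm z + 2 \<le> norm (\<Gamma> k x)"
        unfolding filterlim_at_infinity[OF order_refl] by (metis add_nonneg_pos norm_ge_zero zero_less_numeral)
      \<comment> \<open>A point of modulus at least \<open>norm z + 2\<close> has distance at least
        2 from \<open>z\<close> and hence its parameter is outside \<open>P\<close>.\<close>
      then obtain u where u: "\<And>x. x \<le> u \<Longrightarrow> norm z + 2 \<le> norm (\<Gamma> k x)"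
        by (auto simp: eventually_at_bot_linorder)
      have "u \<le> x" if "x \<in> P" for x
      proof (rule ccontr)
        assume "\<not> u \<le> x"
        then have "norm z + 2 \<le> norm (\<Gamma> k x)" by (intro u) simp
        moreover have "norm (\<Gamma> k x) \<le> norm z + dist z (\<Gamma> k x)"
          using norm_triangle_ineq4[of z "z - \<Gamma> k x"] by (simp add: dist_norm)
        ultimately show False using that by (simp add: P_def)
      qed
      then show ?thesis by blast
    qed (use ab in auto)
    then obtain u where u: "\<And>x. x \<in> P \<Longrightarrow> u \<le> x" by blast
    have "\<exists>v. \<forall>x\<in>P. x \<le> v"
    proof (cases "hi S k")
      case (real v)
      have "C \<subseteq> {..v}"
        unfolding C_def by (rule closure_minimal) (auto simp: Delta_def einterval_def real)
      then show ?thesis by (auto simp: P_def)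
    next
      case PInf
      then have "filterlim (\<Gamma> k) at_infinity at_top"
        using deformation(4)[OF k] by (simp add: fixes_ends_def)
      then have "\<forall>\<^sub>F x in at_top. norm z + 2 \<le> norm (\<Gamma> k x)"
        unfolding filterlim_at_infinity[OF order_refl] by (metis add_nonneg_pos norm_ge_zero zero_less_numeral)
      then obtain v where v: "\<And>x. v \<le> x \<Longrightarrow> norm z + 2 \<le> norm (\<Gamma> k x)"
        by (auto simp: eventually_at_top_linorder)
      have "x \<le> v" if "x \<in> P" for x
      proof (rule ccontr)
        assume "\<not> x \<le> v"
        then have "norm z + 2 \<le> norm (\<Gamma> k x)" by (intro v) simp
        moreover have "norm (\<Gamma> k x) \<le> norm z + dist z (\<Gamma> k x)"
          using norm_triangle_ineq4[of z "z - \<Gamma> k x"] by (simp add: dist_norm)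
        ultimately show False using that by (simp add: P_def)
      qed
      then show ?thesis by blast
    qed (use ab in auto)
    then obtain v where v: "\<And>x. x \<in> P \<Longrightarrow> x \<le> v" by blast
    show ?thesis
      by (rule bounded_subset[OF bounded_closed_interval[of u v]]) (use u v in auto)
  qed
  ultimately have P: "compact P" by (simp add: compact_eq_bounded_closed)
  have pos: "0 < dist z (\<Gamma> k x)" if x: "x \<in> C" for x
  proof -
    \<comment> \<open>A finite end point is not on the open arc, but the deformation fixes it and it
      belongs to \<open>rest\<close>.\<close>
    have "\<Gamma> k x \<in> Z"
    proof (cases "x \<in> Delta S k")
      case True
      then show ?thesis using k by (auto simp: Z_def trace_of_def)
    next
      case False
      then have "x \<in> rest" using endpoints_rest[OF k] x by (simp add: C_def)
      moreover have "\<Gamma> k x = complex_of_real x"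
        using deformation(4)[OF k] x False by (auto simp: fixes_ends_def C_def Delta_def)
      ultimately show ?thesis by (auto simp: Z_def)
    qed
    then show ?thesis using z by auto
  qed
  have sub: "Delta S k \<subseteq> C" unfolding C_def by (rule closure_subset)
  show ?thesis
  proof (cases "P = {}")
    case True
    then show ?thesis
      using sub by (intro that[of 1]) (auto simp: P_def not_le intro: less_imp_le)
  next
    case False
    then obtain x\<^sub>0 where x\<^sub>0: "x\<^sub>0 \<in> P" "\<And>x. x \<in> P \<Longrightarrow> dist z (\<Gamma> k x\<^sub>0) \<le> dist z (\<Gamma> k x)"
      using continuous_attains_inf[OF P False continuous_on_subset[OF cont]] by (auto simp: P_def)
    have "min 1 (dist z (\<Gamma> k x\<^sub>0)) \<le> dist z (\<Gamma> k x)" if "x \<in> Delta S k" for x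
      using x\<^sub>0(2)[of x] that sub by (cases "x \<in> P") (auto simp: P_def)
    moreover have "0 < min 1 (dist z (\<Gamma> k x\<^sub>0))"
      using pos[of x\<^sub>0] x\<^sub>0(1) by (simp add: P_def)
    ultimately show ?thesis by (intro that) auto
  qed
qed

lemma Z_separated:
  assumes z: "z \<notin> Z"
  obtains r where "0 < r" "\<And>w. w \<in> Z \<Longrightarrow> r \<le> dist z w"
proof -
  have "complex_of_real ` rest = {w. Im w = 0} \<inter> Re -` rest"
    by (auto simp: complex_is_Real_iff[symmetric] image_iff) (metis Re_complex_of_real Reals_cases)
  moreover have "closed ({w. Im w = 0} \<inter> Re -` rest)"
    by (intro closed_Int closed_Collect_eq continuous_closed_vimage closed_rest continuous_intros)
  ultimately have "closed (complex_of_real ` rest)" by simp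
  moreover have "z \<notin> complex_of_real ` rest" using z by (simp add: Z_def)
  ultimately have "\<exists>r>0. \<forall>w\<in>complex_of_real ` rest. r \<le> dist z w"
    by (rule separate_point_closed)
  then obtain r where r: "0 < r" "\<And>w. w \<in> complex_of_real ` rest \<Longrightarrow> r \<le> dist z w"
    by (elim exE conjE) (rule that, assumption, erule bspec)
  have "\<exists>r>0. \<forall>x\<in>Delta S k. r \<le> dist z (\<Gamma> k x)" if k: "k \<in> I" for k
  proof -
    obtain r where "0 < r" "\<forall>x\<in>Delta S k. r \<le> dist z (\<Gamma> k x)"
      by (rule arc_separated[OF k z])
    then show ?thesis by (intro exI[of _ r]) simp
  qed
  then obtain f where f: "\<And>k. k \<in> I \<Longrightarrow> 0 < f k" "\<And>k x. k \<in> I \<Longrightarrow> x \<in> Delta S k \<Longrightarrow> f k \<le> dist z (\<Gamma> k x)"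
    by metis
  define m where "m = Min (insert r (f ` I))"
  have "m \<le> dist z w" if "w \<in> Z" for w
    using that unfolding Z_def trace_of_def
  proof
    assume "w \<in> complex_of_real ` rest"
    then show ?thesis
      using r(2) unfolding m_def by (meson Min_le finite.insertI finite_atLeastAtMost finite_imageI insertI1 order_trans)
  next
    assume "w \<in> (\<Union>k\<in>I. \<Gamma> k ` Delta S k)"
    then obtain k x where k: "k \<in> I" "x \<in> Delta S k" "w = \<Gamma> k x" by blast
    have "m \<le> f k"
      unfolding m_def using k(1) by (intro Min_le) auto
    then show ?thesis using f(2)[OF k(1,2)] k(3) by simp
  qed
  moreover have "0 < m"
    unfolding m_def using r(1) f(1) by (subst Min_gr_iff) auto
  ultimately show ?thesis by (intro that)
qed

lemma trace_in_Z: "k \<in> I \<Longrightarrow> x \<in> Delta S k \<Longrightarrow> \<Gamma> k x \<in> Z"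
  by (auto simp: Z_def trace_of_def)

lemma rest_in_Z: "x \<in> rest \<Longrightarrow> complex_of_real x \<in> Z"
  by (simp add: Z_def)

lemma Z_nonempty: "Z \<noteq> {}"
proof -
  have "1 \<in> I"
    using standing by (simp add: standing_assumptions_def spectral_assumptions_def)
  then show ?thesis using Delta_nonempty trace_in_Z by blast
qed

lemma Z_subset: "Z \<subseteq> sigma_rest S \<union> trace_of S \<Gamma>"
  by (auto simp: Z_def rest_def)

lemma clinear_KB_measure: "\<delta> \<in> sets borel \<Longrightarrow> clinear_op (KB_measure S \<delta>)"
  using standing clinear_op_adjoint
  unfolding KB_measure_def standing_assumptions_def operator_assumptions_def spectral_measure_of_def
    projection_measure_def
  by (intro clinear_op_compose) blast+

lemma strong_measure_KB: "strong_measure (KB_measure S)"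
  unfolding strong_measure_def
proof (intro allI impI)
  fix \<delta> :: "nat \<Rightarrow> real set" and x
  assume "range \<delta> \<subseteq> sets borel \<and> disjoint_family \<delta>"
  then have "(\<lambda>n. specE S (\<delta> n) (opB01 S x)) sums specE S (\<Union>n. \<delta> n) (opB01 S x)"
    using standing
    unfolding standing_assumptions_def operator_assumptions_def spectral_measure_of_def
      projection_measure_def by blast
  from bounded_linear.sums[OF blinfun.bounded_linear_right this, of "opB10 S"]
  show "(\<lambda>n. KB_measure S (\<delta> n) x) sums KB_measure S (\<Union>n. \<delta> n) x"
    by (simp add: KB_measure_def)
qed

lemma variation_le_KB: "variation_le (KB_measure S) rest (enn2real rest_variation)"
  unfolding variation_le_def
proof (intro allI impI)
  fix P assume P: "borel_partition rest P"
  define N where "N = card P"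
  have fin: "finite P" and sub: "\<And>p. p \<in> P \<Longrightarrow> p \<subseteq> rest" and UP: "\<Union>P = rest"
    and dis: "disjoint P" and PB: "P \<subseteq> sets borel"
    using P by (auto simp: borel_partition_def partition_on_def)
  obtain e where e: "bij_betw e {0..<N} P"
    using ex_bij_betw_nat_finite[OF fin] by (auto simp: N_def)
  have eP: "e n \<in> P" if "n < N" for n
    using e that by (auto simp: bij_betw_def)
  define spec where "spec = complex_of_real -` op_spectrum (opA0 S)"
  \<comment> \<open>The supremum in \<open>V0\<close> runs over sequences that partition the whole
    spectrum: the part outside \<open>rest\<close> is placed at index \<open>N\<close>, and empty
    sets follow.\<close>
  define \<delta> where "\<delta> n = (if n < N then e n else if n = N then spec - rest else {})" for n
  have "range \<delta> \<subseteq> sets borel"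
    using PB eP borel_closed[OF closed_rest] borel_closed[OF closed_spectrum]
    by (auto simp: \<delta>_def spec_def)
  moreover have "disjoint_family \<delta>"
    unfolding disjoint_family_on_def
  proof (intro ballI impI)
    fix m n :: nat assume "m \<noteq> n"
    have "e m \<inter> e n = {}" if "m < N" "n < N"
    proof -
      have "e m \<noteq> e n"
        using e that \<open>m \<noteq> n\<close> by (auto simp: bij_betw_def inj_on_def)
      then show ?thesis
        using dis eP[OF that(1)] eP[OF that(2)] by (auto simp: pairwise_def disjnt_def)
    qed
    then show "\<delta> m \<inter> \<delta> n = {}"
      using \<open>m \<noteq> n\<close> sub[OF eP, of m] sub[OF eP, of n] by (auto simp: \<delta>_def)
  qed
  moreover have "(\<Union>n. \<delta> n) = spec"
  proof -
    have "rest \<subseteq> spec" by (auto simp: rest_eq spec_def)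
    moreover have "(\<Union>n\<in>{0..<N}. e n) = rest"
      using e UP by (auto simp: bij_betw_def)
    moreover have "(\<Union>n. \<delta> n) = (\<Union>n\<in>{0..<N}. e n) \<union> (spec - rest)"
      by (auto simp: \<delta>_def split: if_splits)
    ultimately show ?thesis by blast
  qed
  ultimately have "(\<Sum>n. ennreal (norm (KB_measure S (\<delta> n \<inter> rest)))) \<le> rest_variation"
    unfolding rest_variation_def spec_def by (intro SUP_upper) auto
  moreover have "(\<Sum>n\<in>{0..<N}. ennreal (norm (KB_measure S (\<delta> n \<inter> rest))))
      \<le> (\<Sum>n. ennreal (norm (KB_measure S (\<delta> n \<inter> rest))))"
    by (rule sum_le_suminf) auto
  moreover have "(\<Sum>n\<in>{0..<N}. ennreal (norm (KB_measure S (\<delta> n \<inter> rest)))) = (\<Sum>n\<in>{0..<N}. ennreal (norm (KB_measure S (e n))))"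
    using sub eP by (intro sum.cong) (auto simp: \<delta>_def Int_absorb2)
  moreover have "\<dots> = (\<Sum>p\<in>P. ennreal (norm (KB_measure S p)))"
    by (rule sum.reindex_bij_betw[OF e])
  ultimately have "ennreal (\<Sum>p\<in>P. norm (KB_measure S p)) \<le> rest_variation"
    by simp
  from enn2real_mono[OF this variations_finite(1)]
  show "(\<Sum>p\<in>P. norm (KB_measure S p)) \<le> enn2real rest_variation"
    by (simp add: sum_nonneg)
qed

lemma Kp_extension:
  assumes k: "k \<in> I"
  obtains U where "open U" "complex_of_real ` Delta S k \<subseteq> U" "sheet S l k \<subseteq> U" "op_holomorphic_on (Kp S k) U"
proof -
  have "\<exists>U. open U \<and> Dm S k \<union> complex_of_real ` Delta S k \<union> cnj ` Dm S k \<subseteq> U \<and>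
           op_holomorphic_on (Kp S k) U"
    using standing k unfolding standing_assumptions_def analyticity_assumptions_def by blast
  then obtain U where "open U" "Dm S k \<union> complex_of_real ` Delta S k \<union> cnj ` Dm S k \<subseteq> U"
    "op_holomorphic_on (Kp S k) U" by (elim exE conjE)
  then show ?thesis
    by (intro that[of U]) (auto simp: sheet_def)
qed

lemma continuous_Kp_arc:
  assumes k: "k \<in> I"
  shows "continuous_on (Delta S k) (\<lambda>x. Kp S k (\<Gamma> k x))"
proof -
  obtain U where U: "sheet S l k \<subseteq> U" "op_holomorphic_on (Kp S k) U"
    using Kp_extension[OF k] by metis
  show ?thesis
    by (rule continuous_on_compose2[OF op_holomorphic_on_continuous[OF U(2)]
          continuous_on_subset[OF deformation(1)[OF k] closure_subset]])
      (use U(1) deformation(2)[OF k] in blast)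
qed

text \<open>The defect functional annihilates \<open>KB S t\<close> for every \<open>t\<close>, so
  it annihilates the derivative.\<close>

lemma clinear_Kp_real:
  assumes k: "k \<in> I" and \<mu>: "\<mu> \<in> Delta S k"
  shows "clinear_op (Kp S k (complex_of_real \<mu>))"
  unfolding clinear_op_def
proof (intro allI)
  fix c x
  define L where "L T = T (c *\<^sub>C x) - c *\<^sub>C T x" for T :: "'b \<Rightarrow>\<^sub>L 'b"
  have L: "bounded_linear L" unfolding L_def by (rule clinear_op_defect)
  have "(KB S has_vector_derivative Kp S k (complex_of_real \<mu>)) (at \<mu>)"
    using standing k \<mu> unfolding standing_assumptions_def analyticity_assumptions_def by blast
  from bounded_linear.has_vector_derivative[OF L this]
  have "((\<lambda>t. L (KB S t)) has_vector_derivative L (Kp S k (complex_of_real \<mu>))) (at \<mu>)" .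
  moreover have "L (KB S t) = 0" for t
    using clinear_KB_measure[of "{..<t}"] by (simp add: L_def KB_def clinear_op_def)
  ultimately have "((\<lambda>t. 0) has_vector_derivative L (Kp S k (complex_of_real \<mu>))) (at \<mu>)" by simp
  then have "L (Kp S k (complex_of_real \<mu>)) = 0"
    using vector_derivative_unique_at[OF _ has_vector_derivative_const] by blast
  then show "Kp S k (complex_of_real \<mu>) (c *\<^sub>C x) = c *\<^sub>C Kp S k (complex_of_real \<mu>) x"
    by (simp add: L_def)
qed

text \<open>Off the real line \<open>Kp\<close> is known only as a holomorphic continuation, so
  linearity is continued from the interval, which lies on the boundary of the sheet.\<close>

lemma clinear_Kp_arc:
  assumes k: "k \<in> I" and x: "x \<in> Delta S k"
  shows "clinear_op (Kp S k (\<Gamma> k x))"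
proof -
  obtain U where U: "open U" "complex_of_real ` Delta S k \<subseteq> U" "sheet S l k \<subseteq> U"
    "op_holomorphic_on (Kp S k) U"
    using Kp_extension[OF k] .
  have "(\<forall>k\<in>I. open (Dm S k)) \<and> (\<forall>k\<in>I. simply_connected (Dm S k)) \<and>
      (\<forall>k\<in>I. complex_of_real ` Delta S k \<subseteq> frontier (Dm S k))"
    using standing unfolding standing_assumptions_def analyticity_assumptions_def ball_conj_distrib
    by (elim conjE, intro conjI)
  then have Dm: "open (Dm S k)" "connected (Dm S k)" "complex_of_real ` Delta S k \<subseteq> frontier (Dm S k)"
    using k simply_connected_imp_connected by blast+
  have "open (cnj ` Dm S k)"
  proof -
    have "cnj ` Dm S k = cnj -` Dm S k" by (auto simp: image_iff) (metis complex_cnj_cnj)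
    then show ?thesis using Dm(1) by (simp add: open_vimage continuous_on_cnj)
  qed
  then have D: "open (sheet S l k)" "connected (sheet S l k)"
    using Dm(1,2) by (auto simp: sheet_def intro!: connected_continuous_image continuous_intros)
  obtain p where p: "p \<in> Delta S k" using Delta_nonempty[OF k] by blast
  have "complex_of_real p \<in> closure (Dm S k)"
    using Dm(3) p by (auto simp: frontier_def)
  then have "complex_of_real p \<in> closure (sheet S l k)"
    by (simp add: sheet_def closure_cnj)
  moreover have "open (Delta S k)" by (simp add: Delta_def)
  ultimately show ?thesis
    using clinear_op_analytic_continuation[OF U(4,1,2,3) D _ p _ clinear_Kp_real[OF k]]
      deformation(2)[OF k] x by blast
qed

section \<open>The combined integral against the measure and along the arcs\<close>

text \<open>Keeps the measure part and the arc parts visible, so that sums, compositions and bounds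
  can be proved part by part; \<open>has_KB_integral_imp\<close> then passes to the THE-based
  \<open>KB_integral\<close>.\<close>

definition has_KB_integral :: "(complex \<Rightarrow> 'b \<Rightarrow>\<^sub>L 'b) \<Rightarrow> 'b \<Rightarrow>\<^sub>L 'b \<Rightarrow> bool" where
  "has_KB_integral T J \<longleftrightarrow> (\<exists>J\<^sub>0 J\<^sub>1.
     has_op_integral (KB_measure S) rest (\<lambda>\<mu>. T (complex_of_real \<mu>)) J\<^sub>0 \<and>
     (\<forall>k\<in>I. has_line_integral (lo S k) (hi S k) (\<Gamma> k) (\<lambda>\<mu>. Kp S k \<mu> o\<^sub>L T \<mu>) (J\<^sub>1 k)) \<and>
     J = J\<^sub>0 + (\<Sum>k\<in>I. J\<^sub>1 k))"

lemma has_KB_integralE: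
  assumes "has_KB_integral T J"
  obtains J\<^sub>0 J\<^sub>1 where "has_op_integral (KB_measure S) rest (\<lambda>\<mu>. T (complex_of_real \<mu>)) J\<^sub>0"
    "\<forall>k\<in>I. has_line_integral (lo S k) (hi S k) (\<Gamma> k) (\<lambda>\<mu>. Kp S k \<mu> o\<^sub>L T \<mu>) (J\<^sub>1 k)"
    "J = J\<^sub>0 + (\<Sum>k\<in>I. J\<^sub>1 k)"
  using assms unfolding has_KB_integral_def by (elim exE conjE)

lemma has_KB_integral_exists:
  assumes T: "continuous_on Z T" and b: "\<And>\<mu>. \<mu> \<in> Z \<Longrightarrow> norm (T \<mu>) \<le> C"
  obtains J where "has_KB_integral T J"
proof -
  have "continuous_on rest (\<lambda>\<mu>. T (complex_of_real \<mu>))"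
    by (rule continuous_on_compose2[OF T]) (auto intro!: continuous_intros rest_in_Z)
  then obtain J\<^sub>0 where J\<^sub>0: "has_op_integral (KB_measure S) rest (\<lambda>\<mu>. T (complex_of_real \<mu>)) J\<^sub>0"
    by (rule has_op_integral_exists[OF strong_measure_KB variation_le_KB closed_rest])
      (auto intro!: b rest_in_Z)
  have "\<exists>J. has_line_integral (lo S k) (hi S k) (\<Gamma> k) (\<lambda>\<mu>. Kp S k \<mu> o\<^sub>L T \<mu>) J" if k: "k \<in> I" for k
  proof -
    note D = Delta_def[of S k, symmetric]
    have T': "continuous_on (Delta S k) (\<lambda>x. T (\<Gamma> k x))"
      by (rule continuous_on_compose2[OF T continuous_on_subset[OF deformation(1)[OF k] closure_subset]])
        (use k trace_in_Z in auto)
    have "0 \<le> C"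
      using b[OF trace_in_Z[OF k]] Delta_nonempty[OF k] norm_ge_zero order_trans by blast
    obtain J where "has_line_integral (lo S k) (hi S k) (\<Gamma> k) (\<lambda>\<mu>. Kp S k \<mu> o\<^sub>L T \<mu>) J"
    proof (rule has_line_integral_exists[where h = "\<lambda>\<mu>. norm (Kp S k \<mu>)" and \<gamma> = "\<Gamma> k" and c = C
            and a = "lo S k" and b = "hi S k" and F = "\<lambda>\<mu>. Kp S k \<mu> o\<^sub>L T \<mu>"], unfold D)
      show "continuous_on (Delta S k) (\<lambda>x. norm (Kp S k (\<Gamma> k x)))"
        by (intro continuous_on_norm continuous_Kp_arc k)
      show "continuous_on (Delta S k) (\<lambda>x. Kp S k (\<Gamma> k x) o\<^sub>L T (\<Gamma> k x))"
        by (intro bounded_bilinear.continuous_on[OF bounded_bilinear_blinfun_compose] continuous_Kp_arc k T')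
      show "arc_length_integral (lo S k) (hi S k) (\<Gamma> k) (\<lambda>\<mu>. norm (Kp S k \<mu>)) < \<infinity>"
        using variations_finite(2)[OF k] by (simp add: arc_variation_def)
      show "norm (Kp S k (\<Gamma> k x) o\<^sub>L T (\<Gamma> k x)) \<le> C * norm (Kp S k (\<Gamma> k x))" if "x \<in> Delta S k" for x
        using mult_left_mono[OF b[OF trace_in_Z[OF k that]] norm_ge_zero[of "Kp S k (\<Gamma> k x)"]]
          norm_blinfun_compose[of "Kp S k (\<Gamma> k x)" "T (\<Gamma> k x)"] by (simp add: mult.commute)
    qed (use Delta_nonempty[OF k] deformation(3)[OF k] \<open>0 \<le> C\<close> in auto)
    then show ?thesis ..
  qed
  then obtain J\<^sub>1 where "\<forall>k\<in>I. has_line_integral (lo S k) (hi S k) (\<Gamma> k) (\<lambda>\<mu>. Kp S k \<mu> o\<^sub>L T \<mu>) (J\<^sub>1 k)"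
    by metis
  then show ?thesis
    using J\<^sub>0 by (intro that) (auto simp: has_KB_integral_def)
qed

lemma has_KB_integral_imp:
  assumes "has_KB_integral T J"
  shows "KB_integrable S \<Gamma> T" "KB_integral S \<Gamma> T = J"
proof -
  obtain J\<^sub>0 J\<^sub>1 where J: "has_op_integral (KB_measure S) rest (\<lambda>\<mu>. T (complex_of_real \<mu>)) J\<^sub>0"
    "\<forall>k\<in>I. has_line_integral (lo S k) (hi S k) (\<Gamma> k) (\<lambda>\<mu>. Kp S k \<mu> o\<^sub>L T \<mu>) (J\<^sub>1 k)"
    "J = J\<^sub>0 + (\<Sum>k\<in>I. J\<^sub>1 k)"
    by (rule has_KB_integralE[OF assms])
  show "KB_integrable S \<Gamma> T"
    unfolding KB_integrable_def rest_def[symmetric] using J by blast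
  show "KB_integral S \<Gamma> T = J"
    unfolding KB_integral_def rest_def[symmetric] J(3)
    using op_integral_eq[OF J(1)] line_integral_eq[OF J(2)[THEN bspec]] by simp
qed

lemma has_KB_integral_add:
  assumes "has_KB_integral T J" "has_KB_integral T' J'"
  shows "has_KB_integral (\<lambda>\<mu>. T \<mu> + T' \<mu>) (J + J')"
proof -
  obtain J\<^sub>0 J\<^sub>1 where J: "has_op_integral (KB_measure S) rest (\<lambda>\<mu>. T (complex_of_real \<mu>)) J\<^sub>0"
    "\<forall>k\<in>I. has_line_integral (lo S k) (hi S k) (\<Gamma> k) (\<lambda>\<mu>. Kp S k \<mu> o\<^sub>L T \<mu>) (J\<^sub>1 k)"
    "J = J\<^sub>0 + (\<Sum>k\<in>I. J\<^sub>1 k)"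
    by (rule has_KB_integralE[OF assms(1)])
  obtain J\<^sub>0' J\<^sub>1' where J': "has_op_integral (KB_measure S) rest (\<lambda>\<mu>. T' (complex_of_real \<mu>)) J\<^sub>0'"
    "\<forall>k\<in>I. has_line_integral (lo S k) (hi S k) (\<Gamma> k) (\<lambda>\<mu>. Kp S k \<mu> o\<^sub>L T' \<mu>) (J\<^sub>1' k)"
    "J' = J\<^sub>0' + (\<Sum>k\<in>I. J\<^sub>1' k)"
    by (rule has_KB_integralE[OF assms(2)])
  show ?thesis
    unfolding has_KB_integral_def
    using has_op_integral_add[OF J(1) J'(1)] has_line_integral_add[OF J(2)[THEN bspec] J'(2)[THEN bspec]] J(3) J'(3)
    by (intro exI[of _ "J\<^sub>0 + J\<^sub>0'"] exI[of _ "\<lambda>k. J\<^sub>1 k + J\<^sub>1' k"])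
      (simp add: sum.distrib bounded_bilinear.add_right[OF bounded_bilinear_blinfun_compose])
qed

lemma has_KB_integral_compose_right:
  assumes "has_KB_integral T J"
  shows "has_KB_integral (\<lambda>\<mu>. T \<mu> o\<^sub>L Q) (J o\<^sub>L Q)"
proof -
  obtain J\<^sub>0 J\<^sub>1 where J: "has_op_integral (KB_measure S) rest (\<lambda>\<mu>. T (complex_of_real \<mu>)) J\<^sub>0"
    "\<forall>k\<in>I. has_line_integral (lo S k) (hi S k) (\<Gamma> k) (\<lambda>\<mu>. Kp S k \<mu> o\<^sub>L T \<mu>) (J\<^sub>1 k)"
    "J = J\<^sub>0 + (\<Sum>k\<in>I. J\<^sub>1 k)"
    by (rule has_KB_integralE[OF assms])
  have assoc: "Kp S k \<mu> o\<^sub>L (T \<mu> o\<^sub>L Q) = (Kp S k \<mu> o\<^sub>L T \<mu>) o\<^sub>L Q" for k \<mu>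
    by (rule blinfun_eqI) simp
  have "has_line_integral (lo S k) (hi S k) (\<Gamma> k) (\<lambda>\<mu>. Kp S k \<mu> o\<^sub>L (T \<mu> o\<^sub>L Q)) (J\<^sub>1 k o\<^sub>L Q)"
    if "k \<in> I" for k
    unfolding assoc
    by (rule has_line_integral_linear[OF J(2)[THEN bspec, OF that], of "\<lambda>A. A o\<^sub>L Q"])
      (rule bounded_bilinear.bounded_linear_left[OF bounded_bilinear_blinfun_compose]
        scaleC_blinfun_compose)+
  then show ?thesis
    unfolding has_KB_integral_def
    using has_op_integral_compose_right[OF J(1)] J(3)
    by (intro exI[of _ "J\<^sub>0 o\<^sub>L Q"] exI[of _ "\<lambda>k. J\<^sub>1 k o\<^sub>L Q"])
      (simp add: blinfun_compose_right_distribs bounded_bilinear.sum_left[OF bounded_bilinear_blinfun_compose])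
qed

lemma has_KB_integral_norm_le:
  assumes "has_KB_integral T J" and b: "\<And>\<mu>. \<mu> \<in> Z \<Longrightarrow> norm (T \<mu>) \<le> C"
  shows "norm J \<le> C * enn2real (V0 S \<Gamma>)"
proof -
  obtain J\<^sub>0 J\<^sub>1 where J: "has_op_integral (KB_measure S) rest (\<lambda>\<mu>. T (complex_of_real \<mu>)) J\<^sub>0"
    "\<forall>k\<in>I. has_line_integral (lo S k) (hi S k) (\<Gamma> k) (\<lambda>\<mu>. Kp S k \<mu> o\<^sub>L T \<mu>) (J\<^sub>1 k)"
    "J = J\<^sub>0 + (\<Sum>k\<in>I. J\<^sub>1 k)"
    by (rule has_KB_integralE[OF assms(1)])
  have C: "0 \<le> C" using b Z_nonempty norm_ge_zero order_trans by blast
  have "norm J\<^sub>0 \<le> C * enn2real rest_variation"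
    by (rule has_op_integral_norm_le[OF J(1) variation_le_KB C]) (intro b rest_in_Z)
  moreover have "norm (J\<^sub>1 k) \<le> C * enn2real (arc_variation k)" if k: "k \<in> I" for k
    unfolding arc_variation_def
  proof (rule has_line_integral_norm_le[OF J(2)[THEN bspec, OF k]], unfold Delta_def[of S k, symmetric])
    show "continuous_on (Delta S k) (\<lambda>x. norm (Kp S k (\<Gamma> k x)))"
      by (intro continuous_on_norm continuous_Kp_arc k)
    show "arc_length_integral (lo S k) (hi S k) (\<Gamma> k) (\<lambda>\<mu>. norm (Kp S k \<mu>)) < \<infinity>"
      using variations_finite(2)[OF k] by (simp add: arc_variation_def)
    show "norm (Kp S k (\<Gamma> k x) o\<^sub>L T (\<Gamma> k x)) \<le> C * norm (Kp S k (\<Gamma> k x))" if "x \<in> Delta S k" for x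
      using mult_left_mono[OF b[OF trace_in_Z[OF k that]] norm_ge_zero[of "Kp S k (\<Gamma> k x)"]]
        norm_blinfun_compose[of "Kp S k (\<Gamma> k x)" "T (\<Gamma> k x)"] by (simp add: mult.commute)
  qed (use deformation(3)[OF k] C in auto)
  ultimately have "norm J \<le> C * enn2real rest_variation + (\<Sum>k\<in>I. C * enn2real (arc_variation k))"
    unfolding J(3) by (intro norm_triangle_mono sum_norm_le)
  then show ?thesis
    by (simp add: enn2real_V0 distrib_left sum_distrib_left)
qed

lemma has_KB_integral_clinear:
  assumes "has_KB_integral T J" and T: "\<And>\<mu>. \<mu> \<in> Z \<Longrightarrow> clinear_op (T \<mu>)"
  shows "clinear_op J"
proof -
  obtain J\<^sub>0 J\<^sub>1 where J: "has_op_integral (KB_measure S) rest (\<lambda>\<mu>. T (complex_of_real \<mu>)) J\<^sub>0"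
    "\<forall>k\<in>I. has_line_integral (lo S k) (hi S k) (\<Gamma> k) (\<lambda>\<mu>. Kp S k \<mu> o\<^sub>L T \<mu>) (J\<^sub>1 k)"
    "J = J\<^sub>0 + (\<Sum>k\<in>I. J\<^sub>1 k)"
    by (rule has_KB_integralE[OF assms(1)])
  have "clinear_op (J\<^sub>1 k)" if k: "k \<in> I" for k
    by (rule has_line_integral_clinear[OF J(2)[THEN bspec, OF k]], unfold Delta_def[of S k, symmetric])
      (intro clinear_op_compose clinear_Kp_arc T trace_in_Z k; assumption)
  moreover have "clinear_op J\<^sub>0"
    by (rule has_op_integral_clinear[OF J(1) clinear_KB_measure]) (auto intro: T rest_in_Z)
  ultimately show ?thesis
    unfolding J(3) by (intro clinear_op_add clinear_op_sum)
qed

end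

section \<open>The factorization\<close>

theorem theorem3:
  fixes S :: "('a::complex_hilbert, 'b::complex_hilbert) block_data"
    and l :: "nat \<Rightarrow> int"
    and \<Gamma> :: "nat \<Rightarrow> real \<Rightarrow> complex"
    and X :: "'b \<Rightarrow>\<^sub>L 'b"
    and H :: "'b opgraph"
    and z :: complex
  assumes "standing_assumptions S"
    and "sign_vector S l"
    and "contour S l \<Gamma>"
    and "KB_bounded S \<Gamma>"
    and "V0 S \<Gamma> < ennreal ((d0 S \<Gamma>)\<^sup>2 / 4)"
    and "basic_solution S \<Gamma> X"
    and "H = op_add (opA1 S) X"
    and "z \<notin> sigma_rest S \<union> trace_of S \<Gamma>"
  shows "KB_integrable S \<Gamma> (\<lambda>\<mu>. (1 / (z - \<mu>)) *\<^sub>C id_blinfun)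
    \<and> KB_integrable S \<Gamma> (\<lambda>\<mu>. (1 / (\<mu> - z)) *\<^sub>C resolvent H \<mu>)
    \<and> clinear_op (W1 S \<Gamma> H z)
    \<and> M1 S \<Gamma> z = op_comp (W1 S \<Gamma> H z) (op_shift H z)
    \<and> (setdist {z} (op_spectrum (opA1 S)) \<le> d0 S \<Gamma> / 2 \<longrightarrow>
         0 < 1 - enn2real (V0 S \<Gamma>) / ((d0 S \<Gamma>)\<^sup>2 / 4)
         \<and> (\<exists>R. clinear_op R \<and> W1 S \<Gamma> H z o\<^sub>L R = id_blinfun \<and> R o\<^sub>L W1 S \<Gamma> H z = id_blinfun
              \<and> norm R \<le> inverse (1 - enn2real (V0 S \<Gamma>) / ((d0 S \<Gamma>)\<^sup>2 / 4))))"
proof -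
  interpret bounded_contour S l \<Gamma>
    by unfold_locales (use assms in auto)
  define d where "d = d0 S \<Gamma>"
  define v where "v = enn2real (V0 S \<Gamma>)"
  have v0: "0 \<le> v" by (simp add: v_def)
  \<comment> \<open>A nonpositive bound would be 0 as an \<open>ennreal\<close>, and no value lies
    below 0.\<close>
  have "0 < d\<^sup>2 / 4"
    using assms(5) unfolding d_def by (metis ennreal_neg ennreal_0 not_less zero_le linorder_not_le)
  moreover have "0 \<le> d" by (simp add: d_def d0_def setdist_pos_le)
  ultimately have d: "0 < d" by (cases "d = 0") auto
  have v: "v < d\<^sup>2 / 4"
    using assms(5) unfolding v_def d_def by (metis enn2real_less_iff ennreal_less_top less_trans zero_le_power2 zero_le_divide_iff zero_le_numeral)
  have X: "clinear_op X" "V1_op S \<Gamma> H = X" "norm X < d / 2"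
  proof -
    show "clinear_op X" "V1_op S \<Gamma> H = X"
      using assms(6,7) by (auto simp: basic_solution_def)
    have "norm X \<le> d / 2 - sqrt (d\<^sup>2 / 4 - v)"
      using assms(6) by (simp add: basic_solution_def r_min_def d_def v_def)
    \<comment> \<open>Strictness of the bound on \<open>V0\<close> makes the root positive, and so
      \<open>norm X\<close> is strictly below \<open>d / 2\<close>.\<close>
    moreover have "0 < sqrt (d\<^sup>2 / 4 - v)" using v by simp
    ultimately show "norm X < d / 2" by linarith
  qed
  have dist_d: "d \<le> dist s \<mu>" if "\<mu> \<in> Z" "s \<in> op_spectrum (opA1 S)" for \<mu> s
    unfolding d_def d0_def using that Z_subset by (intro setdist_le_dist) auto
  have sa: "self_adjoint_op (opA1 S)"
    using assms(1) by (simp add: standing_assumptions_def operator_assumptions_def)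
  have resH: "is_resolvent H \<mu> (resolvent H \<mu>) \<and> norm (resolvent H \<mu>) \<le> 2 / d" if \<mu>: "\<mu> \<in> Z" for \<mu>
  proof -
    let ?R = "resolvent (opA1 S) \<mu>"
    have R: "is_resolvent (opA1 S) \<mu> ?R" "norm ?R \<le> 1 / d"
      using self_adjoint_resolvent_bound[OF sa d dist_d[OF \<mu>]] by blast+
    have "norm (X o\<^sub>L ?R) \<le> d / 2 * (1 / d)"
      using X(3) R(2) d by (intro order_trans[OF norm_blinfun_compose] mult_mono) auto
    then have small: "norm (X o\<^sub>L ?R) \<le> 1 / 2" using d by simp
    then have lt: "norm (X o\<^sub>L ?R) < 1" by linarith
    obtain Q where Q: "is_resolvent H \<mu> Q" "norm Q \<le> norm ?R / (1 - norm (X o\<^sub>L ?R))"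
      unfolding assms(7) using is_resolvent_perturbed[OF R(1) X(1) lt] .
    have "norm ?R / (1 - norm (X o\<^sub>L ?R)) \<le> (1 / d) / (1 / 2)"
      using R(2) small d by (intro frac_le) auto
    then have "norm Q \<le> 2 / d" using Q(2) by simp
    then show ?thesis
      using Q(1) is_resolvent_imp_resolvent[OF Q(1)] by simp
  qed
  have cont: "continuous_on Z (resolvent H)"
    by (rule continuous_on_resolvent[of _ _ "2 / d"]) (use resH in auto)
  have zZ: "z \<notin> Z" using assms(8) Z_subset by blast
  obtain r where r: "0 < r" "\<And>w. w \<in> Z \<Longrightarrow> r \<le> dist z w"
    using Z_separated[OF zZ] by blast
  define T1 where "T1 = (\<lambda>\<mu>. (1 / (z - \<mu>)) *\<^sub>C (id_blinfun :: 'b \<Rightarrow>\<^sub>L 'b))"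
  define T2 where "T2 = (\<lambda>\<mu>. (1 / (\<mu> - z)) *\<^sub>C resolvent H \<mu>)"
  have cont1: "continuous_on Z T1"
    unfolding T1_def using zZ by (intro scaleC.continuous_on continuous_intros) auto
  have cont2: "continuous_on Z T2"
    unfolding T2_def using zZ by (intro scaleC.continuous_on continuous_intros cont) auto
  have inv_le: "cmod (1 / (\<mu> - z)) \<le> 1 / \<rho>" if "0 < \<rho>" "\<rho> \<le> dist z \<mu>" for \<mu> \<rho>
    using that by (simp add: norm_divide dist_norm norm_minus_commute frac_le)
  have bound1: "norm (T1 \<mu>) \<le> 1 / r" if "\<mu> \<in> Z" for \<mu>
  proof -
    have "norm (T1 \<mu>) \<le> cmod (1 / (\<mu> - z)) * 1"
      unfolding T1_def norm_scaleC norm_divide norm_minus_commute[of z]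
      by (intro mult_left_mono norm_blinfun_id_le) simp
    then show ?thesis using inv_le[OF r(1) r(2)[OF that]] by simp
  qed
  \<comment> \<open>The radius is kept free: \<open>r\<close> serves for existence at every
    admissible \<open>z\<close>, while \<open>d / 2\<close> gives the sharp estimate when
    \<open>z\<close> is close to the spectrum of \<open>opA1 S\<close>.\<close>
  have bound2: "norm (T2 \<mu>) \<le> 1 / \<rho> * (2 / d)" if "\<mu> \<in> Z" "0 < \<rho>" "\<rho> \<le> dist z \<mu>" for \<mu> \<rho>
    unfolding T2_def norm_scaleC using inv_le[OF that(2,3)] resH[OF that(1)] that(2)
    by (intro mult_mono) auto
  obtain J1 where J1: "has_KB_integral T1 J1"
    using has_KB_integral_exists[OF cont1 bound1] by blast
  obtain J2 where J2: "has_KB_integral T2 J2"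
    using has_KB_integral_exists[OF cont2 bound2[OF _ r]] by blast
  obtain JH where JH: "has_KB_integral (resolvent H) JH"
    using has_KB_integral_exists[OF cont] resH by blast
  have JHX: "JH = X"
    using has_KB_integral_imp(2)[OF JH] X(2) by (simp add: V1_op_def)
  have V1: "V1 S \<Gamma> z = J1"
    using has_KB_integral_imp(2)[OF J1] by (simp add: V1_def T1_def)
  have W1: "W1 S \<Gamma> H z = id_blinfun - J2"
    using has_KB_integral_imp(2)[OF J2] by (simp add: W1_def T2_def)
  have clW: "clinear_op (W1 S \<Gamma> H z)"
    unfolding W1
  proof (intro clinear_op_diff clinear_op_id has_KB_integral_clinear[OF J2])
    show "clinear_op (T2 \<mu>)" if "\<mu> \<in> Z" for \<mu>
      unfolding T2_def using resH[OF that] by (intro clinear_op_scaleC) (simp add: is_resolvent_def)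
  qed

  obtain \<mu>\<^sub>0 where \<mu>\<^sub>0: "\<mu>\<^sub>0 \<in> Z" using Z_nonempty by blast
  define R0 where "R0 = resolvent H \<mu>\<^sub>0"
  \<comment> \<open>\<open>Q\<close> is the bounded form of \<open>(H - z) R0\<close>, by
    \<open>(H - \<mu>) R0 = I\<close> at the chosen base point. Every vector in the domain of
    \<open>H\<close> is some \<open>R0 w\<close>, so nothing is lost by working with
    \<open>Q\<close>.\<close>
  define Q where "Q = id_blinfun + (\<mu>\<^sub>0 - z) *\<^sub>C R0"
  have R0: "is_resolvent H \<mu>\<^sub>0 R0" using resH[OF \<mu>\<^sub>0] by (simp add: R0_def)
  have T2Q: "T2 \<mu> o\<^sub>L Q = (resolvent H \<mu> o\<^sub>L R0) - (T1 \<mu> o\<^sub>L R0)" if \<mu>: "\<mu> \<in> Z" for \<mu>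
  proof (rule blinfun_eqI)
    fix x
    let ?R = "resolvent H \<mu>"
    have "?R - R0 = (\<mu> - \<mu>\<^sub>0) *\<^sub>C (?R o\<^sub>L R0)"
      by (rule resolvent_identity) (use resH[OF \<mu>] R0 in auto)
    then have "?R x - R0 x = (\<mu> - \<mu>\<^sub>0) *\<^sub>C ?R (R0 x)"
      by (metis blinfun.diff_left blinfun_apply_blinfun_compose scaleC_blinfun_apply)
    then have id: "?R x = R0 x + (\<mu> - \<mu>\<^sub>0) *\<^sub>C ?R (R0 x)"
      by (simp add: algebra_simps)
    have "?R (Q x) = ?R x + (\<mu>\<^sub>0 - z) *\<^sub>C ?R (R0 x)"
      using resH[OF \<mu>] by (simp add: Q_def is_resolvent_def clinear_op_def blinfun.add_left blinfun.add_right)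
    also have "\<dots> = R0 x + ((\<mu> - \<mu>\<^sub>0) *\<^sub>C ?R (R0 x) + (\<mu>\<^sub>0 - z) *\<^sub>C ?R (R0 x))"
      unfolding id by (simp only: add.assoc)
    also have "\<dots> = R0 x + (\<mu> - z) *\<^sub>C ?R (R0 x)"
      by (simp flip: scaleC_add_left)
    finally have eq: "?R (Q x) = R0 x + (\<mu> - z) *\<^sub>C ?R (R0 x)" .
    have "\<mu> \<noteq> z" using \<mu> zZ by auto
    then have "T2 \<mu> (Q x) = (1 / (\<mu> - z)) *\<^sub>C R0 x + ?R (R0 x)"
      by (simp add: T2_def eq scaleC_add_right scaleC_scaleC)
    moreover have "1 / (\<mu> - z) = - (1 / (z - \<mu>))"
      by (metis minus_diff_eq minus_divide_right)
    ultimately show "(T2 \<mu> o\<^sub>L Q) x = ((?R o\<^sub>L R0) - (T1 \<mu> o\<^sub>L R0)) x"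
      by (simp add: T1_def blinfun.diff_left scaleC.minus_left)
  qed
  have J2Q: "J2 o\<^sub>L Q = (X o\<^sub>L R0) - (J1 o\<^sub>L R0)"
  proof -
    \<comment> \<open>This combination vanishes on \<open>Z\<close> by \<open>T2Q\<close>, so the
      norm estimate with constant 0 forces its integral \<open>?I\<close> to be 0. The signs are
      moved into the right factors so that only sums and right compositions of integrals
      occur.\<close>
    let ?D = "\<lambda>\<mu>. ((T2 \<mu> o\<^sub>L (- Q)) + (resolvent H \<mu> o\<^sub>L R0)) + (T1 \<mu> o\<^sub>L (- R0))"
    let ?I = "((J2 o\<^sub>L (- Q)) + (X o\<^sub>L R0)) + (J1 o\<^sub>L (- R0))"
    have "has_KB_integral ?D ?I"
      using J1 J2 JH unfolding JHX
      by (intro has_KB_integral_add has_KB_integral_compose_right)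
    moreover have neg: "A o\<^sub>L (- B) = - (A o\<^sub>L B)" for A B :: "'b \<Rightarrow>\<^sub>L 'b"
      by (rule bounded_bilinear.minus_right[OF bounded_bilinear_blinfun_compose])
    then have "norm (?D \<mu>) \<le> 0" if "\<mu> \<in> Z" for \<mu>
      using T2Q[OF that] by simp
    ultimately have "norm ?I \<le> 0 * enn2real (V0 S \<Gamma>)"
      by (rule has_KB_integral_norm_le)
    then have "?I = 0" by simp
    then show ?thesis by (simp add: neg algebra_simps)
  qed
  have fact: "W1 S \<Gamma> H z (y - z *\<^sub>C x) = y - z *\<^sub>C x - X x + V1 S \<Gamma> z x" if xy: "(x, y) \<in> H" for x y
  proof -
    \<comment> \<open>With this \<open>w\<close> one has \<open>x = R0 w\<close> and
      \<open>Q w = (H - z) x\<close>, so evaluating \<open>J2Q\<close> at \<open>w\<close> returns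
      from \<open>Q\<close> to the unbounded operator.\<close>
    define w where "w = y - \<mu>\<^sub>0 *\<^sub>C x"
    have x: "R0 w = x" using R0 xy by (simp add: is_resolvent_iff w_def)
    have "Q w = y - z *\<^sub>C x"
      unfolding Q_def blinfun.add_left scaleC_blinfun_apply x
      by (simp add: w_def scaleC.diff_left)
    then have "J2 (y - z *\<^sub>C x) = X x - J1 x"
      using arg_cong[OF J2Q, of "\<lambda>A. blinfun_apply A w"] by (simp add: blinfun.diff_left x)
    then show ?thesis
      by (simp add: W1 V1 blinfun.diff_left)
  qed
  have factorization: "M1 S \<Gamma> z = op_comp (W1 S \<Gamma> H z) (op_shift H z)"
  proof -
    have eq: "W1 S \<Gamma> H z (y + X x - z *\<^sub>C x) = y - z *\<^sub>C x + V1 S \<Gamma> z x" if "(x, y) \<in> opA1 S" for x y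
    proof -
      have "(x, y + X x) \<in> H" using that unfolding assms(7) op_add_def by blast
      from fact[OF this] show ?thesis by simp
    qed
    have "M1 S \<Gamma> z = {(x, y - z *\<^sub>C x + V1 S \<Gamma> z x) | x y. (x, y) \<in> opA1 S}"
      unfolding M1_def op_add_def op_shift_def by blast
    also have "\<dots> = {(x, W1 S \<Gamma> H z (y + X x - z *\<^sub>C x)) | x y. (x, y) \<in> opA1 S}"
      using eq by (intro Collect_cong) metis
    also have "\<dots> = op_comp (W1 S \<Gamma> H z) (op_shift H z)"
      unfolding assms(7) op_comp_def op_add_def op_shift_def by blast
    finally show ?thesis .
  qed
  have invertible: "0 < 1 - v / (d\<^sup>2 / 4) \<and> (\<exists>R. clinear_op R \<and> W1 S \<Gamma> H z o\<^sub>L R = id_blinfun \<and>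
      R o\<^sub>L W1 S \<Gamma> H z = id_blinfun \<and> norm R \<le> inverse (1 - v / (d\<^sup>2 / 4)))"
    if near: "setdist {z} (op_spectrum (opA1 S)) \<le> d / 2"
  proof -
    have q: "0 < 1 - v / (d\<^sup>2 / 4)"
      using v d by (simp add: divide_less_eq)
    have far: "d / 2 \<le> dist z \<mu>" if \<mu>: "\<mu> \<in> Z" for \<mu>
    proof -
      \<comment> \<open>\<open>setdist\<close> is 0 when one of its sets is empty, so
        \<open>0 < d\<close> excludes that case; nonemptiness is required to bound a
        \<open>setdist\<close> from below.\<close>
      have ne: "op_spectrum (opA1 S) \<noteq> {}"
        using d by (auto simp: d_def d0_def)
      have "d - dist z \<mu> \<le> setdist {z} (op_spectrum (opA1 S))"
      proof (rule le_setdistI)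
        show "d - dist z \<mu> \<le> dist x s" if "x \<in> {z}" "s \<in> op_spectrum (opA1 S)" for x s
          using dist_d[OF \<mu> that(2)] dist_triangle[of s \<mu> z] that(1) by (simp add: dist_commute)
      qed (use ne in auto)
      then show ?thesis using near by linarith
    qed
    have "norm J2 \<le> 1 / (d / 2) * (2 / d) * v"
      unfolding v_def using bound2[of _ "d / 2"] far d by (intro has_KB_integral_norm_le[OF J2]) auto
    also have "\<dots> = v / (d\<^sup>2 / 4)"
      using d by (simp add: power2_eq_square)
    finally have J2v: "norm J2 \<le> v / (d\<^sup>2 / 4)" .
    then have "norm J2 < 1" using q by linarith
    then obtain R where R: "(id_blinfun - J2) o\<^sub>L R = id_blinfun" "R o\<^sub>L (id_blinfun - J2) = id_blinfun"
      "norm R \<le> inverse (1 - norm J2)"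
      by (rule neumann_inverse)
    have "inverse (1 - norm J2) \<le> inverse (1 - v / (d\<^sup>2 / 4))"
      using J2v q by (intro le_imp_inverse_le) auto
    then show ?thesis
      using q R clinear_op_inverse[OF clW] by (auto simp: W1 intro!: exI[of _ R])
  qed
  show ?thesis
    using has_KB_integral_imp(1)[OF J1] has_KB_integral_imp(1)[OF J2] clW factorization invertible
    unfolding T1_def T2_def d_def v_def by blast
qed

end
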